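(* Let $d\in\mathbb N$, $s>0$, $p\in[1,\infty)$, $\gamma\in(-\infty,d]$, and let $b_T$ be a $B_p^s$-random variable with wavelet density $\beta=2^{\gamma-d}$ (see context). Then: 1.) For all $t>0$ and $q\ge 1$ such that $t< s+\frac{d-\gamma}{q}-\frac dp$ it holds that $b_T\in L^q(\Omega;B^t_q)$, and hence $b_T\in B^t_q$ $P$-almost surely. 2.) Let $s-\frac dp>0$ and $t\in(0,s-\frac dp)$. Then there is an $\varepsilon_p>0$ such that $$\mathbb E\left(\exp\left(\varepsilon\|b_T\|_{\mathcal C^t}^p\right)\right)<\infty,\qquad \varepsilon\in(0,\varepsilon_p).$$ In particular, $b_T\in L^q(\Omega;\mathcal C^t)$ for any $q\ge1$. 3.) Let $q\ge1$ and $s-\frac dp-\frac{\min(\gamma,0)}{q}>0$. Then for any $t\in\left(0,s-\frac dp-\frac{\min(\gamma,0)}{q}\right)$ it holds that $b_T\in L^q(\Omega;\mathcal C^t)$.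
   Context: Wavelets. $\mathbb T^d=[0,1]^d$ is the $d$-dimensional torus (functions on it are identified with one-periodic functions on $\mathbb R^d$). Let $\phi,\psi\in \mathrm C^{\alpha}(\mathbb R)$, $\alpha\ge1$, $\alpha\ge s$, be compactly supported scaling and wavelet functions of an orthonormal multiresolution analysis of $L^2(\mathbb R)$, with $\|\phi\|_{L^2}=\|\psi\|_{L^2}=1$ and $\int_{\mathbb R}\psi(x)x^m\,dx=0$ for $m\in\mathbb N_0$, $m<\alpha$. Put $\psi_{j,k,0}(x)=\phi(2^jx-k)$, $\psi_{j,k,1}(x)=\psi(2^jx-k)$ for $j\in\mathbb N_0$, $k\in\mathbb Z$. Let $\mathcal L_0=\{0,1\}^d$, $\mathcal L_j=\mathcal L_0\setminus\{(0,\dots,0)\}$ for $j\ge1$, $K_j=\{k\in\mathbb Z^d: 0\le k_1,\dots,k_d<2^j\}$, and for $l\in\mathcal L_j$, $k\in K_j$ let $\psi_{j,k,l}(x)=2^{dj/2}\prod_{i=1}^d\psi_{j,k_i,l(i)}(x_i)$ on $\mathbb R^d$ and $\psi_{j,k}^l(x)=\sum_{n\in\mathbb Z^d}\psi_{j,k,l}(x-n)$ for $x\in\mathbb T^d$. With $\mathcal I_{\mathbf\Psi}=\{(j,k,l): j\in\mathbb N_0,k\in K_j,l\in\mathcal L_j\}$, the family $\mathbf\Psi=(\psi_{j,k}^l)_{(j,k,l)\in\mathcal I_{\mathbf\Psi}}$ is an orthonormal basis of $L^2(\mathbb T^d)$. Besov norms. For $t>0$ and $q\in[1,\infty)$, $\|\varphi\|_{B^t_q}=\big(\sum_{(j,k,l)\in\mathcal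 I_{\mathbf\Psi}}2^{jq(t+\frac d2-\frac dq)}|(\varphi,\psi_{j,k}^l)_{L^2(\mathbb T^d)}|^q\big)^{1/q}$, and $\|\varphi\|_{B^t_\infty}=\sup_{(j,k,l)\in\mathcal I_{\mathbf\Psi}}2^{j(t+\frac d2)}|(\varphi,\psi_{j,k}^l)_{L^2(\mathbb T^d)}|$; $B^t_q=B^t_{q,q}(\mathbb T^d)$ is the set of distributions on $\mathbb T^d$ with finite norm. $\mathcal C^t=B^t_\infty$ is the Hölder–Zygmund space of smoothness $t$ on $\mathbb T^d$. Galton–Watson trees. Let $\mathcal U=\bigcup_{n\ge0}\mathbb N^n$ be the finite sequences of positive integers, $\varrho=()$ the empty sequence, $|\mathfrak n|$ the length of $\mathfrak n$. A tree is a subset $\mathbf t\subset\mathcal U$ that contains $\varrho$, contains every proper prefix (ancestor) of each of its elements, and such that for each $\mathfrak n\in\mathbf t$ there is $\mathfrak K_{\mathfrak n}(\mathbf t)\in\mathbb N_0\cup\{\infty\}$ with: for $i\in\mathbb N$, $\mathfrak n i\in\mathbf t$ iff $1\le i\le\mathfrak K_{\mathfrak n}(\mathbf t)$. $\mathfrak T$ is the set of all trees with all $\mathfrak K_{\mathfrak n}(\mathbf t)<\infty$, with metric $\delta_{\mathfrak T}(\mathbf t,\mathbf t')=2^{-\sup\{n\in\mathbb N_0:\ \mathfrak r_n(\mathbf t)=\mathfrak r_n(\mathbf t')\}}$, $\mathfrak r_n(\mathbf t)=\{\mathfrak n\in\mathbf t:|\mathfrak n|\le n\}$, and its Borel $\sigma$-algebra.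 A Galton–Watson (GW) tree with offspring distribution $\mathcal P$ (a probability on $\mathbb N_0$) is a $\mathfrak T$-valued random variable $T$ with $\mathfrak K_\varrho(T)\sim\mathcal P$ and such that, conditionally on $\mathfrak K_\varrho(T)=n$, the sub-trees $\{\mathfrak m\in\mathcal U: i\mathfrak m\in T\}$, $i=1,\dots,n$, are independent and distributed as $T$. Besov random tree prior. Let $(\Omega,\mathcal A,P)$ be a complete probability space, $\kappa>0$ a fixed scaling, $X=(X_{j,k}^l)_{(j,k,l)\in\mathcal I_{\mathbf\Psi}}$ i.i.d. real random variables with density $c_p^{-1}\exp(-|x|^p/\kappa)$, $c_p=\int_{\mathbb R}\exp(-|x|^p/\kappa)dx$, and $T$ a GW tree with offspring distribution $\mathrm{Bin}(2^d,\beta)$, independent of $X$. For a node $\mathfrak n\in\{1,\dots,2^d\}^j$ put $\mathfrak I^1_{d,j}(\mathfrak n)=1+\sum_{i=1}^j2^{d(j-i)}(\mathfrak n_i-1)\in\{1,\dots,2^{dj}\}$, $\mathfrak I^2_{d,j}(n)=\big(\lfloor (n-1)/2^{j(i-1)}\rfloor \bmod 2^j\big)_{i=1,\dots,d}\in K_j$, and let $\mathfrak I_{d,j}=\mathfrak I^2_{d,j}\circ\mathfrak I^1_{d,j}$, a bijection $\{1,\dots,2^d\}^j\to K_j$. Set $\mathcal I_T=\{(j,k,l): (j,k)=(|\mathfrak n|,\mathfrak I_{d,|\mathfrak n|}(\mathfrak n))\text{ for some }\mathfrak n\in T,\ l\in\mathcal L_j\}$. The $B^s_p$-random variable with wavelet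 density $\beta$ is $$b_T(\omega)=\sum_{(j,k,l)\in\mathcal I_T(\omega)}\eta_jX_{j,k}^l(\omega)\psi_{j,k}^l,\qquad \eta_j=2^{-j(s+\frac d2-\frac dp)}.$$ $L^q(\Omega;\mathcal X)$ denotes the Lebesgue–Bochner space. *)

theory Defs
  imports "HOL-Probability.Probability"
begin

section \<open>Scaling functions and wavelets on the real line\<close>

definition L2_real :: "(real \<Rightarrow> real) set" where
  "L2_real = {f \<in> borel_measurable lborel. integrable lborel (\<lambda>x. (f x)\<^sup>2)}"

definition L2_inner :: "(real \<Rightarrow> real) \<Rightarrow> (real \<Rightarrow> real) \<Rightarrow> real" where
  "L2_inner f g = (\<integral>x. f x * g x \<partial>lborel)"

definition L2_norm_real :: "(real \<Rightarrow> real) \<Rightarrow> real" where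
  "L2_norm_real f = sqrt (L2_inner f f)"

text \<open>Elements of L2 are represented by functions; since \<^term>\<open>L2_norm_real\<close> is only a seminorm on
  functions, a closed subspace automatically contains all representatives of its elements.\<close>

definition closed_L2_subspace :: "(real \<Rightarrow> real) set \<Rightarrow> bool" where
  "closed_L2_subspace V \<longleftrightarrow>
     V \<subseteq> L2_real \<and> (\<lambda>_. 0) \<in> V \<and>
     (\<forall>f\<in>V. \<forall>g\<in>V. (\<lambda>x. f x + g x) \<in> V) \<and>
     (\<forall>c. \<forall>f\<in>V. (\<lambda>x. c * f x) \<in> V) \<and>
     (\<forall>F. \<forall>f\<in>L2_real. (\<forall>n::nat. F n \<in> V) \<and> (\<lambda>n. L2_norm_real (\<lambda>x. F n x - f x)) \<longlonglongrightarrow> 0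
        \<longrightarrow> f \<in> V)"

text \<open>An orthonormal basis of a closed subspace, as a complete orthonormal system.\<close>

definition L2_orthonormal_basis :: "(int \<Rightarrow> real \<Rightarrow> real) \<Rightarrow> (real \<Rightarrow> real) set \<Rightarrow> bool" where
  "L2_orthonormal_basis e V \<longleftrightarrow>
     (\<forall>k. e k \<in> V) \<and>
     (\<forall>k k'. L2_inner (e k) (e k') = (if k = k' then 1 else 0)) \<and>
     (\<forall>f\<in>V. (\<forall>k. L2_inner f (e k) = 0) \<longrightarrow> (AE x in lborel. f x = 0))"

definition orthonormal_MRA :: "(int \<Rightarrow> (real \<Rightarrow> real) set) \<Rightarrow> (real \<Rightarrow> real) \<Rightarrow> bool" where
  "orthonormal_MRA V \<phi> \<longleftrightarrow>
     (\<forall>j. closed_L2_subspace (V j)) \<and>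
     (\<forall>j. V j \<subseteq> V (j + 1)) \<and>
     (\<forall>j f. f \<in> V j \<longleftrightarrow> (\<lambda>x. f (2 * x)) \<in> V (j + 1)) \<and>
     (\<forall>f. (\<forall>j. f \<in> V j) \<longrightarrow> (AE x in lborel. f x = 0)) \<and>
     (\<forall>f\<in>L2_real. \<forall>\<delta>>0. \<exists>j. \<exists>h\<in>V j. L2_norm_real (\<lambda>x. f x - h x) < \<delta>) \<and>
     L2_orthonormal_basis (\<lambda>k x. \<phi> (x - of_int k)) (V 0)"

text \<open>The translates of the wavelet form an orthonormal basis of the orthogonal complement of
  \<open>V 0\<close> in \<open>V 1\<close>.\<close>

definition MRA_wavelet :: "(int \<Rightarrow> (real \<Rightarrow> real) set) \<Rightarrow> (real \<Rightarrow> real) \<Rightarrow> bool" where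
  "MRA_wavelet V \<psi> \<longleftrightarrow>
     L2_orthonormal_basis (\<lambda>k x. \<psi> (x - of_int k)) {f \<in> V 1. \<forall>g\<in>V 0. L2_inner f g = 0}"

text \<open>For integral \<open>\<alpha>\<close> this is the class of \<open>\<alpha>\<close> times continuously differentiable functions,
  otherwise the derivative of order \<open>\<lfloor>\<alpha>\<rfloor>\<close> is also Hoelder continuous of exponent
  \<open>\<alpha> - \<lfloor>\<alpha>\<rfloor>\<close>.\<close>

definition C_class :: "real \<Rightarrow> (real \<Rightarrow> real) \<Rightarrow> bool" where
  "C_class \<alpha> f \<longleftrightarrow>
     (let m = nat \<lfloor>\<alpha>\<rfloor> in
        (\<forall>i<m. \<forall>x. (deriv ^^ i) f differentiable (at x)) \<and>
        continuous_on UNIV ((deriv ^^ m) f) \<and>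
        (\<alpha> \<notin> \<int> \<longrightarrow> (\<exists>C. \<forall>x y. \<bar>(deriv ^^ m) f x - (deriv ^^ m) f y\<bar> \<le> C * \<bar>x - y\<bar> powr (\<alpha> - real m))))"

definition wavelet_system :: "real \<Rightarrow> (real \<Rightarrow> real) \<Rightarrow> (real \<Rightarrow> real) \<Rightarrow> bool" where
  "wavelet_system \<alpha> \<phi> \<psi> \<longleftrightarrow>
     C_class \<alpha> \<phi> \<and> C_class \<alpha> \<psi> \<and>
     compact (closure {x. \<phi> x \<noteq> 0}) \<and> compact (closure {x. \<psi> x \<noteq> 0}) \<and>
     (\<exists>V. orthonormal_MRA V \<phi> \<and> MRA_wavelet V \<psi>) \<and>
     L2_norm_real \<phi> = 1 \<and> L2_norm_real \<psi> = 1 \<and>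
     (\<forall>m::nat. real m < \<alpha> \<longrightarrow> (\<integral>x. \<psi> x * x ^ m \<partial>lborel) = 0)"


section \<open>Periodic wavelets on the torus\<close>

text \<open>Points of the \<open>d\<close>-dimensional space are extensional functions on \<open>{1..d}\<close>; the same holds
  for the multi-indices \<open>k\<close> and \<open>l\<close>.\<close>

definition RR :: "nat \<Rightarrow> (nat \<Rightarrow> real) set" where
  "RR d = {1..d} \<rightarrow>\<^sub>E UNIV"

definition ZZ :: "nat \<Rightarrow> (nat \<Rightarrow> int) set" where
  "ZZ d = {1..d} \<rightarrow>\<^sub>E UNIV"

definition torus :: "nat \<Rightarrow> (nat \<Rightarrow> real) measure" where
  "torus d = PiM {1..d} (\<lambda>_. restrict_space lborel {0..1})"

type_synonym windex = "nat \<times> (nat \<Rightarrow> int) \<times> (nat \<Rightarrow> nat)"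

definition L_set :: "nat \<Rightarrow> nat \<Rightarrow> (nat \<Rightarrow> nat) set" where
  "L_set d j = (if j = 0 then {1..d} \<rightarrow>\<^sub>E {0, 1} else ({1..d} \<rightarrow>\<^sub>E {0, 1}) - {\<lambda>i\<in>{1..d}. 0})"

definition K_set :: "nat \<Rightarrow> nat \<Rightarrow> (nat \<Rightarrow> int) set" where
  "K_set d j = {1..d} \<rightarrow>\<^sub>E {0..<2 ^ j}"

definition I_Psi :: "nat \<Rightarrow> windex set" where
  "I_Psi d = {(j, k, l). k \<in> K_set d j \<and> l \<in> L_set d j}"

definition wavelet_1d ::
  "(real \<Rightarrow> real) \<Rightarrow> (real \<Rightarrow> real) \<Rightarrow> nat \<Rightarrow> int \<Rightarrow> nat \<Rightarrow> real \<Rightarrow> real" where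
  "wavelet_1d \<phi> \<psi> j k i x = (if i = 0 then \<phi> else \<psi>) (2 ^ j * x - of_int k)"

definition wavelet_Rd ::
  "nat \<Rightarrow> (real \<Rightarrow> real) \<Rightarrow> (real \<Rightarrow> real) \<Rightarrow> windex \<Rightarrow> (nat \<Rightarrow> real) \<Rightarrow> real" where
  "wavelet_Rd d \<phi> \<psi> = (\<lambda>(j, k, l) x.
     2 powr (real d * real j / 2) * (\<Prod>i=1..d. wavelet_1d \<phi> \<psi> j (k i) (l i) (x i)))"

text \<open>By compactness of the supports only finitely many summands are nonzero at each point.\<close>

definition wavelet_torus ::
  "nat \<Rightarrow> (real \<Rightarrow> real) \<Rightarrow> (real \<Rightarrow> real) \<Rightarrow> windex \<Rightarrow> (nat \<Rightarrow> real) \<Rightarrow> real" where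
  "wavelet_torus d \<phi> \<psi> \<nu> x =
     (\<Sum>\<^sub>\<infinity>n\<in>ZZ d. wavelet_Rd d \<phi> \<psi> \<nu> (\<lambda>i\<in>{1..d}. x i - of_int (n i)))"


section \<open>Distributions on the torus and Besov spaces\<close>

text \<open>The wavelets are test functions only up to order \<open>m = \<lfloor>\<alpha>\<rfloor>\<close>, so the wavelet coefficients
  of a distribution are defined if it has order at most \<open>m\<close>.  Distributions are therefore taken
  to be the continuous linear functionals on the \<open>m\<close> times continuously differentiable
  periodic functions.  A function \<open>f\<close> on the torus is identified with the functional that
  integrates test functions against \<open>f\<close>, so the coefficient \<open>(u, \<psi>)\<close> in L2 is \<open>u \<psi>\<close>.\<close>

definition partial :: "nat \<Rightarrow> ((nat \<Rightarrow> real) \<Rightarrow> real) \<Rightarrow> (nat \<Rightarrow> real) \<Rightarrow> real" where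
  "partial i g x = deriv (\<lambda>h. g (x(i := h))) (x i)"

definition iter_partial :: "nat list \<Rightarrow> ((nat \<Rightarrow> real) \<Rightarrow> real) \<Rightarrow> (nat \<Rightarrow> real) \<Rightarrow> real" where
  "iter_partial is g = foldr partial is g"

definition test_fun :: "nat \<Rightarrow> nat \<Rightarrow> ((nat \<Rightarrow> real) \<Rightarrow> real) set" where
  "test_fun d m = {g.
     (\<forall>x\<in>RR d. \<forall>n\<in>ZZ d. g (\<lambda>i\<in>{1..d}. x i + of_int (n i)) = g x) \<and>
     (\<forall>is. set is \<subseteq> {1..d} \<and> length is \<le> m \<longrightarrow> continuous_on (RR d) (iter_partial is g)) \<and>
     (\<forall>is. set is \<subseteq> {1..d} \<and> length is < m \<longrightarrow>
        (\<forall>i\<in>{1..d}. \<forall>x\<in>RR d. (\<lambda>h. iter_partial is g (x(i := h))) differentiable (at (x i))))}"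

type_synonym functional = "((nat \<Rightarrow> real) \<Rightarrow> real) \<Rightarrow> real"

text \<open>The last clause says that \<open>\<bar>u g\<bar> \<le> C * norm g\<close>, where the norm of \<open>g\<close> is the supremum of
  all its partial derivatives of order at most \<open>m\<close>.\<close>

definition distributions :: "nat \<Rightarrow> nat \<Rightarrow> functional set" where
  "distributions d m = {u.
     (\<forall>g\<in>test_fun d m. \<forall>h\<in>test_fun d m. u (\<lambda>x. g x + h x) = u g + u h) \<and>
     (\<forall>c. \<forall>g\<in>test_fun d m. u (\<lambda>x. c * g x) = c * u g) \<and>
     (\<exists>C. \<forall>g\<in>test_fun d m. \<forall>B.
        (\<forall>is. set is \<subseteq> {1..d} \<and> length is \<le> m \<longrightarrow> (\<forall>x\<in>RR d. \<bar>iter_partial is g x\<bar> \<le> B))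
          \<longrightarrow> \<bar>u g\<bar> \<le> C * B)}"

definition besov_term ::
  "nat \<Rightarrow> (real \<Rightarrow> real) \<Rightarrow> (real \<Rightarrow> real) \<Rightarrow> real \<Rightarrow> real \<Rightarrow> functional \<Rightarrow> windex \<Rightarrow> real" where
  "besov_term d \<phi> \<psi> t q u = (\<lambda>(j, k, l).
     2 powr (real j * q * (t + real d / 2 - real d / q)) * \<bar>u (wavelet_torus d \<phi> \<psi> (j, k, l))\<bar> powr q)"

definition besov_norm ::
  "nat \<Rightarrow> (real \<Rightarrow> real) \<Rightarrow> (real \<Rightarrow> real) \<Rightarrow> real \<Rightarrow> real \<Rightarrow> functional \<Rightarrow> real" where
  "besov_norm d \<phi> \<psi> t q u = (\<Sum>\<^sub>\<infinity>\<nu>\<in>I_Psi d. besov_term d \<phi> \<psi> t q u \<nu>) powr (1 / q)"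

definition besov_space ::
  "nat \<Rightarrow> nat \<Rightarrow> (real \<Rightarrow> real) \<Rightarrow> (real \<Rightarrow> real) \<Rightarrow> real \<Rightarrow> real \<Rightarrow> functional set" where
  "besov_space d m \<phi> \<psi> t q =
     {u \<in> distributions d m. besov_term d \<phi> \<psi> t q u summable_on I_Psi d}"

definition zygmund_term ::
  "nat \<Rightarrow> (real \<Rightarrow> real) \<Rightarrow> (real \<Rightarrow> real) \<Rightarrow> real \<Rightarrow> functional \<Rightarrow> windex \<Rightarrow> real" where
  "zygmund_term d \<phi> \<psi> t u = (\<lambda>(j, k, l).
     2 powr (real j * (t + real d / 2)) * \<bar>u (wavelet_torus d \<phi> \<psi> (j, k, l))\<bar>)"

definition zygmund_norm ::
  "nat \<Rightarrow> (real \<Rightarrow> real) \<Rightarrow> (real \<Rightarrow> real) \<Rightarrow> real \<Rightarrow> functional \<Rightarrow> real" where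
  "zygmund_norm d \<phi> \<psi> t u = (SUP \<nu>\<in>I_Psi d. zygmund_term d \<phi> \<psi> t u \<nu>)"

definition zygmund_space ::
  "nat \<Rightarrow> nat \<Rightarrow> (real \<Rightarrow> real) \<Rightarrow> (real \<Rightarrow> real) \<Rightarrow> real \<Rightarrow> functional set" where
  "zygmund_space d m \<phi> \<psi> t =
     {u \<in> distributions d m. bdd_above (zygmund_term d \<phi> \<psi> t u ` I_Psi d)}"

text \<open>The Lebesgue--Bochner space of a space \<open>E\<close> of functionals with norm \<open>N\<close>: strongly measurable
  (an almost sure limit of \<open>E\<close>-valued simple functions) with integrable \<open>q\<close>-th power of the norm.\<close>

definition bochner_Lq ::
  "'w measure \<Rightarrow> real \<Rightarrow> functional set \<Rightarrow> (functional \<Rightarrow> real) \<Rightarrow> ('w \<Rightarrow> functional) set" where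
  "bochner_Lq M q E N = {f.
     (\<exists>u. (\<forall>n::nat. simple_function M (u n) \<and> u n ` space M \<subseteq> E) \<and>
          (AE \<omega> in M. f \<omega> \<in> E \<and> (\<lambda>n. N (\<lambda>g. u n \<omega> g - f \<omega> g)) \<longlonglongrightarrow> 0)) \<and>
     (\<integral>\<^sup>+\<omega>. ennreal (N (f \<omega>) powr q) \<partial>M) < \<infinity>}"


section \<open>Galton--Watson trees\<close>

text \<open>Nodes are lists of positive natural numbers.\<close>

definition nodes :: "nat list set" where
  "nodes = {n. 0 \<notin> set n}"

definition is_tree :: "nat list set \<Rightarrow> bool" where
  "is_tree t \<longleftrightarrow>
     t \<subseteq> nodes \<and> [] \<in> t \<and>
     (\<forall>n m. n @ m \<in> t \<longrightarrow> n \<in> t) \<and>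
     (\<forall>n\<in>t. \<exists>K::enat. \<forall>i\<ge>1. n @ [i] \<in> t \<longleftrightarrow> enat i \<le> K)"

definition offspring :: "nat list set \<Rightarrow> nat list \<Rightarrow> enat" where
  "offspring t n = (THE K. \<forall>i\<ge>1. n @ [i] \<in> t \<longleftrightarrow> enat i \<le> K)"

definition lf_trees :: "nat list set set" where
  "lf_trees = {t. is_tree t \<and> (\<forall>n\<in>t. offspring t n < \<infinity>)}"

definition tree_truncate :: "nat \<Rightarrow> nat list set \<Rightarrow> nat list set" where
  "tree_truncate n t = {m \<in> t. length m \<le> n}"

text \<open>The supremum over the natural numbers is infinite exactly if the trees agree.\<close>

definition tree_dist :: "nat list set \<Rightarrow> nat list set \<Rightarrow> real" where
  "tree_dist t t' =
     (if t = t' then 0 else 2 powr - real (Sup {n. tree_truncate n t = tree_truncate n t'}))"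

definition tree_measure_space :: "nat list set measure" where
  "tree_measure_space = sigma lf_trees {U. openin (Metric_space.mtopology lf_trees tree_dist) U}"

lemma tree_truncate_eq_iff:
  assumes "t \<in> lf_trees" "t' \<in> lf_trees" "t \<noteq> t'"
  shows "tree_truncate n t = tree_truncate n t' \<longleftrightarrow>
    n \<le> Sup {n. tree_truncate n t = tree_truncate n t'}"
proof -
  let ?S = "{n. tree_truncate n t = tree_truncate n t'}"
  have down: "a \<in> ?S" if "b \<in> ?S" "a \<le> b" for a b
  proof -
    have "tree_truncate a u = tree_truncate a (tree_truncate b u)" for u
      using that(2) by (auto simp: tree_truncate_def)
    from this[of t] this[of t'] that(1) show ?thesis by simp
  qed
  obtain m where m: "m \<in> t \<and> m \<notin> t' \<or> m \<in> t' \<and> m \<notin> t" using assms(3) by blast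
  then have "m \<in> tree_truncate (length m) t \<longleftrightarrow> m \<notin> tree_truncate (length m) t'"
    by (simp add: tree_truncate_def) blast
  then have "length m \<notin> ?S" by auto
  with down have bound: "a \<le> length m" if "a \<in> ?S" for a
    using that nat_le_linear[of a "length m"] by blast
  then have fin: "finite ?S" by (meson finite_nat_set_iff_bounded_le)
  have "[] \<in> t" "[] \<in> t'" using assms by (auto simp: lf_trees_def is_tree_def)
  then have "0 \<in> ?S" by (auto simp: tree_truncate_def)
  then have ne: "?S \<noteq> {}" by blast
  have "Sup ?S = Max ?S" unfolding Sup_nat_def by (simp only: ne if_False)
  moreover have "n \<in> ?S \<longleftrightarrow> n \<le> Max ?S"
    using Max_ge[OF fin, of n] down[OF Max_in[OF fin ne], of n] by blast
  ultimately show ?thesis by simp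
qed

lemma tree_dist_ultra:
  assumes "x \<in> lf_trees" "y \<in> lf_trees" "z \<in> lf_trees"
  shows "tree_dist x z \<le> max (tree_dist x y) (tree_dist y z)"
proof -
  have nonneg: "0 \<le> tree_dist u v" for u v by (simp add: tree_dist_def)
  show ?thesis
  proof (cases "x = y \<or> y = z \<or> x = z")
    case True
    then show ?thesis
    proof (elim disjE)
      assume "x = z"
      then have "tree_dist x z = 0" by (simp add: tree_dist_def)
      then show ?thesis using nonneg[of x y] by (simp add: le_max_iff_disj)
    qed simp_all
  next
    case False
    define N where "N u v = Sup {n. tree_truncate n u = tree_truncate n v}" for u v
    let ?k = "min (N x y) (N y z)"
    have "tree_truncate ?k x = tree_truncate ?k y"
      using tree_truncate_eq_iff[OF assms(1,2), of ?k] False by (simp add: N_def)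
    moreover have "tree_truncate ?k y = tree_truncate ?k z"
      using tree_truncate_eq_iff[OF assms(2,3), of ?k] False by (simp add: N_def)
    ultimately have "?k \<le> N x z"
      using tree_truncate_eq_iff[OF assms(1,3), of ?k] False by (simp add: N_def)
    then have "N x y \<le> N x z \<or> N y z \<le> N x z" by linarith
    moreover have "tree_dist u v = 2 powr - real (N u v)" if "u \<noteq> v" for u v
      using that by (simp add: tree_dist_def N_def)
    ultimately show ?thesis using False by (auto simp: le_max_iff_disj)
  qed
qed

lemma Metric_space_trees: "Metric_space lf_trees tree_dist"
proof
  fix x y z
  have nonneg: "0 \<le> tree_dist u v" for u v by (simp add: tree_dist_def)
  show "0 \<le> tree_dist x y" by (rule nonneg)
  show "tree_dist x y = tree_dist y x" by (simp add: tree_dist_def eq_commute)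
  show "tree_dist x y = 0 \<longleftrightarrow> x = y" by (simp add: tree_dist_def)
  show "tree_dist x z \<le> tree_dist x y + tree_dist y z"
    if "x \<in> lf_trees" "y \<in> lf_trees" "z \<in> lf_trees"
    using tree_dist_ultra[OF that] nonneg[of x y] nonneg[of y z] by linarith
qed

text \<open>The value \<open>{[]}\<close> in the case that the root has no \<open>i\<close>-th child is irrelevant below and only
  makes the map tree-valued everywhere.\<close>

definition subtree :: "nat \<Rightarrow> nat list set \<Rightarrow> nat list set" where
  "subtree i t = (if [i] \<in> t then {m. i # m \<in> t} else {[]})"

definition galton_watson_tree :: "'w measure \<Rightarrow> nat pmf \<Rightarrow> ('w \<Rightarrow> nat list set) \<Rightarrow> bool" where
  "galton_watson_tree M P T \<longleftrightarrow>
     T \<in> measurable M tree_measure_space \<and>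
     distr M (count_space UNIV) (\<lambda>\<omega>. the_enat (offspring (T \<omega>) [])) = measure_pmf P \<and>
     (\<forall>n::nat. let A = {\<omega> \<in> space M. offspring (T \<omega>) [] = enat n}; M' = uniform_measure M A in
        measure M A > 0 \<longrightarrow>
          prob_space.indep_vars M' (\<lambda>_. tree_measure_space) (\<lambda>i \<omega>. subtree i (T \<omega>)) {1..n} \<and>
          (\<forall>i\<in>{1..n}. distr M' tree_measure_space (\<lambda>\<omega>. subtree i (T \<omega>)) =
                       distr M tree_measure_space T))"


section \<open>The Besov random tree prior\<close>

definition node_number :: "nat \<Rightarrow> nat \<Rightarrow> nat list \<Rightarrow> nat" where
  "node_number d j n = 1 + (\<Sum>i=1..j. 2 ^ (d * (j - i)) * (n ! (i - 1) - 1))"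

definition number_position :: "nat \<Rightarrow> nat \<Rightarrow> nat \<Rightarrow> (nat \<Rightarrow> int)" where
  "number_position d j N = (\<lambda>i\<in>{1..d}. int ((N - 1) div 2 ^ (j * (i - 1)) mod 2 ^ j))"

definition node_position :: "nat \<Rightarrow> nat \<Rightarrow> nat list \<Rightarrow> (nat \<Rightarrow> int)" where
  "node_position d j n = number_position d j (node_number d j n)"

definition I_tree :: "nat \<Rightarrow> nat list set \<Rightarrow> windex set" where
  "I_tree d t = {(j, k, l). (\<exists>n\<in>t. j = length n \<and> k = node_position d (length n) n) \<and> l \<in> L_set d j}"

definition p_exp_density :: "real \<Rightarrow> real \<Rightarrow> real \<Rightarrow> real" where
  "p_exp_density p \<kappa> x =
     exp (- (\<bar>x\<bar> powr p) / \<kappa>) / (\<integral>y. exp (- (\<bar>y\<bar> powr p) / \<kappa>) \<partial>lborel)"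

definition eta :: "nat \<Rightarrow> real \<Rightarrow> real \<Rightarrow> nat \<Rightarrow> real" where
  "eta d s p j = 2 powr (- (real j * (s + real d / 2 - real d / p)))"

text \<open>The random coefficients \<open>X\<close> are i.i.d. and independent of \<open>T\<close>.\<close>

definition besov_tree_data ::
  "'w measure \<Rightarrow> nat \<Rightarrow> real \<Rightarrow> real \<Rightarrow> real \<Rightarrow> (windex \<Rightarrow> 'w \<Rightarrow> real) \<Rightarrow> ('w \<Rightarrow> nat list set) \<Rightarrow> bool" where
  "besov_tree_data M d p \<kappa> \<beta> X T \<longleftrightarrow>
     prob_space.indep_vars M (\<lambda>_. borel) X (I_Psi d) \<and>
     (\<forall>\<nu>\<in>I_Psi d. distributed M lborel (X \<nu>) (\<lambda>x. ennreal (p_exp_density p \<kappa> x))) \<and>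
     galton_watson_tree M (binomial_pmf (2 ^ d) \<beta>) T \<and>
     prob_space.indep_set M
       (sets (vimage_algebra (space M) T tree_measure_space))
       (sets (vimage_algebra (space M) (\<lambda>\<omega>. \<lambda>\<nu>\<in>I_Psi d. X \<nu> \<omega>) (PiM (I_Psi d) (\<lambda>_. borel))))"

text \<open>The series is understood in the sense of distributions, i.e. tested against each test
  function.  Where it fails to converge the value is the nonlinear functional \<open>\<lambda>_. 1\<close>; as this is
  not a distribution, membership in any of the spaces above entails convergence of the series.\<close>

definition b_series_term ::
  "nat \<Rightarrow> real \<Rightarrow> real \<Rightarrow> (real \<Rightarrow> real) \<Rightarrow> (real \<Rightarrow> real) \<Rightarrow> (windex \<Rightarrow> 'w \<Rightarrow> real) \<Rightarrow> 'w
    \<Rightarrow> ((nat \<Rightarrow> real) \<Rightarrow> real) \<Rightarrow> windex \<Rightarrow> real" where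
  "b_series_term d s p \<phi> \<psi> X \<omega> g \<nu> =
     eta d s p (fst \<nu>) * X \<nu> \<omega> * (\<integral>x. wavelet_torus d \<phi> \<psi> \<nu> x * g x \<partial>torus d)"

definition b_tree ::
  "nat \<Rightarrow> nat \<Rightarrow> real \<Rightarrow> real \<Rightarrow> (real \<Rightarrow> real) \<Rightarrow> (real \<Rightarrow> real) \<Rightarrow> (windex \<Rightarrow> 'w \<Rightarrow> real)
    \<Rightarrow> ('w \<Rightarrow> nat list set) \<Rightarrow> 'w \<Rightarrow> functional" where
  "b_tree d m s p \<phi> \<psi> X T \<omega> =
     (if \<forall>g\<in>test_fun d m. b_series_term d s p \<phi> \<psi> X \<omega> g summable_on I_tree d (T \<omega>)
      then (\<lambda>g. \<Sum>\<^sub>\<infinity>\<nu>\<in>I_tree d (T \<omega>). b_series_term d s p \<phi> \<psi> X \<omega> g \<nu>)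
      else (\<lambda>_. 1))"

end

theory Submission
  imports Defs
begin

text \<open>Orthonormality of the periodic wavelets identifies \<open>b\<close> with its coefficients
  \<open>\<eta>\<^sub>j X\<^sub>\<nu> 1[\<nu> \<in> I\<^sub>T]\<close>. A node of the binomial tree survives with a probability that multiplies along its
  path, so the expected number of nodes in generation \<open>j\<close> is \<open>2^(\<gamma> j)\<close>, and the expectation of
  \<open>\<parallel>b\<parallel>^q\<close> in \<open>B\<^sup>t\<^sub>q\<close> becomes a geometric series with ratio \<open>2^(q (t - s + d/p) - d + \<gamma>)\<close>. Since a wavelet of level
  \<open>j\<close> has \<open>L\<^sup>1\<close> norm of order \<open>2^(-d j / 2)\<close>, a series of the same kind shows that the sum defining \<open>b\<close> converges
  absolutely against every bounded test function. The Zygmund statements follow from the embedding of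
  \<open>B\<close> of smoothness \<open>t + d/q\<close> and exponent \<open>q\<close> into the Zygmund space of smoothness \<open>t\<close>, and the exponential
  moments from a union bound over all wavelets that ignores the tree.\<close>

section \<open>Periodization\<close>

text \<open>The norms see a functional only through its values at the wavelets, whereas
  \<open>b\<close> is given by series that must converge against every test function, with a
  nonlinear default value otherwise. One object meets both demands, the \<open>synthesis\<close> of
  a coefficient family: a weighted l^1 condition (\<open>synthesizable\<close>) makes it a
  distribution, and testing it with a wavelet returns the coefficient. The prior then enters through
  the real random variables \<open>coef\<close>, whose measurability is plain, while
  \<open>b\<close> itself is controlled only outside a null set. Apart from the exponential moments,
  every estimate is linear in the survival indicators, so expected numbers of nodes suffice and the
  dependence between nodes never has to be resolved. Unordered sums over wavelet indices are read as
  integrals over a counting measure, which gives access to Tonelli and dominated convergence.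
  Bochner membership also asks for simple functions with values in a space of functionals; these
  come from coefficient families of finite support. The range \<epsilon> < 1/(2 \<kappa>) arises
  because the union bound uses the exponential moment of order 2 \<epsilon>, finite below
  1/\<kappa>.\<close>

definition periodize :: "(real \<Rightarrow> real) \<Rightarrow> real \<Rightarrow> real" where
  "periodize h x = (\<Sum>\<^sub>\<infinity>n\<in>UNIV. h (x - of_int n))"

text \<open>A shift by \<open>n\<close> with |n| > \<open>N\<close> moves \<open>x\<close> out of
  the support. Any sufficiently large \<open>N\<close> is allowed, so that one range of shifts can
  serve many points at once.\<close>

lemma periodize_eq_sum:
  fixes N :: int
  assumes "\<And>x. R \<le> \<bar>x\<bar> \<Longrightarrow> h x = 0" "\<bar>x\<bar> + R \<le> real_of_int N"
  shows "periodize h x = (\<Sum>n\<in>{-N..N}. h (x - of_int n))"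
proof -
  have "h (x - of_int n) = 0" if "n \<notin> {-N..N}" for n
  proof (rule assms(1))
    have "N + 1 \<le> \<bar>n\<bar>" using that by auto
    then have "real_of_int N + 1 \<le> \<bar>real_of_int n\<bar>" by linarith
    then show "R \<le> \<bar>x - of_int n\<bar>" using assms(2) by linarith
  qed
  then have "periodize h x = infsum (\<lambda>n. h (x - of_int n)) {-N..N}"
    unfolding periodize_def by (intro infsum_cong_neutral) auto
  then show ?thesis by simp
qed

lemma periodize_add_int [simp]: "periodize h (x + of_int n) = periodize h x"
proof -
  have "bij (\<lambda>m::int. m + n)" by (rule bij_betwI[where g="\<lambda>m. m - n"]) auto
  from infsum_reindex_bij_betw[OF this, of "\<lambda>m. h (x + of_int n - of_int m)"]
  show ?thesis by (simp add: periodize_def)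
qed

text \<open>Half of the unfolding trick: a periodic factor moves inside the periodization, so a
  product of two periodizations becomes a single one.\<close>

lemma periodize_mult_periodic:
  assumes "\<And>x n. G (x + of_int n) = G x"
  shows "periodize (\<lambda>x. h x * G x) x = periodize h x * G x"
proof -
  have "G (x - of_int n) = G x" for n using assms[of x "-n"] by simp
  then show ?thesis unfolding periodize_def by (simp add: infsum_cmult_left')
qed

lemma bounded_supportE:
  fixes f :: "real \<Rightarrow> real"
  assumes "compact (closure {x. f x \<noteq> 0})"
  obtains R where "0 < R" "\<And>x. R \<le> \<bar>x\<bar> \<Longrightarrow> f x = 0"
proof -
  have "bounded {x. f x \<noteq> 0}" using assms compact_imp_bounded bounded_subset closure_subset by blast
  then obtain B where B: "\<And>x. f x \<noteq> 0 \<Longrightarrow> \<bar>x\<bar> \<le> B" by (auto simp: bounded_iff)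
  show thesis by (rule that[of "\<bar>B\<bar> + 1"]) (use B in force)+
qed

lemma integrable_compact_support:
  fixes f :: "real \<Rightarrow> real"
  assumes "continuous_on UNIV f" "\<And>x. R \<le> \<bar>x\<bar> \<Longrightarrow> f x = 0"
  shows "integrable lborel f"
proof -
  have "integrable lborel (\<lambda>x. indicator {-R..R} x *\<^sub>R f x)"
    by (rule borel_integrable_compact) (auto intro: continuous_on_subset assms)
  moreover have "(\<lambda>x. indicator {-R..R} x *\<^sub>R f x) = f"
    using assms(2) by (force simp: indicator_def fun_eq_iff)
  ultimately show ?thesis by simp
qed

lemma continuous_on_periodize:
  assumes "continuous_on UNIV h" "\<And>x. R \<le> \<bar>x\<bar> \<Longrightarrow> h x = 0"
  shows "continuous_on UNIV (periodize h)"
proof (rule continuous_at_imp_continuous_on, safe)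
  fix x :: real
  \<comment> \<open>The extra 1 makes one range of shifts valid for all points at distance less than
    1 from \<open>x\<close>; locally the periodization is then a fixed finite sum of continuous
    functions.\<close>
  define N where "N = \<lceil>\<bar>x\<bar> + 1 + R\<rceil>"
  have "\<forall>\<^sub>F y in nhds x. periodize h y = (\<Sum>n\<in>{-N..N}. h (y - of_int n))"
  proof (rule eventually_nhds_metric[THEN iffD2], intro exI[of _ 1] conjI allI impI)
    fix y assume "dist y x < 1"
    then have "\<bar>y\<bar> + R \<le> real_of_int N" unfolding N_def dist_real_def by linarith
    then show "periodize h y = (\<Sum>n\<in>{-N..N}. h (y - of_int n))"
      using assms(2) by (intro periodize_eq_sum) auto
  qed simp
  moreover have "isCont (\<lambda>y. \<Sum>n\<in>{-N..N}. h (y - of_int n)) x"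
    using assms(1) by (intro continuous_intros continuous_on_interior[of UNIV])
      (auto intro!: continuous_intros continuous_on_compose2[OF assms(1)])
  ultimately show "isCont (periodize h) x"
    by (rule isCont_cong[THEN iffD2])
qed

text \<open>The integer translates of the unit interval tile the line, and each summand of the
  periodization accounts for one tile.\<close>

lemma integral_periodize:
  assumes "continuous_on UNIV h" "\<And>x. R \<le> \<bar>x\<bar> \<Longrightarrow> h x = 0"
  shows "(\<integral>x. periodize h x \<partial>restrict_space lborel {0..1}) = (\<integral>x. h x \<partial>lborel)"
proof -
  \<comment> \<open>Large enough for two purposes: the periodization on [0,1] uses only shifts in
    this range, and the tiles with index in this range cover the support of
    \<open>h\<close>.\<close>
  define N where "N = \<lceil>1 + \<bar>R\<bar>\<rceil>"
  have int: "integrable lborel h" by (rule integrable_compact_support[OF assms])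
  have int2: "integrable lborel (\<lambda>x. indicator {0..<1} (x + of_int n) * h x)" for n :: int
    by (rule Bochner_Integration.integrable_bound[OF int])
       (use int in \<open>auto simp: indicator_def intro!: borel_measurable_integrable\<close>)
  have int3: "integrable lborel (\<lambda>x. indicator {0..1} x * h (x - of_int n))" for n :: int
  proof (rule Bochner_Integration.integrable_bound)
    show "integrable lborel (\<lambda>x. h (x - of_int n))"
      using lborel_integrable_real_affine[OF int, of 1 "- of_int n"] by simp
    then show "(\<lambda>x. indicator {0..1} x * h (x - of_int n)) \<in> borel_measurable lborel"
      by (auto intro!: borel_measurable_integrable)
  qed (auto simp: indicator_def)
  have "(\<integral>x. periodize h x \<partial>restrict_space lborel {0..1}) =
        (\<integral>x. (\<Sum>n\<in>{-N..N}. indicator {0..1} x * h (x - of_int n)) \<partial>lborel)"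
  proof (subst integral_restrict_space, simp, rule Bochner_Integration.integral_cong[OF refl])
    fix x :: real
    show "indicator {0..1} x *\<^sub>R periodize h x = (\<Sum>n\<in>{-N..N}. indicator {0..1} x * h (x - of_int n))"
    proof (cases "x \<in> {0..1}")
      case True
      then have "\<bar>x\<bar> + R \<le> real_of_int N" unfolding N_def by auto linarith
      from periodize_eq_sum[OF assms(2) this] True show ?thesis by simp
    qed simp
  qed
  also have "\<dots> = (\<Sum>n\<in>{-N..N}. (\<integral>x. indicator {0..1} x * h (x - of_int n) \<partial>lborel))"
    by (intro Bochner_Integration.integral_sum int3)
  also have "\<dots> = (\<Sum>n\<in>{-N..N}. (\<integral>x. indicator {0..<1} (x + of_int n) * h x \<partial>lborel))"
  proof (rule sum.cong[OF refl])
    fix n :: int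
    have "(\<integral>x. indicator {0..1} x * h (x - of_int n) \<partial>lborel) =
      (\<integral>x. indicator {0..1} (of_int n + x) * h x \<partial>lborel)"
      using lborel_integral_real_affine[of 1 "\<lambda>x. indicator {0..1} x * h (x - of_int n)" "of_int n"] by simp
    \<comment> \<open>The closed interval is exchanged for the half-open one, at the cost of a
      single point, because only half-open tiles are disjoint.\<close>
    also have "\<dots> = (\<integral>x. indicator {0..<1} (x + of_int n) * h x \<partial>lborel)"
    proof (rule integral_cong_AE)
      show "(\<lambda>x. indicator {0..1} (of_int n + x) * h x) \<in> borel_measurable lborel"
        using int by (auto intro!: borel_measurable_integrable)
      show "(\<lambda>x. indicator {0..<1} (x + of_int n) * h x) \<in> borel_measurable lborel"
        using int2 by (rule borel_measurable_integrable)
      have "AE x in lborel. x \<noteq> 1 - real_of_int n" by (rule AE_lborel_singleton)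
      then show "AE x in lborel. indicator {0..1} (of_int n + x) * h x = indicator {0..<1} (x + of_int n) * h x"
        by eventually_elim (auto simp: indicator_def)
    qed
    finally show "(\<integral>x. indicator {0..1} x * h (x - of_int n) \<partial>lborel) =
      (\<integral>x. indicator {0..<1} (x + of_int n) * h x \<partial>lborel)" .
  qed
  also have "\<dots> = (\<integral>x. (\<Sum>n\<in>{-N..N}. indicator {0..<1} (x + of_int n) * h x) \<partial>lborel)"
    by (intro Bochner_Integration.integral_sum[symmetric] int2)
  also have "\<dots> = (\<integral>x. h x \<partial>lborel)"
  proof (rule Bochner_Integration.integral_cong[OF refl])
    fix x :: real
    show "(\<Sum>n\<in>{-N..N}. indicator {0..<1} (x + of_int n) * h x) = h x"
    proof (cases "R \<le> \<bar>x\<bar>")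
      case True
      then show ?thesis using assms(2) by simp
    next
      case False
      have *: "indicator {0..<1} (x + of_int n) * h x = (if n = - \<lfloor>x\<rfloor> then h x else 0)" for n :: int
      proof -
        have "x + of_int n \<in> {0..<1} \<longleftrightarrow> n = - \<lfloor>x\<rfloor>"
          by simp linarith
        then show ?thesis by (simp add: indicator_def)
      qed
      have "- \<lfloor>x\<rfloor> \<in> {-N..N}" unfolding N_def using False by simp linarith
      then show ?thesis by (simp add: * sum.delta)
    qed
  qed
  finally show ?thesis .
qed

text \<open>By unfolding, the integral over the circle equals the integral of
  \<open>f * periodize g\<close> over the line. On the support of \<open>f\<close> one has |x| < R,
  so the shifts of \<open>g\<close> up to |R| + R suffice.\<close>

lemma integral_periodize_mult:
  assumes "continuous_on UNIV f" "\<And>x. R \<le> \<bar>x\<bar> \<Longrightarrow> f x = 0"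
    and "continuous_on UNIV g" "\<And>x. R \<le> \<bar>x\<bar> \<Longrightarrow> g x = 0"
    and "\<bar>R\<bar> + R \<le> real_of_int N"
  shows "(\<integral>x. periodize f x * periodize g x \<partial>restrict_space lborel {0..1}) =
         (\<Sum>n\<in>{-N..N}. \<integral>x. f x * g (x - of_int n) \<partial>lborel)"
proof -
  have cg: "continuous_on UNIV (periodize g)" by (rule continuous_on_periodize[OF assms(3,4)])
  have "(\<integral>x. periodize f x * periodize g x \<partial>restrict_space lborel {0..1}) =
    (\<integral>x. periodize (\<lambda>x. f x * periodize g x) x \<partial>restrict_space lborel {0..1})"
    by (simp add: periodize_mult_periodic)
  also have "\<dots> = (\<integral>x. f x * periodize g x \<partial>lborel)"
    by (rule integral_periodize[of _ R]) (auto intro!: continuous_intros assms(1) cg simp: assms(2))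
  also have "\<dots> = (\<integral>x. (\<Sum>n\<in>{-N..N}. f x * g (x - of_int n)) \<partial>lborel)"
  proof (rule Bochner_Integration.integral_cong[OF refl])
    fix x
    show "f x * periodize g x = (\<Sum>n\<in>{-N..N}. f x * g (x - of_int n))"
    proof (cases "R \<le> \<bar>x\<bar>")
      case True
      then show ?thesis by (simp add: assms(2))
    next
      case False
      then have "\<bar>x\<bar> + R \<le> of_int N" using assms(5) by linarith
      from periodize_eq_sum[OF assms(4) this] show ?thesis by (simp add: sum_distrib_left)
    qed
  qed
  also have "\<dots> = (\<Sum>n\<in>{-N..N}. \<integral>x. f x * g (x - of_int n) \<partial>lborel)"
  proof (rule Bochner_Integration.integral_sum)
    fix n
    show "integrable lborel (\<lambda>x. f x * g (x - real_of_int n))"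
      by (rule integrable_compact_support[of _ R])
         (auto intro!: continuous_intros assms(1) continuous_on_compose2[OF assms(3)] simp: assms(2))
  qed
  finally show ?thesis .
qed

lemma periodize_abs_le:
  assumes "\<And>x. R \<le> \<bar>x\<bar> \<Longrightarrow> h x = 0"
  shows "\<bar>periodize h x\<bar> \<le> periodize (\<lambda>x. \<bar>h x\<bar>) x"
proof -
  define N where "N = \<lceil>\<bar>x\<bar> + R\<rceil>"
  have N: "\<bar>x\<bar> + R \<le> real_of_int N" by (simp add: N_def)
  show ?thesis
    using periodize_eq_sum[OF assms N] periodize_eq_sum[of R "\<lambda>x. \<bar>h x\<bar>", OF _ N] assms
    by (simp add: sum_abs)
qed

section \<open>One-dimensional wavelets: orthogonality on the line and on the circle, and size in
  L^1\<close>

locale wavelet_pair =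
  fixes \<alpha> :: real and \<phi> \<psi> :: "real \<Rightarrow> real"
  assumes alpha: "1 \<le> \<alpha>" and sys: "wavelet_system \<alpha> \<phi> \<psi>"
begin

abbreviation (input) w where "w \<equiv> wavelet_1d \<phi> \<psi>"

definition per_wavelet :: "nat \<Rightarrow> int \<Rightarrow> nat \<Rightarrow> real \<Rightarrow> real" where
  "per_wavelet j k i = periodize (w j k i)"

text \<open>\<open>C_class\<close> asserts continuity only of the highest derivative; since \<alpha>
  is at least 1, the function itself is differentiable, hence continuous.\<close>

lemma continuous_mother: "continuous_on UNIV \<phi>" "continuous_on UNIV \<psi>"
proof -
  have m: "0 < nat \<lfloor>\<alpha>\<rfloor>" using alpha by linarith
  have "continuous_on UNIV f" if "C_class \<alpha> f" for f
  proof -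
    have "\<forall>x. f differentiable (at x)" using that m unfolding C_class_def Let_def by fastforce
    then show ?thesis
      by (intro continuous_at_imp_continuous_on ballI differentiable_imp_continuous_within) auto
  qed
  with sys show "continuous_on UNIV \<phi>" "continuous_on UNIV \<psi>" by (auto simp: wavelet_system_def)
qed

lemma supportE:
  obtains R where "0 < R" "\<And>x. R \<le> \<bar>x\<bar> \<Longrightarrow> \<phi> x = 0" "\<And>x. R \<le> \<bar>x\<bar> \<Longrightarrow> \<psi> x = 0"
proof -
  obtain R1 where "0 < R1" "\<And>x. R1 \<le> \<bar>x\<bar> \<Longrightarrow> \<phi> x = 0"
    using bounded_supportE[of \<phi>] sys unfolding wavelet_system_def by metis
  moreover obtain R2 where "0 < R2" "\<And>x. R2 \<le> \<bar>x\<bar> \<Longrightarrow> \<psi> x = 0"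
    using bounded_supportE[of \<psi>] sys unfolding wavelet_system_def by metis
  ultimately show thesis by (intro that[of "max R1 R2"]) auto
qed

lemma continuous_w [continuous_intros]: "continuous_on UNIV (w j k i)"
  unfolding wavelet_1d_def
  by (auto intro!: continuous_intros continuous_on_compose2[OF continuous_mother(1)]
      continuous_on_compose2[OF continuous_mother(2)])

lemma support_wE:
  obtains R where "0 < R" "\<And>x. R \<le> \<bar>x\<bar> \<Longrightarrow> w j k i x = 0"
proof -
  obtain R where R: "0 < R" "\<And>x. R \<le> \<bar>x\<bar> \<Longrightarrow> \<phi> x = 0" "\<And>x. R \<le> \<bar>x\<bar> \<Longrightarrow> \<psi> x = 0"
    using supportE by blast
  show thesis
  proof (rule that[of "R + \<bar>real_of_int k\<bar>"])
    fix x assume x: "R + \<bar>real_of_int k\<bar> \<le> \<bar>x\<bar>"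
    have "1 * \<bar>x\<bar> \<le> 2 ^ j * \<bar>x\<bar>" by (intro mult_right_mono) auto
    then have "\<bar>x\<bar> \<le> \<bar>2 ^ j * x\<bar>" by (simp add: abs_mult)
    then have "R \<le> \<bar>2 ^ j * x - k\<bar>" using x by linarith
    then show "w j k i x = 0" using R by (simp add: wavelet_1d_def)
  qed (use R in auto)
qed

lemma w_shift: "w j k i (x - of_int n) = w j (k + 2 ^ j * n) i x"
  by (simp add: wavelet_1d_def algebra_simps)

lemma continuous_per_wavelet: "continuous_on UNIV (per_wavelet j k i)"
proof -
  obtain R where "\<And>x. R \<le> \<bar>x\<bar> \<Longrightarrow> w j k i x = 0" using support_wE by metis
  then show ?thesis unfolding per_wavelet_def
    by (intro continuous_on_periodize[of _ R] continuous_w) auto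
qed

lemma integral_scale: "(\<integral>x. h (2 ^ j * x) \<partial>lborel) = (\<integral>x. h x \<partial>lborel) / 2 ^ j" for h :: "real \<Rightarrow> real"
  using lborel_integral_real_affine[of "2 ^ j" h 0] by simp

text \<open>The value 1 / 2^j reflects that \<open>wavelet_1d\<close> carries no normalizing factor.
  In the second claim a dilation by 2^j' turns the finer function into a translate of \<psi>, which
  is orthogonal to \<open>V 0\<close>, and the coarser one into an element of
  \<open>V 0\<close>.\<close>

lemma orthogonality_line:
  shows "(\<integral>x. w j k i x * w j k' i x \<partial>lborel) = (if k = k' then 1 / 2 ^ j else 0)"
    and "i' \<noteq> 0 \<Longrightarrow> j < j' \<or> j = j' \<and> i = 0 \<Longrightarrow> (\<integral>x. w j k i x * w j' k' i' x \<partial>lborel) = 0"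
proof -
  obtain V where mra: "orthonormal_MRA V \<phi>" and wav: "MRA_wavelet V \<psi>"
    using sys unfolding wavelet_system_def by blast
  have sc: "f \<in> V a \<longleftrightarrow> (\<lambda>x. f (2 * x)) \<in> V (a + 1)" for f a
    using mra unfolding orthonormal_MRA_def by blast
  \<comment> \<open>The dilation axiom of the multiresolution analysis, iterated \<open>n\<close>
    times.\<close>
  have scale: "f \<in> V a \<longleftrightarrow> (\<lambda>x. f (2 ^ n * x)) \<in> V (a + int n)" for f a n
  proof (induction n arbitrary: f)
    case (Suc n)
    have "f \<in> V a \<longleftrightarrow> (\<lambda>x. f (2 ^ n * x)) \<in> V (a + int n)" by (rule Suc)
    also have "\<dots> \<longleftrightarrow> (\<lambda>x. f (2 ^ n * (2 * x))) \<in> V (a + int n + 1)" by (rule sc)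
    finally show ?case by (simp add: mult_ac add_ac)
  qed simp
  have V1: "V a \<subseteq> V (a + 1)" for a using mra unfolding orthonormal_MRA_def by blast
  have Vn: "V a \<subseteq> V (a + int n)" for a n
  proof (induction n)
    case (Suc n)
    then show ?case using V1[of "a + int n"] by (auto simp: add_ac)
  qed simp
  have phi: "(\<lambda>x. \<phi> (x - of_int k)) \<in> V 0" for k
    using mra unfolding orthonormal_MRA_def L2_orthonormal_basis_def by blast
  have psi: "(\<lambda>x. \<psi> (x - of_int k)) \<in> V 1" for k
    using wav unfolding MRA_wavelet_def L2_orthonormal_basis_def by blast
  have psi0: "g \<in> V 0 \<Longrightarrow> (\<integral>x. \<psi> (x - of_int k) * g x \<partial>lborel) = 0" for k g
    using wav unfolding MRA_wavelet_def L2_orthonormal_basis_def L2_inner_def by blast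
  have "(\<integral>x. (if i = 0 then \<phi> else \<psi>) (x - of_int k) * (if i = 0 then \<phi> else \<psi>) (x - of_int k') \<partial>lborel)
    = (if k = k' then 1 else 0)"
    using mra wav unfolding orthonormal_MRA_def MRA_wavelet_def L2_orthonormal_basis_def L2_inner_def
    by (cases "i = 0") simp_all
  then show "(\<integral>x. w j k i x * w j k' i x \<partial>lborel) = (if k = k' then 1 / 2 ^ j else 0)"
    using integral_scale[of "\<lambda>x. (if i = 0 then \<phi> else \<psi>) (x - of_int k) * (if i = 0 then \<phi> else \<psi>) (x - of_int k')" j]
    unfolding wavelet_1d_def by simp
  assume i': "i' \<noteq> 0" and j': "j < j' \<or> j = j' \<and> i = 0"
  have "w j k i \<in> V (int j')"
  proof (cases "i = 0")
    case True
    have "w j k i \<in> V (0 + int j)"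
      using phi[of k] scale[of "\<lambda>x. \<phi> (x - of_int k)" 0 j] True unfolding wavelet_1d_def by simp
    then show ?thesis using Vn[of "int j" "j' - j"] j' by auto
  next
    case False
    \<comment> \<open>A wavelet of level \<open>j\<close> lies only in the space of index
      \<open>j + 1\<close>; this is why the strict inequality j < j' is demanded unless
      \<open>i = 0\<close>.\<close>
    have "w j k i \<in> V (1 + int j)"
      using psi[of k] scale[of "\<lambda>x. \<psi> (x - of_int k)" 1 j] False unfolding wavelet_1d_def by simp
    then show ?thesis using Vn[of "1 + int j" "j' - Suc j"] j' False by auto
  qed
  then have "(\<lambda>x. w j k i (x / 2 ^ j')) \<in> V 0"
    using scale[of "\<lambda>x. w j k i (x / 2 ^ j')" 0 j'] by simp
  from psi0[OF this, of k'] integral_scale[of "\<lambda>x. \<psi> (x - of_int k') * w j k i (x / 2 ^ j')" j']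
  have "(\<integral>x. \<psi> (2 ^ j' * x - of_int k') * w j k i x \<partial>lborel) = 0" by simp
  then show "(\<integral>x. w j k i x * w j' k' i' x \<partial>lborel) = 0"
    using i' by (simp add: wavelet_1d_def[of _ _ j' k'] mult.commute)
qed

text \<open>By \<open>w_shift\<close> an integer translate of a wavelet of level \<open>j'\<close>
  is again a wavelet of that level. The bound \<open>0 \<le> N\<close> ensures that the untranslated
  term, which carries the diagonal, is among the summands.\<close>

lemma integral_per_wavelet_mult:
  obtains N where "0 \<le> N" "(\<integral>x. per_wavelet j k i x * per_wavelet j' k' i' x \<partial>restrict_space lborel {0..1}) =
    (\<Sum>n\<in>{-N..N}. \<integral>x. w j k i x * w j' (k' + 2 ^ j' * n) i' x \<partial>lborel)"
proof -
  obtain R1 where R1: "0 < R1" "\<And>x. R1 \<le> \<bar>x\<bar> \<Longrightarrow> w j k i x = 0" using support_wE by metis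
  obtain R2 where R2: "0 < R2" "\<And>x. R2 \<le> \<bar>x\<bar> \<Longrightarrow> w j' k' i' x = 0" using support_wE by metis
  define R where "R = max R1 R2"
  show thesis
  proof (rule that[of "\<lceil>\<bar>R\<bar> + R\<rceil>"])
    show "0 \<le> \<lceil>\<bar>R\<bar> + R\<rceil>" by linarith
    show "(\<integral>x. per_wavelet j k i x * per_wavelet j' k' i' x \<partial>restrict_space lborel {0..1}) =
      (\<Sum>n\<in>{-\<lceil>\<bar>R\<bar> + R\<rceil>..\<lceil>\<bar>R\<bar> + R\<rceil>}. \<integral>x. w j k i x * w j' (k' + 2 ^ j' * n) i' x \<partial>lborel)"
      unfolding per_wavelet_def w_shift[symmetric]
      by (rule integral_periodize_mult[of _ R])
         (use R1 R2 in \<open>auto simp: R_def intro!: continuous_w\<close>)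
  qed
qed

lemma orthogonality_circle:
  shows "k \<in> {0..<2 ^ j} \<Longrightarrow> k' \<in> {0..<2 ^ j} \<Longrightarrow>
      (\<integral>x. per_wavelet j k i x * per_wavelet j k' i x \<partial>restrict_space lborel {0..1}) =
      (if k = k' then 1 / 2 ^ j else 0)"
    and "i' \<noteq> 0 \<Longrightarrow> j < j' \<or> j = j' \<and> i = 0 \<Longrightarrow>
      (\<integral>x. per_wavelet j k i x * per_wavelet j' k' i' x \<partial>restrict_space lborel {0..1}) = 0"
proof -
  assume k: "k \<in> {0..<2 ^ j}" "k' \<in> {0..<2 ^ j}"
  obtain N where N: "0 \<le> N" "(\<integral>x. per_wavelet j k i x * per_wavelet j k' i x \<partial>restrict_space lborel {0..1}) =
    (\<Sum>n\<in>{-N..N}. \<integral>x. w j k i x * w j (k' + 2 ^ j * n) i x \<partial>lborel)"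
    by (rule integral_per_wavelet_mult)
  have *: "k = k' + 2 ^ j * n \<longleftrightarrow> k = k' \<and> n = 0" for n
  proof
    assume eq: "k = k' + 2 ^ j * n"
    have "k mod 2 ^ j = k' mod 2 ^ j" unfolding eq by simp
    then have "k = k'" using k by simp
    then show "k = k' \<and> n = 0" using eq by simp
  qed simp
  have "(\<Sum>n\<in>{-N..N}. \<integral>x. w j k i x * w j (k' + 2 ^ j * n) i x \<partial>lborel) =
    (\<Sum>n\<in>{-N..N}. if n = 0 then if k = k' then 1 / 2 ^ j else 0 else 0)"
    unfolding orthogonality_line(1) by (intro sum.cong refl) (auto simp: *)
  with N show "(\<integral>x. per_wavelet j k i x * per_wavelet j k' i x \<partial>restrict_space lborel {0..1}) =
      (if k = k' then 1 / 2 ^ j else 0)" by simp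
next
  assume a: "i' \<noteq> 0" "j < j' \<or> j = j' \<and> i = 0"
  obtain N where N: "(\<integral>x. per_wavelet j k i x * per_wavelet j' k' i' x \<partial>restrict_space lborel {0..1}) =
    (\<Sum>n\<in>{-N..N}. \<integral>x. w j k i x * w j' (k' + 2 ^ j' * n) i' x \<partial>lborel)"
    by (rule integral_per_wavelet_mult)
  then show "(\<integral>x. per_wavelet j k i x * per_wavelet j' k' i' x \<partial>restrict_space lborel {0..1}) = 0"
    using orthogonality_line(2)[OF a] by simp
qed

lemma integrable_circle:
  assumes "continuous_on UNIV (f :: real \<Rightarrow> real)"
  shows "integrable (restrict_space lborel {0..1}) f"
proof -
  have "integrable lborel (\<lambda>x. indicator {0..1} x *\<^sub>R f x)"
    by (rule borel_integrable_compact) (auto intro: continuous_on_subset assms)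
  then show ?thesis by (subst integrable_restrict_space) auto
qed

text \<open>The sum dominates the L^1 norms of both generators, so that one constant serves all
  types.\<close>

definition mother_L1 :: real where
  "mother_L1 = (\<integral>x. \<bar>\<phi> x\<bar> \<partial>lborel) + (\<integral>x. \<bar>\<psi> x\<bar> \<partial>lborel)"

text \<open>Periodization does not increase the L^1 norm, and dilation by 2^j divides it by
  2^j.\<close>

lemma per_wavelet_L1:
  "(\<integral>x. \<bar>per_wavelet j k i x\<bar> \<partial>restrict_space lborel {0..1}) \<le> mother_L1 / 2 ^ j"
proof -
  obtain R where R: "\<And>x. R \<le> \<bar>x\<bar> \<Longrightarrow> w j k i x = 0" using support_wE by metis
  have c: "continuous_on UNIV (\<lambda>x. \<bar>w j k i x\<bar>)" by (intro continuous_intros)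
  have "(\<integral>x. \<bar>per_wavelet j k i x\<bar> \<partial>restrict_space lborel {0..1}) \<le>
    (\<integral>x. periodize (\<lambda>x. \<bar>w j k i x\<bar>) x \<partial>restrict_space lborel {0..1})"
    unfolding per_wavelet_def
    by (intro integral_mono integrable_circle periodize_abs_le[of R] continuous_on_periodize[OF c, of R]
        continuous_intros continuous_on_periodize[of _ R]) (auto simp: R)
  also have "\<dots> = (\<integral>x. \<bar>w j k i x\<bar> \<partial>lborel)"
    using R by (intro integral_periodize[OF c, of R]) auto
  also have "\<dots> = (\<integral>x. \<bar>(if i = 0 then \<phi> else \<psi>) (x - of_int k)\<bar> \<partial>lborel) / 2 ^ j"
    unfolding wavelet_1d_def by (rule integral_scale)
  also have "(\<integral>x. \<bar>(if i = 0 then \<phi> else \<psi>) (x - of_int k)\<bar> \<partial>lborel) = (\<integral>x. \<bar>(if i = 0 then \<phi> else \<psi>) x\<bar> \<partial>lborel)"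
    using lborel_integral_real_affine[of 1 "\<lambda>x. \<bar>(if i = 0 then \<phi> else \<psi>) (x - of_int k)\<bar>" "of_int k"] by simp
  also have "\<dots> / 2 ^ j \<le> mother_L1 / 2 ^ j"
    by (intro divide_right_mono) (auto simp: mother_L1_def)
  finally show ?thesis .
qed

end

section \<open>Periodic wavelets on the torus\<close>

lemma finite_measure_circle: "finite_measure (restrict_space lborel {0..1::real})"
  by (rule finite_measureI) (simp add: emeasure_restrict_space space_restrict_space)

lemma space_torus: "space (torus d) = {1..d} \<rightarrow>\<^sub>E {0..1}"
  by (simp add: torus_def space_PiM space_restrict_space)

lemma finite_measure_torus: "finite_measure (torus d)"
proof -
  interpret finite_measure "restrict_space lborel {0..1::real}" by (rule finite_measure_circle)
  interpret product_sigma_finite "\<lambda>_::nat. restrict_space lborel {0..1::real}" by standard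
  have "emeasure (torus d) (PiE {1..d} (\<lambda>_. {0..1})) = (\<Prod>i\<in>{1..d}. emeasure (restrict_space lborel {0..1}) {0..1::real})"
    unfolding torus_def by (subst emeasure_PiM) (auto simp: sets_restrict_space)
  then show ?thesis
    by (intro finite_measureI) (simp add: space_torus emeasure_restrict_space space_restrict_space)
qed

text \<open>Continuity refers to the product topology on all functions
  \<open>nat \<Rightarrow> real\<close>, measurability to the finite product of intervals.
  Composition with restriction to {1..d} extends \<open>g\<close> continuously to all functions,
  where the Borel sets of the countable product are those of the product sigma-algebra.\<close>

lemma measurable_RR:
  assumes "continuous_on (RR d) (g :: (nat \<Rightarrow> real) \<Rightarrow> real)"
  shows "g \<in> borel_measurable (torus d)"
proof -
  define G where "G x = g (restrict x {1..d})" for x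
  have "continuous_on UNIV (\<lambda>x. restrict x {1..d} :: nat \<Rightarrow> real)"
  proof (rule continuous_on_coordinatewise_then_product)
    fix i
    show "continuous_on UNIV (\<lambda>x. restrict x {1..d} i :: real)"
      by (cases "i \<in> {1..d}") (auto simp: restrict_def intro!: continuous_on_product_coordinates)
  qed
  then have "continuous_on UNIV G"
    unfolding G_def by (intro continuous_on_compose2[OF assms]) (auto simp: RR_def)
  then have "G \<in> borel_measurable borel" by (rule borel_measurable_continuous_onI)
  also have "borel_measurable borel = borel_measurable (PiM UNIV (\<lambda>_::nat. borel :: real measure))"
    by (intro measurable_cong_sets refl sets_PiM_equal_borel[symmetric])
  finally have G: "G \<in> borel_measurable (PiM UNIV (\<lambda>_::nat. borel :: real measure))" .
  have "(\<lambda>x. x) \<in> measurable (torus d) (PiM UNIV (\<lambda>_::nat. borel :: real measure))"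
  proof (rule measurable_PiM_single')
    fix i :: nat
    show "(\<lambda>x. x i) \<in> measurable (torus d) (borel :: real measure)"
    proof (cases "i \<in> {1..d}")
      case True
      then have "(\<lambda>x. x i) \<in> measurable (torus d) (restrict_space lborel {0..1::real})"
        unfolding torus_def by simp
      then show ?thesis by (auto simp: measurable_restrict_space2_iff)
    next
      case False
      then have "(\<lambda>x. x i) \<in> measurable (torus d) (borel :: real measure) \<longleftrightarrow>
        (\<lambda>x. undefined) \<in> measurable (torus d) (borel :: real measure)"
        by (intro measurable_cong) (auto simp: space_torus PiE_def extensional_def)
      then show ?thesis by simp
    qed
  qed auto
  from measurable_comp[OF this G] have "G \<in> borel_measurable (torus d)" by (simp add: comp_def)
  moreover have "G x = g x" if "x \<in> space (torus d)" for x
    using that by (simp add: G_def space_torus)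
  ultimately show ?thesis by (simp cong: measurable_cong)
qed

text \<open>The extensional functions form a full product whose factors outside {1..d} are the
  one-point set \<open>{undefined}\<close>, so Tychonoff's theorem applies.\<close>

lemma compact_torus: "compact ({1..d} \<rightarrow>\<^sub>E {0..1::real} :: (nat \<Rightarrow> real) set)"
proof -
  define S where "S i = (if i \<in> {1..d} then {0..1::real} else {undefined})" for i :: nat
  have eq: "{1..d} \<rightarrow>\<^sub>E {0..1::real} = PiE UNIV S"
    by (auto simp: S_def PiE_def extensional_def Pi_def split: if_splits)
  have "compactin (product_topology (\<lambda>_::nat. euclidean) UNIV) (PiE UNIV S)"
    by (subst compactin_PiE) (auto simp: S_def)
  then have "compactin euclidean (PiE UNIV S)" by (simp only: euclidean_product_topology)
  then show ?thesis unfolding eq by (simp only: compactin_euclidean_iff)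
qed

lemma bounded_on_torus:
  assumes "continuous_on (RR d) (g :: (nat \<Rightarrow> real) \<Rightarrow> real)"
  obtains B where "0 \<le> B" "\<And>x. x \<in> space (torus d) \<Longrightarrow> \<bar>g x\<bar> \<le> B"
proof -
  have "continuous_on (space (torus d)) g"
    using assms by (rule continuous_on_subset) (auto simp: space_torus RR_def)
  then have "compact (g ` space (torus d))"
    by (rule compact_continuous_image) (unfold space_torus, rule compact_torus)
  then have "bounded (g ` space (torus d))" by (rule compact_imp_bounded)
  then obtain B where "\<And>x. x \<in> space (torus d) \<Longrightarrow> \<bar>g x\<bar> \<le> B" by (auto simp: bounded_iff)
  then show thesis by (intro that[of "\<bar>B\<bar>"]) force+
qed

lemma test_fun_continuous: "g \<in> test_fun d m \<Longrightarrow> continuous_on (RR d) g"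
  unfolding test_fun_def by (auto dest!: spec[of _ "[]"] simp: iter_partial_def)

lemma integrable_torus:
  assumes "continuous_on (RR d) (g :: (nat \<Rightarrow> real) \<Rightarrow> real)"
  shows "integrable (torus d) g"
proof -
  interpret finite_measure "torus d" by (rule finite_measure_torus)
  obtain B where "\<And>x. x \<in> space (torus d) \<Longrightarrow> \<bar>g x\<bar> \<le> B" using bounded_on_torus[OF assms] by metis
  then show ?thesis
    by (intro integrable_const_bound[of _ B] measurable_RR assms) auto
qed

lemma finite_L_set: "finite (L_set d j)" and finite_K_set: "finite (K_set d j)"
  unfolding L_set_def K_set_def by (auto intro!: finite_PiE)

lemma countable_I_Psi: "countable (I_Psi d)"
proof -
  have "I_Psi d = Sigma UNIV (\<lambda>j. K_set d j \<times> L_set d j)" by (auto simp: I_Psi_def)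
  moreover have "countable (Sigma UNIV (\<lambda>j. K_set d j \<times> L_set d j))"
    by (intro countable_SIGMA countable_finite[OF finite_cartesian_product] finite_L_set finite_K_set) simp
  ultimately show ?thesis by simp
qed

section \<open>Tensor wavelets on the torus and the synthesis of a distribution from
  coefficients\<close>

definition pairing ::
  "nat \<Rightarrow> (real \<Rightarrow> real) \<Rightarrow> (real \<Rightarrow> real) \<Rightarrow> windex \<Rightarrow> ((nat \<Rightarrow> real) \<Rightarrow> real) \<Rightarrow> real" where
  "pairing d \<phi> \<psi> \<nu> g = (\<integral>x. wavelet_torus d \<phi> \<psi> \<nu> x * g x \<partial>torus d)"

definition synthesis ::
  "nat \<Rightarrow> (real \<Rightarrow> real) \<Rightarrow> (real \<Rightarrow> real) \<Rightarrow> (windex \<Rightarrow> real) \<Rightarrow> functional" where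
  "synthesis d \<phi> \<psi> c g = (\<Sum>\<^sub>\<infinity>\<nu>\<in>I_Psi d. c \<nu> * pairing d \<phi> \<psi> \<nu> g)"

text \<open>The weight is the order of the L^1 norm of a wavelet of the given level, so the
  condition yields absolute convergence against every bounded continuous function.\<close>

definition synthesizable :: "nat \<Rightarrow> (windex \<Rightarrow> real) \<Rightarrow> bool" where
  "synthesizable d c \<longleftrightarrow> (\<lambda>\<nu>. \<bar>c \<nu>\<bar> * 2 powr - (real d * real (fst \<nu>) / 2)) summable_on I_Psi d"

context wavelet_pair
begin

text \<open>At a fixed point the lattice sum lives on a finite box, and over a box a sum of products
  is a product of sums.\<close>

lemma wavelet_torus_eq:
  "wavelet_torus d \<phi> \<psi> (j, k, l) x =
     2 powr (real d * real j / 2) * (\<Prod>i=1..d. per_wavelet j (k i) (l i) (x i))"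
proof -
  have "\<exists>R. \<forall>x. R \<le> \<bar>x\<bar> \<longrightarrow> w j (k i) (l i) x = 0" for i
    by (rule support_wE[of j "k i" "l i"]) blast
  then obtain R where R: "\<And>i x. R i \<le> \<bar>x\<bar> \<Longrightarrow> w j (k i) (l i) x = 0" by metis
  define N where "N = (MAX i\<in>{0..d}. \<lceil>\<bar>x i\<bar> + R i\<rceil>)"
  have N: "\<bar>x i\<bar> + R i \<le> real_of_int N" if "i \<in> {1..d}" for i
  proof -
    have "\<lceil>\<bar>x i\<bar> + R i\<rceil> \<le> N" unfolding N_def using that by (intro Max_ge) auto
    then show ?thesis by linarith
  qed
  let ?c = "2 powr (real d * real j / 2) :: real"
  have "wavelet_torus d \<phi> \<psi> (j, k, l) x =
    (\<Sum>\<^sub>\<infinity>n\<in>ZZ d. ?c * (\<Prod>i=1..d. w j (k i) (l i) (x i - of_int (n i))))"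
    by (simp add: wavelet_torus_def wavelet_Rd_def)
  also have "\<dots> = (\<Sum>\<^sub>\<infinity>n\<in>{1..d} \<rightarrow>\<^sub>E {-N..N}. ?c * (\<Prod>i=1..d. w j (k i) (l i) (x i - of_int (n i))))"
  proof (rule infsum_cong_neutral)
    fix n assume "n \<in> ZZ d - ({1..d} \<rightarrow>\<^sub>E {-N..N})"
    then obtain i where i: "i \<in> {1..d}" "n i \<notin> {-N..N}"
      unfolding ZZ_def PiE_iff Diff_iff by blast
    then have "N + 1 \<le> \<bar>n i\<bar>" by auto
    then have "R i \<le> \<bar>x i - of_int (n i)\<bar>" using N[OF i(1)] by linarith
    then have "w j (k i) (l i) (x i - of_int (n i)) = 0" by (rule R)
    then show "?c * (\<Prod>i=1..d. w j (k i) (l i) (x i - of_int (n i))) = 0"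
      using i(1) by (auto simp: prod_zero_iff)
  qed (auto simp: ZZ_def)
  also have "\<dots> = ?c * (\<Sum>n\<in>{1..d} \<rightarrow>\<^sub>E {-N..N}. \<Prod>i=1..d. w j (k i) (l i) (x i - of_int (n i)))"
    by (subst infsum_finite) (auto intro!: finite_PiE simp: sum_distrib_left)
  also have "(\<Sum>n\<in>{1..d} \<rightarrow>\<^sub>E {-N..N}. \<Prod>i=1..d. w j (k i) (l i) (x i - of_int (n i))) =
    (\<Prod>i=1..d. \<Sum>n\<in>{-N..N}. w j (k i) (l i) (x i - of_int n))"
    by (subst prod_sum_PiE) auto
  also have "\<dots> = (\<Prod>i=1..d. per_wavelet j (k i) (l i) (x i))"
    unfolding per_wavelet_def using R N
    by (intro prod.cong refl periodize_eq_sum[symmetric]) auto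
  finally show ?thesis .
qed

lemma integral_torus_prod:
  fixes f :: "nat \<Rightarrow> real \<Rightarrow> real"
  assumes "\<And>i. continuous_on UNIV (f i)"
  shows "(\<integral>x. (\<Prod>i=1..d. f i (x i)) \<partial>torus d) =
    (\<Prod>i=1..d. \<integral>x. f i x \<partial>restrict_space lborel {0..1::real})"
proof -
  interpret finite_measure "restrict_space lborel {0..1::real}" by (rule finite_measure_circle)
  interpret product_sigma_finite "\<lambda>_::nat. restrict_space lborel {0..1::real}" by standard
  show ?thesis unfolding torus_def
    by (rule product_integral_prod[of "{1..d}" f]) (auto intro: integrable_circle assms)
qed

lemma continuous_on_per_wavelet_coord:
  "continuous_on S (\<lambda>x. per_wavelet j k i (x n))"
  by (rule continuous_on_compose2[OF continuous_per_wavelet])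
     (auto intro: continuous_on_product_coordinates continuous_on_subset)

lemma continuous_wavelet_torus: "continuous_on S (wavelet_torus d \<phi> \<psi> \<nu>)"
proof -
  obtain j k l where \<nu>: "\<nu> = (j, k, l)" by (cases \<nu>)
  show ?thesis unfolding \<nu> wavelet_torus_eq[abs_def]
    by (intro continuous_intros continuous_on_per_wavelet_coord)
qed

text \<open>The integral factors over the coordinates, so one vanishing factor settles every
  off-diagonal case. On the diagonal the \<open>d\<close> factors 1 / 2^j cancel the two prefactors
  2^(d j / 2).\<close>

lemma orthonormal_torus:
  assumes "\<nu> \<in> I_Psi d" "\<nu>' \<in> I_Psi d"
  shows "(\<integral>x. wavelet_torus d \<phi> \<psi> \<nu> x * wavelet_torus d \<phi> \<psi> \<nu>' x \<partial>torus d) = (if \<nu> = \<nu>' then 1 else 0)"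
proof -
  obtain j k l j' k' l' where \<nu>: "\<nu> = (j, k, l)" "\<nu>' = (j', k', l')" by (metis prod_cases3)
  have kl: "k \<in> K_set d j" "l \<in> L_set d j" "k' \<in> K_set d j'" "l' \<in> L_set d j'"
    using assms by (auto simp: \<nu> I_Psi_def)
  have k: "k i \<in> {0..<2^j}" "k' i \<in> {0..<2^j'}" if "i \<in> {1..d}" for i
    using kl that by (auto simp: K_set_def)
  let ?I = "\<lambda>i. \<integral>x. per_wavelet j (k i) (l i) x * per_wavelet j' (k' i) (l' i) x \<partial>restrict_space lborel {0..1}"
  have "(\<integral>x. wavelet_torus d \<phi> \<psi> \<nu> x * wavelet_torus d \<phi> \<psi> \<nu>' x \<partial>torus d) =
    (\<integral>x. (2 powr (real d * real j / 2) * 2 powr (real d * real j' / 2)) *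
      (\<Prod>i=1..d. per_wavelet j (k i) (l i) (x i) * per_wavelet j' (k' i) (l' i) (x i)) \<partial>torus d)"
    by (intro Bochner_Integration.integral_cong) (auto simp: \<nu> wavelet_torus_eq prod.distrib)
  also have "\<dots> = (2 powr (real d * real j / 2) * 2 powr (real d * real j' / 2)) * (\<Prod>i=1..d. ?I i)"
    by (simp add: integral_torus_prod[of "\<lambda>i x. per_wavelet j (k i) (l i) x * per_wavelet j' (k' i) (l' i) x"]
        continuous_on_mult continuous_per_wavelet del: One_nat_def)
  finally have eq: "(\<integral>x. wavelet_torus d \<phi> \<psi> \<nu> x * wavelet_torus d \<phi> \<psi> \<nu>' x \<partial>torus d) =
    (2 powr (real d * real j / 2) * 2 powr (real d * real j' / 2)) * (\<Prod>i=1..d. ?I i)" .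
  have zero: "(\<Prod>i=1..d. ?I i) = 0" if "i \<in> {1..d}" "?I i = 0" for i
    using that by (auto simp: prod_zero_iff)
  \<comment> \<open>The vanishing statement on the circle expects the coarser function first;
    symmetry provides the other order.\<close>
  have comm: "?I i = (\<integral>x. per_wavelet j' (k' i) (l' i) x * per_wavelet j (k i) (l i) x \<partial>restrict_space lborel {0..1})" for i
    by (simp add: mult.commute)
  \<comment> \<open>The purely scaling type is excluded above level 0, so the finer of two wavelets
    has a coordinate of wavelet type, in which it is orthogonal to everything coarser.\<close>
  have nz: "\<exists>i\<in>{1..d}. l i \<noteq> 0" if "l \<in> L_set d j" "0 < j" for l j
  proof (rule ccontr)
    assume "\<not> ?thesis"
    then have "l = (\<lambda>i\<in>{1..d}. 0)"
      using that by (auto simp: L_set_def PiE_def extensional_def fun_eq_iff split: if_splits)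
    with that show False by (auto simp: L_set_def)
  qed
  consider "j < j'" | "j' < j" | "j = j'" "l \<noteq> l'" | "j = j'" "l = l'" "k \<noteq> k'" | "\<nu> = \<nu>'"
    using \<nu> by fastforce
  then show ?thesis
  proof cases
    case 1
    with kl nz obtain i where "i \<in> {1..d}" "l' i \<noteq> 0" by blast
    with 1 orthogonality_circle(2) zero[of i] eq show ?thesis by (auto simp: \<nu>)
  next
    case 2
    with kl nz obtain i where "i \<in> {1..d}" "l i \<noteq> 0" by blast
    with 2 orthogonality_circle(2) zero[of i] eq comm[of i] show ?thesis by (auto simp: \<nu>)
  next
    case 3
    have l: "l \<in> {1..d} \<rightarrow>\<^sub>E {0,1}" "l' \<in> {1..d} \<rightarrow>\<^sub>E {0,1}" using kl by (auto simp: L_set_def split: if_splits)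
    with 3 obtain i where i: "i \<in> {1..d}" "l i \<noteq> l' i" by (metis PiE_ext)
    with l[THEN PiE_mem, OF i(1)] have "l i = 0 \<and> l' i \<noteq> 0 \<or> l' i = 0 \<and> l i \<noteq> 0" by auto
    then have "?I i = 0"
    proof
      assume "l i = 0 \<and> l' i \<noteq> 0"
      with 3 show ?thesis by (intro orthogonality_circle(2)) auto
    next
      assume "l' i = 0 \<and> l i \<noteq> 0"
      with 3 show ?thesis unfolding comm by (intro orthogonality_circle(2)) auto
    qed
    with zero[OF i(1)] eq 3 show ?thesis by (auto simp: \<nu>)
  next
    case 4
    then obtain i where i: "i \<in> {1..d}" "k i \<noteq> k' i" using kl unfolding K_set_def by (metis PiE_ext)
    then have "?I i = 0" using 4 orthogonality_circle(1) k[OF i(1)] by auto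
    with zero[OF i(1)] eq 4 show ?thesis by (auto simp: \<nu>)
  next
    case 5
    then have "?I i = 1 / 2 ^ j" if "i \<in> {1..d}" for i
      using k[OF that] \<nu> orthogonality_circle(1)[of "k i" j "k i" "l i"] by auto
    then have "(\<Prod>i=1..d. ?I i) = (1 / 2 ^ j) ^ d" by simp
    also have "\<dots> = 2 powr (- (real d * real j))"
      by (simp add: powr_minus powr_realpow power_mult[symmetric] mult.commute divide_inverse power_inverse
          flip: of_nat_mult)
    finally have "(\<Prod>i=1..d. ?I i) = 2 powr (- (real d * real j))" .
    then show ?thesis unfolding eq using 5 \<nu> by (simp add: powr_add[symmetric] del: One_nat_def)
  qed
qed

lemma wavelet_torus_L1:
  "(\<integral>x. \<bar>wavelet_torus d \<phi> \<psi> (j, k, l) x\<bar> \<partial>torus d) \<le> mother_L1 ^ d * 2 powr - (real d * real j / 2)"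
proof -
  have "(\<integral>x. \<bar>wavelet_torus d \<phi> \<psi> (j, k, l) x\<bar> \<partial>torus d) =
    (\<integral>x. 2 powr (real d * real j / 2) * (\<Prod>i=1..d. \<bar>per_wavelet j (k i) (l i) (x i)\<bar>) \<partial>torus d)"
    by (simp add: wavelet_torus_eq abs_mult abs_prod)
  also have "\<dots> = 2 powr (real d * real j / 2) *
    (\<Prod>i=1..d. \<integral>x. \<bar>per_wavelet j (k i) (l i) x\<bar> \<partial>restrict_space lborel {0..1})"
    by (simp add: integral_torus_prod[of "\<lambda>i x. \<bar>per_wavelet j (k i) (l i) x\<bar>"] continuous_on_rabs continuous_per_wavelet del: One_nat_def)
  also have "\<dots> \<le> 2 powr (real d * real j / 2) * (\<Prod>i=1..d. mother_L1 / 2 ^ j)"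
    by (intro mult_left_mono prod_mono conjI per_wavelet_L1) auto
  also have "(\<Prod>i=1..d. mother_L1 / 2 ^ j) = mother_L1 ^ d * 2 powr (- (real d * real j))"
    by (simp add: powr_minus powr_realpow power_mult[symmetric] mult.commute divide_inverse power_inverse
          power_mult_distrib flip: of_nat_mult)
  also have "2 powr (real d * real j / 2) * (mother_L1 ^ d * 2 powr (- (real d * real j))) =
      mother_L1 ^ d * 2 powr - (real d * real j / 2)"
    by (simp add: powr_add[symmetric])
  finally show ?thesis .
qed

lemma pairing_bound:
  assumes "\<And>x. x \<in> space (torus d) \<Longrightarrow> \<bar>g x\<bar> \<le> B" "continuous_on (RR d) g"
  shows "\<bar>pairing d \<phi> \<psi> \<nu> g\<bar> \<le> B * mother_L1 ^ d * 2 powr - (real d * real (fst \<nu>) / 2)"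
proof -
  obtain j k l where \<nu>: "\<nu> = (j, k, l)" by (cases \<nu>)
  have c: "continuous_on (RR d) (\<lambda>x. \<bar>wavelet_torus d \<phi> \<psi> \<nu> x\<bar>)"
    by (intro continuous_intros continuous_wavelet_torus)
  have "(\<lambda>i\<in>{1..d}. 0) \<in> space (torus d)" by (auto simp: space_torus)
  from assms(1)[OF this] have B: "0 \<le> B" by linarith
  have "\<bar>pairing d \<phi> \<psi> \<nu> g\<bar> \<le> (\<integral>x. \<bar>wavelet_torus d \<phi> \<psi> \<nu> x * g x\<bar> \<partial>torus d)"
    unfolding pairing_def by (rule integral_abs_bound)
  also have "\<dots> \<le> (\<integral>x. \<bar>wavelet_torus d \<phi> \<psi> \<nu> x\<bar> * B \<partial>torus d)"
    using assms(1) by (intro integral_mono integrable_torus continuous_intros continuous_wavelet_torus assms(2))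
      (auto simp: abs_mult intro!: mult_left_mono)
  also have "\<dots> = B * (\<integral>x. \<bar>wavelet_torus d \<phi> \<psi> \<nu> x\<bar> \<partial>torus d)" by simp
  also have "\<dots> \<le> B * (mother_L1 ^ d * 2 powr - (real d * real (fst \<nu>) / 2))"
    unfolding \<nu> using B wavelet_torus_L1 by (intro mult_left_mono) auto
  finally show ?thesis by (simp add: mult_ac)
qed

lemma pairing_add:
  assumes "continuous_on (RR d) g" "continuous_on (RR d) h"
  shows "pairing d \<phi> \<psi> \<nu> (\<lambda>x. g x + h x) = pairing d \<phi> \<psi> \<nu> g + pairing d \<phi> \<psi> \<nu> h"
  unfolding pairing_def distrib_left
  by (intro Bochner_Integration.integral_add integrable_torus continuous_intros continuous_wavelet_torus assms)

lemma pairing_cmult: "pairing d \<phi> \<psi> \<nu> (\<lambda>x. c * g x) = c * pairing d \<phi> \<psi> \<nu> g"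
  by (simp add: pairing_def mult.left_commute)

lemma abs_summable_synthesis:
  assumes "synthesizable d c" "continuous_on (RR d) g"
  shows "(\<lambda>\<nu>. norm (c \<nu> * pairing d \<phi> \<psi> \<nu> g)) summable_on I_Psi d"
proof -
  obtain B where "0 \<le> B" "\<And>x. x \<in> space (torus d) \<Longrightarrow> \<bar>g x\<bar> \<le> B" using bounded_on_torus[OF assms(2)] by blast
  note b = pairing_bound[OF this(2) assms(2)]
  have "(\<lambda>\<nu>. (B * mother_L1 ^ d) * (\<bar>c \<nu>\<bar> * 2 powr - (real d * real (fst \<nu>) / 2))) summable_on I_Psi d"
    using assms(1) unfolding synthesizable_def by (rule summable_on_cmult_right)
  then show ?thesis
  proof (rule summable_on_comparison_test)
    fix \<nu>
    have "\<bar>c \<nu>\<bar> * \<bar>pairing d \<phi> \<psi> \<nu> g\<bar> \<le> \<bar>c \<nu>\<bar> * (B * mother_L1 ^ d * 2 powr - (real d * real (fst \<nu>) / 2))"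
      by (intro mult_left_mono b) auto
    then show "norm (c \<nu> * pairing d \<phi> \<psi> \<nu> g) \<le>
        (B * mother_L1 ^ d) * (\<bar>c \<nu>\<bar> * 2 powr - (real d * real (fst \<nu>) / 2))"
      by (simp add: abs_mult mult_ac)
  qed auto
qed

lemma summable_synthesis:
  assumes "synthesizable d c" "continuous_on (RR d) g"
  shows "(\<lambda>\<nu>. c \<nu> * pairing d \<phi> \<psi> \<nu> g) summable_on I_Psi d"
  using abs_summable_synthesis[OF assms] by (rule abs_summable_summable)

text \<open>The pairings are bounded through the supremum of \<open>g\<close> alone, that is through
  the empty list of derivatives; the functional is thus continuous of order 0, for any
  \<open>m\<close>.\<close>

lemma synthesis_distribution:
  assumes "synthesizable d c"
  shows "synthesis d \<phi> \<psi> c \<in> distributions d m"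
  unfolding distributions_def
proof (intro CollectI conjI ballI allI exI impI)
  fix g h assume "g \<in> test_fun d m" "h \<in> test_fun d m"
  note gh = this[THEN test_fun_continuous]
  show "synthesis d \<phi> \<psi> c (\<lambda>x. g x + h x) = synthesis d \<phi> \<psi> c g + synthesis d \<phi> \<psi> c h"
    unfolding synthesis_def pairing_add[OF gh] distrib_left
    by (intro infsum_add summable_synthesis assms gh)
next
  fix a g
  show "synthesis d \<phi> \<psi> c (\<lambda>x. a * g x) = a * synthesis d \<phi> \<psi> c g"
    unfolding synthesis_def pairing_cmult by (simp add: mult.left_commute infsum_cmult_right')
next
  fix g B assume g: "g \<in> test_fun d m"
  assume B: "\<forall>is. set is \<subseteq> {1..d} \<and> length is \<le> m \<longrightarrow> (\<forall>x\<in>RR d. \<bar>iter_partial is g x\<bar> \<le> B)"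
  have "\<bar>g x\<bar> \<le> B" if "x \<in> space (torus d)" for x
    using B[rule_format, of "[]" x] that by (auto simp: iter_partial_def space_torus RR_def)
  note b = pairing_bound[OF this test_fun_continuous[OF g]]
  have "\<bar>synthesis d \<phi> \<psi> c g\<bar> \<le> (\<Sum>\<^sub>\<infinity>\<nu>\<in>I_Psi d. norm (c \<nu> * pairing d \<phi> \<psi> \<nu> g))"
    unfolding synthesis_def using norm_infsum_bound[OF abs_summable_synthesis[OF assms test_fun_continuous[OF g]]] by simp
  also have "\<dots> \<le> (\<Sum>\<^sub>\<infinity>\<nu>\<in>I_Psi d. (B * mother_L1 ^ d) * (\<bar>c \<nu>\<bar> * 2 powr - (real d * real (fst \<nu>) / 2)))"
  proof (rule infsum_mono)
    show "(\<lambda>\<nu>. norm (c \<nu> * pairing d \<phi> \<psi> \<nu> g)) summable_on I_Psi d"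
      by (rule abs_summable_synthesis[OF assms test_fun_continuous[OF g]])
    show "(\<lambda>\<nu>. (B * mother_L1 ^ d) * (\<bar>c \<nu>\<bar> * 2 powr - (real d * real (fst \<nu>) / 2))) summable_on I_Psi d"
      using assms unfolding synthesizable_def by (rule summable_on_cmult_right)
    fix \<nu>
    have "\<bar>c \<nu>\<bar> * \<bar>pairing d \<phi> \<psi> \<nu> g\<bar> \<le> \<bar>c \<nu>\<bar> * (B * mother_L1 ^ d * 2 powr - (real d * real (fst \<nu>) / 2))"
      by (intro mult_left_mono b) auto
    then show "norm (c \<nu> * pairing d \<phi> \<psi> \<nu> g) \<le>
        (B * mother_L1 ^ d) * (\<bar>c \<nu>\<bar> * 2 powr - (real d * real (fst \<nu>) / 2))"
      by (simp add: abs_mult mult_ac)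
  qed
  also have "\<dots> = (mother_L1 ^ d * (\<Sum>\<^sub>\<infinity>\<nu>\<in>I_Psi d. \<bar>c \<nu>\<bar> * 2 powr - (real d * real (fst \<nu>) / 2))) * B"
    unfolding infsum_cmult_right' by (simp add: mult_ac)
  finally show "\<bar>synthesis d \<phi> \<psi> c g\<bar> \<le>
    (mother_L1 ^ d * (\<Sum>\<^sub>\<infinity>\<nu>\<in>I_Psi d. \<bar>c \<nu>\<bar> * 2 powr - (real d * real (fst \<nu>) / 2))) * B" .
qed

text \<open>Tested against a wavelet, all terms of the sum but one vanish, so the identity holds for
  an arbitrary family \<open>c\<close>. It turns Besov and Zygmund terms into expressions in the
  coefficients.\<close>

lemma synthesis_wavelet:
  assumes "\<nu> \<in> I_Psi d"
  shows "synthesis d \<phi> \<psi> c (wavelet_torus d \<phi> \<psi> \<nu>) = c \<nu>"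
proof -
  have "synthesis d \<phi> \<psi> c (wavelet_torus d \<phi> \<psi> \<nu>) = (\<Sum>\<^sub>\<infinity>\<mu>\<in>{\<nu>}. c \<mu> * pairing d \<phi> \<psi> \<mu> (wavelet_torus d \<phi> \<psi> \<nu>))"
    unfolding synthesis_def using assms
    by (intro infsum_cong_neutral) (auto simp: pairing_def orthonormal_torus)
  then show ?thesis using assms by (simp add: pairing_def orthonormal_torus)
qed

lemma synthesizable_finite:
  assumes "finite F" "\<And>\<nu>. \<nu> \<notin> F \<Longrightarrow> c \<nu> = 0"
  shows "synthesizable d c"
proof -
  have "(\<lambda>\<nu>. \<bar>c \<nu>\<bar> * 2 powr - (real d * real (fst \<nu>) / 2)) summable_on (I_Psi d \<inter> F)"
    using assms(1) by (intro summable_on_finite) auto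
  then show ?thesis unfolding synthesizable_def
    by (rule summable_on_cong_neutral[THEN iffD1, rotated -1]) (use assms(2) in auto)
qed

end

section \<open>Galton--Watson trees\<close>

lemma space_tree_measure_space: "space tree_measure_space = lf_trees"
  by (simp add: tree_measure_space_def space_measure_of_conv)

text \<open>The event depends on the generations up to the length of \<open>n\<close>, and trees at
  distance less than 2^(-length n) agree on these; the set is therefore open.\<close>

lemma sets_tree_contains: "{t \<in> lf_trees. n \<in> t} \<in> sets tree_measure_space"
proof -
  interpret Metric_space lf_trees tree_dist by (rule Metric_space_trees)
  have "openin mtopology {t \<in> lf_trees. n \<in> t}"
    unfolding openin_mtopology
  proof (intro conjI allI impI)
    show "{t \<in> lf_trees. n \<in> t} \<subseteq> lf_trees" by blast
    fix x assume x: "x \<in> {t \<in> lf_trees. n \<in> t}"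
    show "\<exists>r>0. mball x r \<subseteq> {t \<in> lf_trees. n \<in> t}"
    proof (intro exI[of _ "2 powr - real (length n)"] conjI subsetI)
      fix y assume y: "y \<in> mball x (2 powr - real (length n))"
      then have xy: "x \<in> lf_trees" "y \<in> lf_trees" "tree_dist x y < 2 powr - real (length n)" by auto
      have "n \<in> y"
      proof (cases "x = y")
        case False
        define S where "S = Sup {n. tree_truncate n x = tree_truncate n y}"
        have "2 powr - real S < 2 powr - real (length n)"
          using xy(3) False by (simp only: tree_dist_def S_def if_False)
        then have "length n \<le> S" by simp
        then have "tree_truncate (length n) x = tree_truncate (length n) y"
          using tree_truncate_eq_iff[OF xy(1,2) False, of "length n"] by (simp only: S_def)
        moreover have "n \<in> tree_truncate (length n) x" using x by (simp add: tree_truncate_def)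
        ultimately show ?thesis by (simp add: tree_truncate_def)
      qed (use x in simp)
      with xy show "y \<in> {t \<in> lf_trees. n \<in> t}" by simp
    qed simp
  qed
  then have "{t \<in> lf_trees. n \<in> t} \<in> sigma_sets lf_trees {U. openin mtopology U}"
    by (intro sigma_sets.Basic CollectI)
  moreover have "{U. openin mtopology U} \<subseteq> Pow lf_trees"
    using openin_subset topspace_mtopology by blast
  ultimately show ?thesis unfolding tree_measure_space_def by (simp only: sets_measure_of)
qed

text \<open>The domain is arbitrary because, besides the underlying probability space, the
  sigma-algebra generated by \<open>T\<close> is needed when independence from \<open>X\<close> is
  exploited.\<close>

lemma pred_node_tree:
  assumes "T \<in> measurable N tree_measure_space"
  shows "Measurable.pred N (\<lambda>\<omega>. n \<in> T \<omega>)"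
proof -
  have "T -` {t \<in> lf_trees. n \<in> t} \<inter> space N \<in> sets N"
    using assms sets_tree_contains by (rule measurable_sets)
  also have "T -` {t \<in> lf_trees. n \<in> t} \<inter> space N = {\<omega> \<in> space N. n \<in> T \<omega>}"
    using measurable_space[OF assms] by (auto simp: space_tree_measure_space)
  finally show ?thesis by (simp add: pred_def)
qed

lemma pred_I_tree_measurable:
  assumes "T \<in> measurable N tree_measure_space"
  shows "Measurable.pred N (\<lambda>\<omega>. \<nu> \<in> I_tree d (T \<omega>))"
proof -
  note [measurable] = pred_node_tree[OF assms]
  obtain j k l where \<nu>: "\<nu> = (j, k, l)" by (cases \<nu>)
  have "(\<lambda>\<omega>. \<nu> \<in> I_tree d (T \<omega>)) =
    (\<lambda>\<omega>. \<exists>n. n \<in> T \<omega> \<and> j = length n \<and> k = node_position d (length n) n \<and> l \<in> L_set d j)"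
    by (auto simp: \<nu> I_tree_def)
  then show ?thesis by simp
qed

lemma lf_trees_root: "t \<in> lf_trees \<Longrightarrow> [] \<in> t"
  and lf_trees_prefix: "t \<in> lf_trees \<Longrightarrow> n @ n' \<in> t \<Longrightarrow> n \<in> t"
  and lf_trees_nodes: "t \<in> lf_trees \<Longrightarrow> n \<in> t \<Longrightarrow> 0 \<notin> set n"
  by (auto simp: lf_trees_def is_tree_def nodes_def)

text \<open>\<open>offspring\<close> is a definite description, so uniqueness is the point: an
  extended natural number is determined by the positive integers below it. Local finiteness then
  excludes infinity.\<close>

lemma offspring_root:
  assumes "t \<in> lf_trees"
  shows "offspring t [] = enat (the_enat (offspring t []))"
    and "1 \<le> i \<Longrightarrow> [i] \<in> t \<longleftrightarrow> i \<le> the_enat (offspring t [])"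
proof -
  have "\<forall>n\<in>t. \<exists>K::enat. \<forall>i\<ge>1. n @ [i] \<in> t \<longleftrightarrow> enat i \<le> K"
    using assms unfolding lf_trees_def is_tree_def by blast
  from bspec[OF this lf_trees_root[OF assms]]
  obtain K :: enat where K: "\<forall>i\<ge>1. [i] \<in> t \<longleftrightarrow> enat i \<le> K" by auto
  have "offspring t [] = K" unfolding offspring_def
  proof (rule the_equality)
    show "\<forall>i\<ge>1. [] @ [i] \<in> t \<longleftrightarrow> enat i \<le> K" using K by simp
    fix K' assume "\<forall>i\<ge>1. [] @ [i] \<in> t \<longleftrightarrow> enat i \<le> K'"
    with K have eq: "enat i \<le> K' \<longleftrightarrow> enat i \<le> K" if "1 \<le> i" for i using that by simp
    have le: "a \<le> b" if "\<And>i. 1 \<le> i \<Longrightarrow> enat i \<le> a \<Longrightarrow> enat i \<le> b" for a b :: enat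
    proof (rule ccontr)
      assume "\<not> a \<le> b"
      then have "b < a" by simp
      then obtain n where n: "b = enat n" by (cases b) auto
      with \<open>b < a\<close> have "enat (Suc n) \<le> a" by (simp add: Suc_ile_eq)
      from that[OF _ this] n show False by simp
    qed
    show "K' = K"
    proof (rule antisym)
      show "K' \<le> K" by (rule le) (use eq in blast)
      show "K \<le> K'" by (rule le) (use eq in blast)
    qed
  qed
  moreover have "offspring t [] \<noteq> \<infinity>" using assms lf_trees_root[OF assms] by (auto simp: lf_trees_def)
  ultimately obtain k where "offspring t [] = enat k" "K = enat k" by auto
  with K show "offspring t [] = enat (the_enat (offspring t []))"
    and "1 \<le> i \<Longrightarrow> [i] \<in> t \<longleftrightarrow> i \<le> the_enat (offspring t [])" by auto
qed

lemma node_position_K_set: "node_position d j n \<in> K_set d (length n)"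
  if "j = length n"
  unfolding node_position_def number_position_def K_set_def that by auto

lemma I_tree_subset: "I_tree d t \<subseteq> I_Psi d"
  using node_position_K_set by (auto simp: I_tree_def I_Psi_def)

section \<open>Survival probabilities of nodes and mean generation sizes\<close>

locale galton_watson = prob_space M for M :: "'w measure" +
  fixes P :: "nat pmf" and T :: "'w \<Rightarrow> nat list set" and N :: nat
  assumes gw: "galton_watson_tree M P T" and supp: "set_pmf P \<subseteq> {..N}"
begin

lemma measurable_T: "T \<in> measurable M tree_measure_space"
  using gw by (simp add: galton_watson_tree_def)

lemma T_lf: "\<omega> \<in> space M \<Longrightarrow> T \<omega> \<in> lf_trees"
  using measurable_space[OF measurable_T] by (simp add: space_tree_measure_space)

lemma pred_node [measurable]: "Measurable.pred M (\<lambda>\<omega>. n \<in> T \<omega>)"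
  by (rule pred_node_tree[OF measurable_T])

definition node_prob :: "nat list \<Rightarrow> real" where "node_prob n = prob {\<omega> \<in> space M. n \<in> T \<omega>}"

definition offs :: "'w \<Rightarrow> nat" where "offs \<omega> = the_enat (offspring (T \<omega>) [])"

text \<open>The number of children is described by which nodes of length 1 are present, and these
  events are already known to be measurable.\<close>

lemma measurable_offs [measurable]: "offs \<in> measurable M (count_space UNIV)"
proof (subst measurable_count_space_eq2_countable, intro conjI ballI)
  fix k :: nat
  have "offs \<omega> = k \<longleftrightarrow> (\<forall>i. 1 \<le> i \<longrightarrow> ([i] \<in> T \<omega> \<longleftrightarrow> i \<le> k))" if "\<omega> \<in> space M" for \<omega>
  proof
    assume r: "\<forall>i. 1 \<le> i \<longrightarrow> ([i] \<in> T \<omega> \<longleftrightarrow> i \<le> k)"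
    have *: "i \<le> offs \<omega> \<longleftrightarrow> i \<le> k" if "1 \<le> i" for i
      using r offspring_root(2)[OF T_lf[OF \<open>\<omega> \<in> space M\<close>] that] that by (simp add: offs_def)
    have "offs \<omega> \<le> k" using *[of "offs \<omega>"] by (cases "offs \<omega>") auto
    moreover have "k \<le> offs \<omega>" using *[of k] by (cases k) auto
    ultimately show "offs \<omega> = k" by simp
  qed (use offspring_root(2)[OF T_lf[OF that]] in \<open>auto simp: offs_def\<close>)
  then have "offs -` {k} \<inter> space M = {\<omega> \<in> space M. \<forall>i. 1 \<le> i \<longrightarrow> ([i] \<in> T \<omega> \<longleftrightarrow> i \<le> k)}" by auto
  also have "\<dots> \<in> sets M" by measurable
  finally show "offs -` {k} \<inter> space M \<in> sets M" .
qed auto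

lemma distr_offs: "distr M (count_space UNIV) offs = measure_pmf P"
  using gw by (simp add: galton_watson_tree_def offs_def[abs_def])

lemma prob_offs: "prob {\<omega> \<in> space M. offs \<omega> = k} = pmf P k"
proof -
  have "pmf P k = measure (distr M (count_space UNIV) offs) {k}"
    by (simp add: distr_offs measure_pmf_single)
  also have "\<dots> = prob (offs -` {k} \<inter> space M)" by (subst measure_distr) auto
  also have "offs -` {k} \<inter> space M = {\<omega> \<in> space M. offs \<omega> = k}" by auto
  finally show ?thesis by simp
qed

lemma AE_offs: "AE \<omega> in M. offs \<omega> \<le> N"
proof -
  have "AE k in distr M (count_space UNIV) offs. k \<le> N"
    unfolding distr_offs using supp by (auto simp: AE_measure_pmf_iff)
  then show ?thesis by (intro AE_distrD[OF measurable_offs])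
qed

lemma node_prob_Nil: "node_prob [] = 1"
proof -
  have "{\<omega> \<in> space M. [] \<in> T \<omega>} = space M" using T_lf lf_trees_root by auto
  then show ?thesis by (simp add: node_prob_def prob_space)
qed

text \<open>Given \<open>k\<close> children with \<open>i \<le> k\<close>, the \<open>i\<close>-th
  subtree has the law of \<open>T\<close>, so the conditional probability of the node
  \<open>i # n\<close> is that of \<open>n\<close> in the whole tree.\<close>

lemma prob_node_offs:
  assumes "1 \<le> i"
  shows "prob {\<omega> \<in> space M. i # n \<in> T \<omega> \<and> offs \<omega> = k} = (if i \<le> k then pmf P k * node_prob n else 0)"
proof (cases "i \<le> k")
  case False
  have "\<not> (i # n \<in> T \<omega> \<and> offs \<omega> = k)" if "\<omega> \<in> space M" for \<omega>
    using lf_trees_prefix[OF T_lf[OF that], of "[i]" n] offspring_root(2)[OF T_lf[OF that] assms] False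
    by (auto simp: offs_def)
  then have "{\<omega> \<in> space M. i # n \<in> T \<omega> \<and> offs \<omega> = k} = {}" by blast
  with False show ?thesis by (metis (no_types, lifting) measure_empty)
next
  case True
  define A where "A = {\<omega> \<in> space M. offs \<omega> = k}"
  have [measurable]: "A \<in> sets M" unfolding A_def by measurable
  have A_off: "A = {\<omega> \<in> space M. offspring (T \<omega>) [] = enat k}"
    unfolding A_def offs_def using offspring_root(1)[OF T_lf] by (metis (lifting) the_enat.simps)
  show ?thesis
  proof (cases "prob A > 0")
    case False
    \<comment> \<open>No conditioning is possible here, but both sides vanish.\<close>
    then have A0: "prob A = 0" using measure_nonneg[of M A] by linarith
    have "prob {\<omega> \<in> space M. i # n \<in> T \<omega> \<and> offs \<omega> = k} \<le> prob A"
      by (intro finite_measure_mono) (auto simp: A_def)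
    with A0 prob_offs[of k] show ?thesis using measure_nonneg[of M] by (simp add: A_def antisym)
  next
    case pos: True
    define M' where "M' = uniform_measure M A"
    have ps: "prob_space M'" unfolding M'_def using pos
      by (intro prob_space_uniform_measure) (auto simp: emeasure_eq_measure)
    have "prob_space.indep_vars M' (\<lambda>_. tree_measure_space) (\<lambda>i \<omega>. subtree i (T \<omega>)) {1..k} \<and>
          (\<forall>i\<in>{1..k}. distr M' tree_measure_space (\<lambda>\<omega>. subtree i (T \<omega>)) = distr M tree_measure_space T)"
      using gw pos unfolding galton_watson_tree_def M'_def Let_def A_off by blast
    with True assms have meas: "(\<lambda>\<omega>. subtree i (T \<omega>)) \<in> measurable M' tree_measure_space"
      and dist: "distr M' tree_measure_space (\<lambda>\<omega>. subtree i (T \<omega>)) = distr M tree_measure_space T"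
      unfolding prob_space.indep_vars_def[OF ps] by auto
    have sp: "space M' = space M" by (simp add: M'_def)
    have lf': "subtree i (T \<omega>) \<in> lf_trees" if "\<omega> \<in> space M" for \<omega>
      using measurable_space[OF meas] that by (simp add: sp space_tree_measure_space)
    have "node_prob n = measure (distr M tree_measure_space T) {t \<in> lf_trees. n \<in> t}"
      using gw sets_tree_contains T_lf
      by (subst measure_distr) (auto simp: node_prob_def galton_watson_tree_def intro!: arg_cong[where f=prob])
    also have "\<dots> = measure M' {\<omega> \<in> space M. n \<in> subtree i (T \<omega>)}"
      unfolding dist[symmetric] using meas sets_tree_contains lf'
      by (subst measure_distr) (auto simp: sp intro!: arg_cong[where f="measure M'"])
    also have "\<dots> = prob (A \<inter> {\<omega> \<in> space M. n \<in> subtree i (T \<omega>)}) / prob A"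
    proof -
      have "(\<lambda>\<omega>. subtree i (T \<omega>)) -` {t \<in> lf_trees. n \<in> t} \<inter> space M' \<in> sets M'"
        using meas sets_tree_contains by (rule measurable_sets)
      also have "(\<lambda>\<omega>. subtree i (T \<omega>)) -` {t \<in> lf_trees. n \<in> t} \<inter> space M' = {\<omega> \<in> space M. n \<in> subtree i (T \<omega>)}"
        using lf' by (auto simp: sp)
      finally have "{\<omega> \<in> space M. n \<in> subtree i (T \<omega>)} \<in> sets M" by (simp add: M'_def)
      then show ?thesis unfolding M'_def using pos
        by (subst measure_uniform_measure) (auto simp: emeasure_eq_measure)
    qed
    also have "A \<inter> {\<omega> \<in> space M. n \<in> subtree i (T \<omega>)} = {\<omega> \<in> space M. i # n \<in> T \<omega> \<and> offs \<omega> = k}"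
    proof -
      \<comment> \<open>On \<open>A\<close> the \<open>i\<close>-th child exists, so the default
        value of \<open>subtree\<close> does not occur.\<close>
      have "[i] \<in> T \<omega>" if "\<omega> \<in> A" for \<omega>
        using that True offspring_root(2)[OF T_lf _, of \<omega> i] assms by (auto simp: A_def offs_def)
      then show ?thesis by (auto simp: A_def subtree_def)
    qed
    finally show ?thesis using pos True prob_offs[of k] by (simp add: A_def field_simps)
  qed
qed

text \<open>The root is peeled off, since self-similarity concerns its subtrees. Summation over the
  number of its children leaves the probability of at least \<open>i\<close> children as the factor
  of the first step.\<close>

lemma node_prob_Cons: "node_prob (i # n) = (if 1 \<le> i then (\<Sum>k\<in>{i..N}. pmf P k) * node_prob n else 0)"
proof (cases "1 \<le> i")
  case True
  have "node_prob (i # n) = prob (\<Union>k\<in>{..N}. {\<omega> \<in> space M. i # n \<in> T \<omega> \<and> offs \<omega> = k})"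
    unfolding node_prob_def by (rule finite_measure_eq_AE) (use AE_offs in auto)
  also have "\<dots> = (\<Sum>k\<in>{..N}. prob {\<omega> \<in> space M. i # n \<in> T \<omega> \<and> offs \<omega> = k})"
    by (rule finite_measure_finite_Union) (auto simp: disjoint_family_on_def)
  also have "\<dots> = (\<Sum>k\<in>{..N}. if i \<le> k then pmf P k * node_prob n else 0)"
    by (simp add: prob_node_offs[OF True])
  also have "\<dots> = (\<Sum>k\<in>{i..N}. pmf P k * node_prob n)"
    by (intro sum.mono_neutral_cong_right) auto
  finally show ?thesis using True by (simp add: sum_distrib_right)
next
  case False
  then have "{\<omega> \<in> space M. i # n \<in> T \<omega>} = {}" using T_lf lf_trees_nodes[of _ "i # n"] by force
  then have "node_prob (i # n) = 0" unfolding node_prob_def by (metis (no_types, lifting) measure_empty)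
  with False show ?thesis by simp
qed

lemma node_prob_eq_0: "\<not> set n \<subseteq> {1..N} \<Longrightarrow> node_prob n = 0"
proof (induction n)
  case (Cons i n)
  show ?case
  proof (cases "i \<in> {1..N}")
    case True
    with Cons.prems have "\<not> set n \<subseteq> {1..N}" by simp
    from Cons.IH[OF this] show ?thesis by (simp add: node_prob_Cons)
  next
    case False
    then have "i = 0 \<or> {i..N} = {}" by auto
    then show ?thesis unfolding node_prob_Cons by (elim disjE) (simp_all only: sum.empty mult_zero_left if_cancel, simp)
  qed
qed simp

definition level :: "nat \<Rightarrow> nat list set" where
  "level j = {n. set n \<subseteq> {1..N} \<and> length n = j}"

lemma finite_level: "finite (level j)"
  unfolding level_def by (rule finite_lists_length_eq) simp

lemma sum_node_prob_level: "(\<Sum>n\<in>level j. node_prob n) = (\<Sum>k\<le>N. real k * pmf P k) ^ j"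
proof (induction j)
  case 0
  have "level 0 = {[]}" unfolding level_def by force
  then show ?case by (simp add: node_prob_Nil)
next
  case (Suc j)
  have "(\<Sum>n\<in>level (Suc j). node_prob n) = (\<Sum>(n, i)\<in>level j \<times> {1..N}. node_prob (i # n))"
    unfolding level_def lists_length_Suc_eq
    by (subst sum.reindex) (auto simp: inj_on_def case_prod_unfold)
  also have "\<dots> = (\<Sum>n\<in>level j. \<Sum>i=1..N. (\<Sum>k\<in>{i..N}. pmf P k) * node_prob n)"
    by (subst sum.cartesian_product[symmetric]) (auto intro!: sum.cong simp: node_prob_Cons)
  also have "\<dots> = (\<Sum>i=1..N. \<Sum>k\<in>{i..N}. pmf P k) * (\<Sum>n\<in>level j. node_prob n)"
    by (simp add: sum_distrib_right sum_distrib_left)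
  \<comment> \<open>The tail probabilities of a distribution on the natural numbers sum to its
    mean.\<close>
  also have "(\<Sum>i=1..N. \<Sum>k\<in>{i..N}. pmf P k) = (\<Sum>k\<le>N. real k * pmf P k)"
  proof -
    have "(\<Sum>i=1..N. \<Sum>k\<in>{i..N}. pmf P k) = (\<Sum>i=1..N. \<Sum>k\<le>N. if i \<le> k then pmf P k else 0)"
      by (intro sum.cong refl sum.mono_neutral_cong_left) auto
    also have "\<dots> = (\<Sum>k\<le>N. \<Sum>i=1..N. if i \<le> k then pmf P k else 0)" by (rule sum.swap)
    also have "\<dots> = (\<Sum>k\<le>N. \<Sum>i\<in>{1..k}. pmf P k)"
      by (intro sum.cong refl sum.mono_neutral_cong_right) auto
    finally show ?thesis by simp
  qed
  finally show ?case using Suc by simp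
qed

lemma pred_I_tree [measurable]: "Measurable.pred M (\<lambda>\<omega>. \<nu> \<in> I_tree d (T \<omega>))"
  by (rule pred_I_tree_measurable[OF measurable_T])

lemma AE_T_level: "AE \<omega> in M. \<forall>n\<in>T \<omega>. n \<in> level (length n)"
proof -
  have "AE \<omega> in M. n \<in> T \<omega> \<longrightarrow> n \<in> level (length n)" for n
  proof (cases "n \<in> level (length n)")
    case False
    then have "prob {\<omega> \<in> space M. n \<in> T \<omega>} = 0" using node_prob_eq_0 by (simp add: level_def node_prob_def)
    then have "AE \<omega> in M. n \<notin> T \<omega>" by (subst (asm) prob_eq_0) (auto)
    then show ?thesis by eventually_elim simp
  qed simp
  then show ?thesis unfolding Ball_def by (simp add: AE_all_countable)
qed

text \<open>A union bound over the nodes with position \<open>k\<close>. Each node has one position,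
  so summation over \<open>k\<close> counts every node of the generation once.\<close>

lemma sum_prob_I_tree:
  "(\<Sum>k\<in>K_set d j. prob {\<omega> \<in> space M. (j, k, l) \<in> I_tree d (T \<omega>)}) \<le> (\<Sum>k\<le>N. real k * pmf P k) ^ j"
proof -
  have "prob {\<omega> \<in> space M. (j, k, l) \<in> I_tree d (T \<omega>)} \<le> (\<Sum>n | n \<in> level j \<and> node_position d j n = k. node_prob n)" for k
  proof -
    have "prob {\<omega> \<in> space M. (j, k, l) \<in> I_tree d (T \<omega>)} \<le>
      prob (\<Union>n\<in>{n \<in> level j. node_position d j n = k}. {\<omega> \<in> space M. n \<in> T \<omega>})"
    proof (rule finite_measure_mono_AE)
      show "AE \<omega> in M. \<omega> \<in> {\<omega> \<in> space M. (j, k, l) \<in> I_tree d (T \<omega>)} \<longrightarrow>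
        \<omega> \<in> (\<Union>n\<in>{n \<in> level j. node_position d j n = k}. {\<omega> \<in> space M. n \<in> T \<omega>})"
        using AE_T_level
      proof eventually_elim
        case (elim \<omega>)
        show ?case
        proof
          assume "\<omega> \<in> {\<omega> \<in> space M. (j, k, l) \<in> I_tree d (T \<omega>)}"
          then obtain n where "\<omega> \<in> space M" "n \<in> T \<omega>" "j = length n" "k = node_position d j n"
            unfolding I_tree_def by blast
          with elim show "\<omega> \<in> (\<Union>n\<in>{n \<in> level j. node_position d j n = k}. {\<omega> \<in> space M. n \<in> T \<omega>})"
            by blast
        qed
      qed
    qed (use finite_level in auto)
    also have "\<dots> \<le> (\<Sum>n | n \<in> level j \<and> node_position d j n = k. node_prob n)"
      unfolding node_prob_def using finite_level by (intro finite_measure_subadditive_finite) auto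
    finally show ?thesis .
  qed
  then have "(\<Sum>k\<in>K_set d j. prob {\<omega> \<in> space M. (j, k, l) \<in> I_tree d (T \<omega>)}) \<le>
    (\<Sum>k\<in>K_set d j. \<Sum>n | n \<in> level j \<and> node_position d j n = k. node_prob n)" by (rule sum_mono)
  also have "\<dots> = (\<Sum>n\<in>level j. node_prob n)"
    using node_position_K_set by (intro sum.group finite_level finite_K_set) (auto simp: level_def)
  finally show ?thesis by (simp add: sum_node_prob_level)
qed

end

text \<open>The derivative of the binomial formula for (a + b)^n in \<open>a\<close>, taken at a = p
  and b = 1 - p.\<close>

lemma binomial_pmf_mean:
  assumes "0 \<le> p" "p \<le> 1"
  shows "(\<Sum>k\<le>n. real k * pmf (binomial_pmf n p) k) = real n * p"
proof -
  have "(\<Sum>k\<le>n. real k * pmf (binomial_pmf n p) k) =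
    p * (\<Sum>k\<le>n. real k * real (n choose k) * p ^ (k - 1) * (1 - p) ^ (n - k))"
    unfolding sum_distrib_left
  proof (intro sum.cong refl)
    fix k
    show "real k * pmf (binomial_pmf n p) k = p * (real k * real (n choose k) * p ^ (k - 1) * (1 - p) ^ (n - k))"
      using assms by (cases k) (auto simp: mult_ac)
  qed
  also have "(\<Sum>k\<le>n. real k * real (n choose k) * p ^ (k - 1) * (1 - p) ^ (n - k)) = real n"
    using binomial_deriv1[of n p "1 - p"] by simp
  finally show ?thesis by simp
qed

lemma galton_watson_binomial:
  assumes "prob_space M" "galton_watson_tree M (binomial_pmf n p) T" "0 \<le> p" "p \<le> 1"
  shows "galton_watson M (binomial_pmf n p) T n"
proof -
  have "set_pmf (binomial_pmf n p) \<subseteq> {..n}" using assms by (auto simp: set_pmf_binomial_eq)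
  with assms show ?thesis by (simp add: galton_watson_def galton_watson_axioms_def)
qed

section \<open>Moments and expected sums over the tree\<close>

text \<open>The quotient of y^r and exp (a y) is largest at y = r / a; the constant is its value
  there without the factor exp (-r).\<close>

lemma powr_le_exp:
  fixes a r y :: real
  assumes "0 < a" "0 < r" "0 \<le> y"
  shows "y powr r \<le> (r / a) powr r * exp (a * y)"
proof (cases "y = 0")
  case False
  then have y: "0 < y" using assms by simp
  have "ln (a * y / r) \<le> a * y / r"
    using ln_le_minus_one[of "a * y / r"] assms y by simp
  then have "r * ln (a * y / r) \<le> a * y"
    using assms by (simp add: pos_le_divide_eq mult.commute)
  then have "(a * y / r) powr r \<le> exp (a * y)"
    using assms y by (simp add: powr_def)
  moreover have "y powr r = (r / a) powr r * (a * y / r) powr r"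
    using assms y by (subst powr_mult[symmetric]) auto
  ultimately show ?thesis by (simp add: mult_left_mono)
qed simp

text \<open>Comparison with the integrable function 1 / (1 + x^2).\<close>

lemma nn_integral_exp_powr_finite:
  fixes a p :: real
  assumes "0 < a" "1 \<le> p"
  shows "(\<integral>\<^sup>+x. ennreal (exp (- a * \<bar>x\<bar> powr p)) \<partial>lborel) < \<infinity>"
proof -
  \<comment> \<open>The factor exp a comes from |x|^p \<ge> |x| - 1; the summands 1 and (2 / a)^2
    come from bounding 1 and x^2 by multiples of exp (a |x|).\<close>
  define C where "C = exp a * (1 + (2 / a)\<^sup>2)"
  have int: "integrable lborel (\<lambda>x::real. C * inverse (1 + x\<^sup>2))"
    using integrable_inverse_1_plus_square
    by (simp add: set_integrable_def einterval_def)
  have bound: "exp (- a * \<bar>x\<bar> powr p) \<le> C * inverse (1 + x\<^sup>2)" for x :: real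
  proof -
    have "\<bar>x\<bar> - 1 \<le> \<bar>x\<bar> powr p"
    proof (cases "1 \<le> \<bar>x\<bar>")
      case True
      then have "\<bar>x\<bar> powr 1 \<le> \<bar>x\<bar> powr p" using assms by (intro powr_mono) auto
      with True show ?thesis by simp
    next
      case False
      then show ?thesis using powr_ge_zero[of "\<bar>x\<bar>" p] by linarith
    qed
    then have "a * (\<bar>x\<bar> - 1) \<le> a * \<bar>x\<bar> powr p" using assms by (intro mult_left_mono) auto
    then have "exp (- a * \<bar>x\<bar> powr p) \<le> exp (a + - (a * \<bar>x\<bar>))" by (simp add: algebra_simps)
    also have "\<dots> = exp a * inverse (exp (a * \<bar>x\<bar>))" by (simp add: exp_add exp_minus exp_diff divide_inverse)
    also have "\<dots> \<le> exp a * ((1 + (2 / a)\<^sup>2) * inverse (1 + x\<^sup>2))"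
    proof (rule mult_left_mono)
      have "\<bar>x\<bar> powr 2 \<le> (2 / a) powr 2 * exp (a * \<bar>x\<bar>)" using assms by (intro powr_le_exp) auto
      then have "x\<^sup>2 \<le> (2 / a)\<^sup>2 * exp (a * \<bar>x\<bar>)" using assms by simp
      moreover have "1 \<le> exp (a * \<bar>x\<bar>)" using assms by simp
      ultimately have "1 + x\<^sup>2 \<le> (1 + (2 / a)\<^sup>2) * exp (a * \<bar>x\<bar>)" unfolding distrib_right by linarith
      moreover have "0 < 1 + x\<^sup>2" by (simp add: add_pos_nonneg)
      ultimately show "inverse (exp (a * \<bar>x\<bar>)) \<le> (1 + (2 / a)\<^sup>2) * inverse (1 + x\<^sup>2)"
        by (simp add: field_simps)
    qed simp
    finally show ?thesis by (simp add: C_def mult_ac)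
  qed
  have "(\<integral>\<^sup>+x. ennreal (exp (- a * \<bar>x\<bar> powr p)) \<partial>lborel) \<le> (\<integral>\<^sup>+x. ennreal (C * inverse (1 + x\<^sup>2)) \<partial>lborel)"
    by (intro nn_integral_mono ennreal_leI bound)
  also have "\<dots> < \<infinity>"
    using int by (subst nn_integral_eq_integral) (auto simp: C_def)
  finally show ?thesis .
qed

section \<open>Sums over the wavelet indices, level by level and as integrals\<close>

lemma card_L_set: "card (L_set d j) \<le> 2 ^ d"
proof -
  have "card (L_set d j) \<le> card ({1..d} \<rightarrow>\<^sub>E {0, 1 :: nat})"
    by (intro card_mono finite_PiE) (auto simp: L_set_def)
  also have "\<dots> = 2 ^ d" by (simp add: card_PiE) (simp only: numeral_2_eq_2)
  finally show ?thesis .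
qed

lemma card_K_set: "card (K_set d j) = 2 ^ (d * j)"
  by (simp add: K_set_def card_PiE nat_power_eq power_mult[symmetric] mult.commute)

lemma nn_integral_I_Psi:
  "(\<integral>\<^sup>+\<nu>. f \<nu> \<partial>count_space (I_Psi d)) = (\<Sum>j. \<Sum>k\<in>K_set d j. \<Sum>l\<in>L_set d j. f (j, k, l))"
proof -
  have "(\<integral>\<^sup>+\<nu>. f \<nu> \<partial>count_space (I_Psi d)) = (\<integral>\<^sup>+\<nu>. f \<nu> * indicator (I_Psi d) \<nu> \<partial>count_space UNIV)"
    by (rule nn_integral_count_space_indicator) simp
  also have "\<dots> = (\<integral>\<^sup>+j. \<integral>\<^sup>+y. f (j, y) * indicator (I_Psi d) (j, y) \<partial>count_space UNIV \<partial>count_space UNIV)"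
    by (rule nn_integral_fst_count_space[symmetric])
  also have "\<dots> = (\<Sum>j. \<integral>\<^sup>+y. f (j, y) * indicator (I_Psi d) (j, y) \<partial>count_space UNIV)"
    by (rule nn_integral_count_space_nat)
  also have "\<dots> = (\<Sum>j. \<Sum>k\<in>K_set d j. \<Sum>l\<in>L_set d j. f (j, k, l))"
  proof (rule arg_cong[where f=suminf], rule ext)
    fix j
    have "(\<integral>\<^sup>+y. f (j, y) * indicator (I_Psi d) (j, y) \<partial>count_space UNIV) =
      (\<integral>\<^sup>+y. f (j, y) * indicator (K_set d j \<times> L_set d j) y \<partial>count_space UNIV)"
      by (intro nn_integral_cong) (auto simp: indicator_def I_Psi_def)
    also have "\<dots> = (\<integral>\<^sup>+y. f (j, y) \<partial>count_space (K_set d j \<times> L_set d j))"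
      by (rule nn_integral_count_space_indicator[symmetric]) simp
    also have "\<dots> = (\<Sum>y\<in>K_set d j \<times> L_set d j. f (j, y))"
      by (intro nn_integral_count_space_finite finite_cartesian_product finite_K_set finite_L_set)
    also have "\<dots> = (\<Sum>k\<in>K_set d j. \<Sum>l\<in>L_set d j. f (j, k, l))"
      by (simp add: sum.cartesian_product case_prod_unfold)
    finally show "(\<integral>\<^sup>+y. f (j, y) * indicator (I_Psi d) (j, y) \<partial>count_space UNIV) =
      (\<Sum>k\<in>K_set d j. \<Sum>l\<in>L_set d j. f (j, k, l))" .
  qed
  finally show ?thesis .
qed

text \<open>Unordered summability of reals is absolute, hence integrability for the counting
  measure. This links the sums in the definitions of the norms to the convergence theorems for
  integrals.\<close>

lemma summable_on_iff_integrable_count_space: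
  fixes f :: "'a \<Rightarrow> real"
  shows "f summable_on A \<longleftrightarrow> integrable (count_space A) f"
    and "f summable_on A \<Longrightarrow> infsum f A = (\<integral>x. f x \<partial>count_space A)"
proof -
  show *: "f summable_on A \<longleftrightarrow> integrable (count_space A) f"
    using abs_summable_equivalent[of f A] summable_on_iff_abs_summable_on_real[of f A]
    unfolding Infinite_Set_Sum.abs_summable_on_def by simp
  assume "f summable_on A"
  then show "infsum f A = (\<integral>x. f x \<partial>count_space A)"
    using * infsetsum_infsum[of f A] unfolding infsetsum_def Infinite_Set_Sum.abs_summable_on_def by simp
qed

lemma summable_on_if_nn_integral_finite:
  fixes f :: "'a \<Rightarrow> real"
  assumes "(\<integral>\<^sup>+x. ennreal (f x) \<partial>count_space A) < \<infinity>" "\<And>x. x \<in> A \<Longrightarrow> 0 \<le> f x"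
  shows "f summable_on A" and "ennreal (infsum f A) = (\<integral>\<^sup>+x. ennreal (f x) \<partial>count_space A)"
proof -
  have int: "integrable (count_space A) f"
    using assms by (intro integrableI_nonneg) (auto simp: AE_count_space)
  then show "f summable_on A" by (simp add: summable_on_iff_integrable_count_space)
  then show "ennreal (infsum f A) = (\<integral>\<^sup>+x. ennreal (f x) \<partial>count_space A)"
    using nn_integral_eq_integral[OF int] assms(2)
    by (simp add: summable_on_iff_integrable_count_space(2) AE_count_space)
qed

text \<open>Independence is given for two sigma-algebras, while the product rule is about random
  variables: those generated by the indicator and by \<open>f\<close> are contained in
  \<open>F\<close> and \<open>G\<close>.\<close>

lemma (in prob_space) nn_integral_indep_indicator:
  fixes f :: "'a \<Rightarrow> ennreal"
  assumes "indep_set (sets F) (sets G)" "space F = space M" "space G = space M"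
    and "A \<in> sets F" "f \<in> borel_measurable G"
  shows "(\<integral>\<^sup>+\<omega>. indicator A \<omega> * f \<omega> \<partial>M) = emeasure M A * (\<integral>\<^sup>+\<omega>. f \<omega> \<partial>M)"
proof -
  have ev: "sets F \<subseteq> events" "sets G \<subseteq> events"
    using assms(1) by (auto simp: indep_set_def indep_sets_def UNIV_bool)
  have iM: "indicator A \<in> borel_measurable M" using assms ev by auto
  have fM: "f \<in> borel_measurable M"
    using assms(5) ev assms(3) unfolding measurable_def by auto
  have iF: "indicator A \<in> borel_measurable F" using assms by auto
  have "indep_set (sigma_sets (space M) {indicator A -` B \<inter> space M | B. B \<in> sets (borel :: ennreal measure)})
                  (sigma_sets (space M) {f -` B \<inter> space M | B. B \<in> sets borel})"
    using assms(1) unfolding indep_set_def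
  proof (rule indep_sets_mono_sets)
    have "sigma_sets (space F) {indicator A -` B \<inter> space F | B. B \<in> sets (borel :: ennreal measure)} \<subseteq> sets F"
      using measurable_sets[OF iF] by (intro sets.sigma_sets_subset) auto
    moreover have "sigma_sets (space G) {f -` B \<inter> space G | B. B \<in> sets borel} \<subseteq> sets G"
      using measurable_sets[OF assms(5)] by (intro sets.sigma_sets_subset) auto
    ultimately show "case_bool (sigma_sets (space M) {indicator A -` B \<inter> space M | B. B \<in> sets (borel :: ennreal measure)})
        (sigma_sets (space M) {f -` B \<inter> space M | B. B \<in> sets borel}) i \<subseteq> case_bool (sets F) (sets G) i" for i
      using assms(2,3) by (cases i) auto
  qed
  then have "indep_var borel (indicator A :: 'a \<Rightarrow> ennreal) borel f"
    unfolding indep_var_eq using iM fM by simp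
  \<comment> \<open>The family of target spaces, given by cases on a boolean, is rewritten as a
    constant one to fit the product rule.\<close>
  then have iv: "indep_vars (\<lambda>_. borel) (case_bool (indicator A) f) UNIV"
    unfolding indep_var_def by (rule back_subst[of "\<lambda>m. indep_vars m _ _"]) (auto split: bool.split)
  from indep_vars_nn_integral[OF _ this]
  have "(\<integral>\<^sup>+\<omega>. indicator A \<omega> * f \<omega> \<partial>M) = (\<integral>\<^sup>+\<omega>. indicator A \<omega> \<partial>M) * (\<integral>\<^sup>+\<omega>. f \<omega> \<partial>M)"
    by (simp add: UNIV_bool mult.commute)
  also have "(\<integral>\<^sup>+\<omega>. indicator A \<omega> \<partial>M) = emeasure M A" using assms(4) ev by auto
  finally show ?thesis .
qed

section \<open>Moments of the coefficients and expected sums over the tree\<close>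

locale besov_tree = prob_space M for M :: "'w measure" +
  fixes d :: nat and p \<kappa> \<gamma> :: real and X :: "windex \<Rightarrow> 'w \<Rightarrow> real" and T :: "'w \<Rightarrow> nat list set"
  assumes p: "1 \<le> p" and \<gamma>: "\<gamma> \<le> real d" and \<kappa>: "0 < \<kappa>"
    and data: "besov_tree_data M d p \<kappa> (2 powr (\<gamma> - real d)) X T"
begin

sublocale gw: galton_watson M "binomial_pmf (2 ^ d) (2 powr (\<gamma> - real d))" T "2 ^ d"
proof (rule galton_watson_binomial)
  show "prob_space M" by (rule prob_space_axioms)
  show "galton_watson_tree M (binomial_pmf (2 ^ d) (2 powr (\<gamma> - real d))) T"
    using data by (simp add: besov_tree_data_def)
  show "2 powr (\<gamma> - real d) \<le> 1" using powr_mono[of "\<gamma> - real d" 0 2] \<gamma> by simp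
qed simp

lemma measurable_X: "\<nu> \<in> I_Psi d \<Longrightarrow> X \<nu> \<in> borel_measurable M"
  using data unfolding besov_tree_data_def by (auto dest!: bspec dest: distributed_measurable)

text \<open>The mean offspring is 2^d times 2^(\<gamma> - d), which is 2^\<gamma>.\<close>

lemma sum_prob_tree:
  "(\<Sum>k\<in>K_set d j. prob {\<omega> \<in> space M. (j, k, l) \<in> I_tree d (T \<omega>)}) \<le> 2 powr (\<gamma> * real j)"
proof -
  have "2 powr (\<gamma> - real d) \<le> 1" using powr_mono[of "\<gamma> - real d" 0 2] \<gamma> by simp
  then have "(\<Sum>k\<le>2 ^ d. real k * pmf (binomial_pmf (2 ^ d) (2 powr (\<gamma> - real d))) k) = 2 powr \<gamma>"
    using binomial_pmf_mean[of "2 powr (\<gamma> - real d)" "2 ^ d"]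
    by (simp add: powr_diff powr_realpow)
  then show ?thesis using gw.sum_prob_I_tree[where d=d and j=j and l=l]
    by (simp add: powr_powr[symmetric] powr_realpow)
qed

text \<open>The expectation of \<open>g (X \<nu>)\<close>, written through the common density so
  that it does not depend on \<nu>.\<close>

definition moment :: "(real \<Rightarrow> real) \<Rightarrow> ennreal" where
  "moment g = (\<integral>\<^sup>+x. ennreal (p_exp_density p \<kappa> x) * ennreal (g x) \<partial>lborel)"

lemma nn_integral_X:
  assumes "\<nu> \<in> I_Psi d" "g \<in> borel_measurable borel"
  shows "(\<integral>\<^sup>+\<omega>. ennreal (g (X \<nu> \<omega>)) \<partial>M) = moment g"
  unfolding moment_def using assms data
  by (intro distributed_nn_integral[symmetric]) (auto simp: besov_tree_data_def)

text \<open>The weight leaves exp (-(1/\<kappa> - a) |x|^p) up to the normalizing constant, which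
  explains the threshold 1/\<kappa>.\<close>

lemma exponential_moment:
  assumes "a < 1 / \<kappa>"
  shows "moment (\<lambda>x. exp (a * \<bar>x\<bar> powr p)) < \<infinity>"
proof -
  define c where "c = (\<integral>y. exp (- (\<bar>y\<bar> powr p) / \<kappa>) \<partial>lborel)"
  have c: "0 \<le> c" by (simp add: c_def)
  have "moment (\<lambda>x. exp (a * \<bar>x\<bar> powr p)) = (\<integral>\<^sup>+x. ennreal (1 / c) * ennreal (exp (- (1 / \<kappa> - a) * \<bar>x\<bar> powr p)) \<partial>lborel)"
    unfolding moment_def
  proof (intro nn_integral_cong)
    fix x :: real
    have "p_exp_density p \<kappa> x * exp (a * \<bar>x\<bar> powr p) = 1 / c * exp (- (1 / \<kappa> - a) * \<bar>x\<bar> powr p)"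
      by (simp add: p_exp_density_def c_def exp_add[symmetric] algebra_simps)
    moreover have "0 \<le> p_exp_density p \<kappa> x" using c by (simp add: p_exp_density_def c_def)
    ultimately show "ennreal (p_exp_density p \<kappa> x) * ennreal (exp (a * \<bar>x\<bar> powr p)) =
      ennreal (1 / c) * ennreal (exp (- (1 / \<kappa> - a) * \<bar>x\<bar> powr p))"
      using c by (simp add: ennreal_mult[symmetric])
  qed
  also have "\<dots> = ennreal (1 / c) * (\<integral>\<^sup>+x. ennreal (exp (- (1 / \<kappa> - a) * \<bar>x\<bar> powr p)) \<partial>lborel)"
    by (rule nn_integral_cmult) simp
  also have "\<dots> < \<infinity>"
    using nn_integral_exp_powr_finite[of "1 / \<kappa> - a" p] assms p by (simp add: ennreal_mult_less_top)
  finally show ?thesis .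
qed

lemma polynomial_moment:
  assumes "0 < r"
  shows "moment (\<lambda>x. \<bar>x\<bar> powr r) < \<infinity>"
proof -
  \<comment> \<open>Half of the threshold for exponential moments; any value strictly between 0 and
    1/\<kappa> would do.\<close>
  define a where "a = 1 / (2 * \<kappa>)"
  define C where "C = (r / p / a) powr (r / p)"
  have a: "0 < a" "a < 1 / \<kappa>" using \<kappa> by (auto simp: a_def field_simps)
  have "moment (\<lambda>x. \<bar>x\<bar> powr r) \<le>
    (\<integral>\<^sup>+x. ennreal C * (ennreal (p_exp_density p \<kappa> x) * ennreal (exp (a * \<bar>x\<bar> powr p))) \<partial>lborel)"
    unfolding moment_def
  proof (intro nn_integral_mono)
    fix x :: real
    have "(\<bar>x\<bar> powr p) powr (r / p) \<le> C * exp (a * \<bar>x\<bar> powr p)"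
      unfolding C_def using assms p a by (intro powr_le_exp) auto
    then have "\<bar>x\<bar> powr r \<le> C * exp (a * \<bar>x\<bar> powr p)" using p by (simp add: powr_powr)
    then have "ennreal (\<bar>x\<bar> powr r) \<le> ennreal C * ennreal (exp (a * \<bar>x\<bar> powr p))"
      by (subst ennreal_mult[symmetric]) (auto simp: C_def intro: ennreal_leI)
    then show "ennreal (p_exp_density p \<kappa> x) * ennreal (\<bar>x\<bar> powr r) \<le>
      ennreal C * (ennreal (p_exp_density p \<kappa> x) * ennreal (exp (a * \<bar>x\<bar> powr p)))"
      by (metis mult.left_commute mult_left_mono zero_le)
  qed
  also have "\<dots> = ennreal C * moment (\<lambda>x. exp (a * \<bar>x\<bar> powr p))"
    unfolding moment_def by (rule nn_integral_cmult) (simp add: p_exp_density_def)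
  also have "\<dots> < \<infinity>" using exponential_moment[OF a(2)] by (simp add: ennreal_mult_less_top)
  finally show ?thesis .
qed

lemma nn_integral_tree_X:
  assumes "\<nu> \<in> I_Psi d" "g \<in> borel_measurable borel"
  shows "(\<integral>\<^sup>+\<omega>. indicator {\<omega> \<in> space M. \<nu> \<in> I_tree d (T \<omega>)} \<omega> * ennreal (g (X \<nu> \<omega>)) \<partial>M) =
    ennreal (prob {\<omega> \<in> space M. \<nu> \<in> I_tree d (T \<omega>)}) * moment g"
proof -
  define F where "F = vimage_algebra (space M) T tree_measure_space"
  define G where "G = vimage_algebra (space M) (\<lambda>\<omega>. \<lambda>\<nu>\<in>I_Psi d. X \<nu> \<omega>) (PiM (I_Psi d) (\<lambda>_. borel :: real measure))"
  have sp: "space F = space M" "space G = space M" by (auto simp: F_def G_def)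
  have "T \<in> measurable F tree_measure_space" unfolding F_def
    using gw.measurable_T by (intro measurable_vimage_algebra1) (auto dest: measurable_space)
  from pred_I_tree_measurable[OF this, of \<nu> d]
  have A: "{\<omega> \<in> space M. \<nu> \<in> I_tree d (T \<omega>)} \<in> sets F" by (simp add: pred_def sp)
  have "(\<lambda>\<omega>. \<lambda>\<nu>\<in>I_Psi d. X \<nu> \<omega>) \<in> measurable G (PiM (I_Psi d) (\<lambda>_. borel :: real measure))"
    unfolding G_def by (intro measurable_vimage_algebra1) (auto simp: space_PiM)
  from measurable_compose[OF this measurable_component_singleton[OF assms(1)]] assms(1)
  have [measurable]: "X \<nu> \<in> borel_measurable G" by simp
  have "(\<lambda>\<omega>. ennreal (g (X \<nu> \<omega>))) \<in> borel_measurable G" using assms(2) by measurable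
  moreover have "indep_set (sets F) (sets G)" using data unfolding besov_tree_data_def F_def G_def by blast
  ultimately have "(\<integral>\<^sup>+\<omega>. indicator {\<omega> \<in> space M. \<nu> \<in> I_tree d (T \<omega>)} \<omega> * ennreal (g (X \<nu> \<omega>)) \<partial>M) =
    emeasure M {\<omega> \<in> space M. \<nu> \<in> I_tree d (T \<omega>)} * (\<integral>\<^sup>+\<omega>. ennreal (g (X \<nu> \<omega>)) \<partial>M)"
    using nn_integral_indep_indicator[OF _ sp A] by blast
  then show ?thesis using nn_integral_X[OF assms] by (simp add: emeasure_eq_measure)
qed

text \<open>The number \<open>a\<close> collects all weights of a level, so that the Besov norms and
  the convergence of the series are instances. Level \<open>j\<close> contributes at most 2^d types
  times 2^((a + \<gamma>) j).\<close>

lemma expected_tree_sum_finite: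
  assumes "0 < r" "a + \<gamma> < 0"
  shows "(\<integral>\<^sup>+\<omega>. \<integral>\<^sup>+\<nu>. ennreal (2 powr (real (fst \<nu>) * a)) * (indicator {\<omega> \<in> space M. \<nu> \<in> I_tree d (T \<omega>)} \<omega> *
      ennreal (\<bar>X \<nu> \<omega>\<bar> powr r)) \<partial>count_space (I_Psi d) \<partial>M) < \<infinity>"
proof -
  let ?m = "moment (\<lambda>x. \<bar>x\<bar> powr r)"
  let ?p = "\<lambda>\<nu>. prob {\<omega> \<in> space M. \<nu> \<in> I_tree d (T \<omega>)}"
  have "(\<integral>\<^sup>+\<omega>. \<integral>\<^sup>+\<nu>. ennreal (2 powr (real (fst \<nu>) * a)) * (indicator {\<omega> \<in> space M. \<nu> \<in> I_tree d (T \<omega>)} \<omega> *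
      ennreal (\<bar>X \<nu> \<omega>\<bar> powr r)) \<partial>count_space (I_Psi d) \<partial>M) =
    (\<integral>\<^sup>+\<nu>. \<integral>\<^sup>+\<omega>. ennreal (2 powr (real (fst \<nu>) * a)) * (indicator {\<omega> \<in> space M. \<nu> \<in> I_tree d (T \<omega>)} \<omega> *
      ennreal (\<bar>X \<nu> \<omega>\<bar> powr r)) \<partial>M \<partial>count_space (I_Psi d))"
  proof (rule nn_integral_count_space_nn_integral[OF countable_I_Psi])
    fix \<nu> assume "\<nu> \<in> I_Psi d"
    note [measurable] = measurable_X[OF this]
    show "(\<lambda>\<omega>. ennreal (2 powr (real (fst \<nu>) * a)) * (indicator {\<omega> \<in> space M. \<nu> \<in> I_tree d (T \<omega>)} \<omega> *
      ennreal (\<bar>X \<nu> \<omega>\<bar> powr r))) \<in> borel_measurable M" by measurable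
  qed
  also have "\<dots> = (\<integral>\<^sup>+\<nu>. ennreal (2 powr (real (fst \<nu>) * a)) * (ennreal (?p \<nu>) * ?m) \<partial>count_space (I_Psi d))"
  proof (rule nn_integral_cong)
    fix \<nu> assume "\<nu> \<in> space (count_space (I_Psi d))"
    then have \<nu>: "\<nu> \<in> I_Psi d" by simp
    note [measurable] = measurable_X[OF this]
    show "(\<integral>\<^sup>+\<omega>. ennreal (2 powr (real (fst \<nu>) * a)) * (indicator {\<omega> \<in> space M. \<nu> \<in> I_tree d (T \<omega>)} \<omega> *
      ennreal (\<bar>X \<nu> \<omega>\<bar> powr r)) \<partial>M) = ennreal (2 powr (real (fst \<nu>) * a)) * (ennreal (?p \<nu>) * ?m)"
      by (subst nn_integral_cmult) (simp_all add: nn_integral_tree_X[OF \<nu>, of "\<lambda>x. \<bar>x\<bar> powr r"])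
  qed
  also have "\<dots> = (\<Sum>j. \<Sum>k\<in>K_set d j. \<Sum>l\<in>L_set d j. ennreal (2 powr (real j * a) * ?p (j, k, l)) * ?m)"
    by (simp add: nn_integral_I_Psi ennreal_mult mult.assoc)
  also have "\<dots> = (\<Sum>j. ennreal (\<Sum>k\<in>K_set d j. \<Sum>l\<in>L_set d j. 2 powr (real j * a) * ?p (j, k, l)) * ?m)"
    by (simp add: sum_distrib_right[symmetric] sum_nonneg)
  also have "\<dots> \<le> (\<Sum>j. ennreal (2 ^ d * (2 powr (a + \<gamma>)) ^ j) * ?m)"
  proof (intro suminf_le mult_right_mono ennreal_leI)
    fix j
    have "(\<Sum>k\<in>K_set d j. \<Sum>l\<in>L_set d j. 2 powr (real j * a) * ?p (j, k, l)) =
      (\<Sum>l\<in>L_set d j. 2 powr (real j * a) * (\<Sum>k\<in>K_set d j. ?p (j, k, l)))"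
      by (subst sum.swap) (simp add: sum_distrib_left)
    also have "\<dots> \<le> (\<Sum>l\<in>L_set d j. 2 powr (real j * a) * 2 powr (\<gamma> * real j))"
      by (intro sum_mono mult_left_mono sum_prob_tree) auto
    also have "\<dots> = real (card (L_set d j)) * (2 powr (a + \<gamma>)) ^ j"
    proof -
      have "2 powr (real j * a) * 2 powr (\<gamma> * real j) = (2 powr (a + \<gamma>)) ^ j"
        by (simp add: powr_power powr_add[symmetric] algebra_simps)
      then show ?thesis by simp
    qed
    also have "\<dots> \<le> 2 ^ d * (2 powr (a + \<gamma>)) ^ j"
      using of_nat_mono[OF card_L_set[of d j], where 'a=real] by (intro mult_right_mono) auto
    finally show "(\<Sum>k\<in>K_set d j. \<Sum>l\<in>L_set d j. 2 powr (real j * a) * ?p (j, k, l)) \<le> 2 ^ d * (2 powr (a + \<gamma>)) ^ j" .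
  qed auto
  also have "\<dots> = ennreal (\<Sum>j. 2 ^ d * (2 powr (a + \<gamma>)) ^ j) * ?m"
  proof -
    have "2 powr (a + \<gamma>) < 1" using powr_less_mono[OF assms(2), of 2] by simp
    then have "summable (\<lambda>j. 2 ^ d * (2 powr (a + \<gamma>)) ^ j)" by (intro summable_mult summable_geometric) auto
    then show ?thesis by (subst ennreal_suminf_multc) (simp add: suminf_ennreal2)
  qed
  also have "\<dots> < \<infinity>" using polynomial_moment[OF assms(1)] by (simp add: ennreal_mult_less_top)
  finally show ?thesis .
qed

end

section \<open>Strong measurability in Besov and Zygmund spaces\<close>

definition besov_weight :: "nat \<Rightarrow> real \<Rightarrow> real \<Rightarrow> windex \<Rightarrow> real" where
  "besov_weight d t q \<nu> = 2 powr (real (fst \<nu>) * q * (t + real d / 2 - real d / q))"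

lemma besov_term_eq:
  "besov_term d \<phi> \<psi> t q u \<nu> = besov_weight d t q \<nu> * \<bar>u (wavelet_torus d \<phi> \<psi> \<nu>)\<bar> powr q"
  by (cases \<nu>) (simp add: besov_term_def besov_weight_def)

lemma besov_term_nonneg: "0 \<le> besov_term d \<phi> \<psi> t q u \<nu>"
  by (simp add: besov_term_eq besov_weight_def)

lemma besov_norm_powr:
  assumes "q \<noteq> 0"
  shows "besov_norm d \<phi> \<psi> t q u powr q = (\<Sum>\<^sub>\<infinity>\<nu>\<in>I_Psi d. besov_term d \<phi> \<psi> t q u \<nu>)"
  using assms by (simp add: besov_norm_def powr_powr infsum_nonneg besov_term_nonneg)

lemma zygmund_term_nonneg: "0 \<le> zygmund_term d \<phi> \<psi> t u \<nu>"
  by (cases \<nu>) (simp add: zygmund_term_def)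

text \<open>The summand d/q in the smoothness cancels the -d/q in the Besov weight. Hence the
  embedding amounts to comparing a supremum with an l^q norm of the same terms.\<close>

lemma zygmund_term_powr:
  assumes "q \<noteq> 0"
  shows "zygmund_term d \<phi> \<psi> t u \<nu> = besov_term d \<phi> \<psi> (t + real d / q) q u \<nu> powr (1 / q)"
  using assms by (cases \<nu>) (simp add: zygmund_term_def besov_term_def powr_mult powr_powr mult_ac)

lemma I_Psi_nonempty: "I_Psi d \<noteq> {}"
proof -
  have "(0, \<lambda>i\<in>{1..d}. 0, \<lambda>i\<in>{1..d}. 0) \<in> I_Psi d" by (auto simp: I_Psi_def K_set_def L_set_def)
  then show ?thesis by blast
qed

text \<open>A single term is at most the whole sum. Boundedness is recorded as well, since the real
  supremum is meaningful only with it.\<close>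

lemma zygmund_le_besov:
  assumes "besov_term d \<phi> \<psi> (t + real d / q) q u summable_on I_Psi d" "0 < q"
  shows "bdd_above (zygmund_term d \<phi> \<psi> t u ` I_Psi d)"
    and "0 \<le> zygmund_norm d \<phi> \<psi> t u"
    and "zygmund_norm d \<phi> \<psi> t u \<le> besov_norm d \<phi> \<psi> (t + real d / q) q u"
proof -
  have le: "zygmund_term d \<phi> \<psi> t u \<nu> \<le> besov_norm d \<phi> \<psi> (t + real d / q) q u" if "\<nu> \<in> I_Psi d" for \<nu>
  proof -
    have "besov_term d \<phi> \<psi> (t + real d / q) q u \<nu> \<le> (\<Sum>\<^sub>\<infinity>\<nu>\<in>I_Psi d. besov_term d \<phi> \<psi> (t + real d / q) q u \<nu>)"
      using finite_sum_le_infsum[OF assms(1), of "{\<nu>}"] that by (simp add: besov_term_nonneg)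
    then show ?thesis using assms(2) unfolding besov_norm_def
      by (subst zygmund_term_powr[of q]) (auto intro!: powr_mono2 besov_term_nonneg)
  qed
  then show bdd: "bdd_above (zygmund_term d \<phi> \<psi> t u ` I_Psi d)" by (auto intro!: bdd_aboveI2)
  show "zygmund_norm d \<phi> \<psi> t u \<le> besov_norm d \<phi> \<psi> (t + real d / q) q u"
    unfolding zygmund_norm_def using le by (intro cSUP_least I_Psi_nonempty)
  obtain \<nu> where \<nu>: "\<nu> \<in> I_Psi d" using I_Psi_nonempty by blast
  show "0 \<le> zygmund_norm d \<phi> \<psi> t u"
    unfolding zygmund_norm_def using cSUP_upper[OF \<nu> bdd] zygmund_term_nonneg[of d \<phi> \<psi> t u \<nu>] by linarith
qed

lemma abs_diff_powr_le:
  fixes a b q :: real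
  assumes "0 < q"
  shows "\<bar>a - b\<bar> powr q \<le> 2 powr q * (\<bar>a\<bar> powr q + \<bar>b\<bar> powr q)"
proof -
  have "\<bar>a - b\<bar> powr q \<le> (2 * max \<bar>a\<bar> \<bar>b\<bar>) powr q" using assms by (intro powr_mono2) auto
  also have "\<dots> = 2 powr q * max \<bar>a\<bar> \<bar>b\<bar> powr q" by (simp add: powr_mult)
  also have "\<dots> \<le> 2 powr q * (\<bar>a\<bar> powr q + \<bar>b\<bar> powr q)" by (intro mult_left_mono) (auto simp: max_def)
  finally show ?thesis .
qed

lemma besov_term_diff_summable:
  assumes "besov_term d \<phi> \<psi> t q u summable_on I_Psi d" "besov_term d \<phi> \<psi> t q v summable_on I_Psi d" "0 < q"
  shows "besov_term d \<phi> \<psi> t q (\<lambda>g. u g - v g) summable_on I_Psi d"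
proof (rule summable_on_comparison_test)
  show "(\<lambda>\<nu>. 2 powr q * (besov_term d \<phi> \<psi> t q u \<nu> + besov_term d \<phi> \<psi> t q v \<nu>)) summable_on I_Psi d"
    by (intro summable_on_cmult_right summable_on_add assms)
  fix \<nu>
  show "besov_term d \<phi> \<psi> t q (\<lambda>g. u g - v g) \<nu> \<le> 2 powr q * (besov_term d \<phi> \<psi> t q u \<nu> + besov_term d \<phi> \<psi> t q v \<nu>)"
  proof -
    let ?a = "u (wavelet_torus d \<phi> \<psi> \<nu>)" and ?b = "v (wavelet_torus d \<phi> \<psi> \<nu>)"
    have "besov_weight d t q \<nu> * \<bar>?a - ?b\<bar> powr q \<le>
      besov_weight d t q \<nu> * (2 powr q * (\<bar>?a\<bar> powr q + \<bar>?b\<bar> powr q))"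
      by (intro mult_left_mono abs_diff_powr_le assms) (simp add: besov_weight_def)
    then show ?thesis by (simp add: besov_term_eq algebra_simps)
  qed
qed (rule besov_term_nonneg)

text \<open>By induction on \<open>F\<close>: adding an index is a binary composition of simple
  functions, namely a function update.\<close>

lemma simple_function_finite_family:
  fixes f :: "'i \<Rightarrow> 'a \<Rightarrow> 'b :: zero"
  assumes "finite F" "\<And>\<nu>. \<nu> \<in> F \<Longrightarrow> simple_function M (f \<nu>)"
  shows "simple_function M (\<lambda>\<omega> \<nu>. if \<nu> \<in> F then f \<nu> \<omega> else 0)"
  using assms
proof (induction F)
  case (insert \<mu> F)
  have "(\<lambda>\<omega> \<nu>. if \<nu> \<in> insert \<mu> F then f \<nu> \<omega> else 0) =
    (\<lambda>\<omega>. (\<lambda>\<nu>. if \<nu> \<in> F then f \<nu> \<omega> else 0)(\<mu> := f \<mu> \<omega>))"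
    by (auto simp: fun_eq_iff)
  then show ?case using simple_function_compose2[OF insert.IH, of "f \<mu>" "\<lambda>g y. g(\<mu> := y)"] insert.prems by simp
qed simp

lemma measurable_nn_integral_I_Psi:
  assumes "\<And>\<nu>. \<nu> \<in> I_Psi d \<Longrightarrow> f \<nu> \<in> borel_measurable M"
  shows "(\<lambda>\<omega>. \<integral>\<^sup>+\<nu>. f \<nu> \<omega> \<partial>count_space (I_Psi d)) \<in> borel_measurable M"
  unfolding nn_integral_I_Psi
  by (intro borel_measurable_suminf_order borel_measurable_sum assms) (auto simp: I_Psi_def)

section \<open>Coefficient families of finite energy and Bochner membership\<close>

context wavelet_pair
begin

text \<open>The expected \<open>q\<close>-th power of the Besov norm, expressed in the coefficients,
  whose measurability is clear.\<close>

definition finite_energy :: "'w measure \<Rightarrow> nat \<Rightarrow> real \<Rightarrow> real \<Rightarrow> ('w \<Rightarrow> windex \<Rightarrow> real) \<Rightarrow> bool" where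
  "finite_energy M d t q c \<longleftrightarrow>
     (\<integral>\<^sup>+\<omega>. \<integral>\<^sup>+\<nu>. ennreal (besov_weight d t q \<nu> * \<bar>c \<omega> \<nu>\<bar> powr q) \<partial>count_space (I_Psi d) \<partial>M) < \<infinity>"

lemma besov_term_synthesis:
  assumes "\<nu> \<in> I_Psi d"
  shows "besov_term d \<phi> \<psi> t q (synthesis d \<phi> \<psi> c) \<nu> = besov_weight d t q \<nu> * \<bar>c \<nu>\<bar> powr q"
  using assms by (simp add: besov_term_eq synthesis_wavelet)

context
  fixes M :: "'w measure" and d :: nat and t q :: real and b :: "'w \<Rightarrow> functional"
    and c :: "'w \<Rightarrow> windex \<Rightarrow> real" and m :: nat
  assumes q: "1 \<le> q"
    and meas: "\<And>\<nu>. \<nu> \<in> I_Psi d \<Longrightarrow> (\<lambda>\<omega>. c \<omega> \<nu>) \<in> borel_measurable M"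
    and synth: "AE \<omega> in M. b \<omega> = synthesis d \<phi> \<psi> (c \<omega>) \<and> synthesizable d (c \<omega>)"
    and energy: "finite_energy M d t q c"
begin

text \<open>A nonnegative measurable function with finite integral is finite almost everywhere;
  there the norm of \<open>b\<close> can be read off the coefficients.\<close>

lemma AE_besov:
  "AE \<omega> in M. b \<omega> \<in> besov_space d m \<phi> \<psi> t q \<and>
     (\<lambda>\<nu>. besov_weight d t q \<nu> * \<bar>c \<omega> \<nu>\<bar> powr q) summable_on I_Psi d \<and>
     ennreal (besov_norm d \<phi> \<psi> t q (b \<omega>) powr q) =
       (\<integral>\<^sup>+\<nu>. ennreal (besov_weight d t q \<nu> * \<bar>c \<omega> \<nu>\<bar> powr q) \<partial>count_space (I_Psi d))"
proof -
  have "(\<lambda>\<omega>. \<integral>\<^sup>+\<nu>. ennreal (besov_weight d t q \<nu> * \<bar>c \<omega> \<nu>\<bar> powr q) \<partial>count_space (I_Psi d)) \<in> borel_measurable M"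
    using meas by (intro measurable_nn_integral_I_Psi) measurable
  from nn_integral_PInf_AE[OF this] energy
  have "AE \<omega> in M. (\<integral>\<^sup>+\<nu>. ennreal (besov_weight d t q \<nu> * \<bar>c \<omega> \<nu>\<bar> powr q) \<partial>count_space (I_Psi d)) \<noteq> \<infinity>"
    by (simp add: finite_energy_def less_top[symmetric])
  with synth show ?thesis
  proof eventually_elim
    case (elim \<omega>)
    then have "(\<integral>\<^sup>+\<nu>. ennreal (besov_weight d t q \<nu> * \<bar>c \<omega> \<nu>\<bar> powr q) \<partial>count_space (I_Psi d)) < \<infinity>"
      by (simp add: less_top[symmetric])
    note s = summable_on_if_nn_integral_finite[OF this]
    have sum: "(\<lambda>\<nu>. besov_weight d t q \<nu> * \<bar>c \<omega> \<nu>\<bar> powr q) summable_on I_Psi d"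
      by (rule s(1)) (simp add: besov_weight_def)
    then have bsum: "besov_term d \<phi> \<psi> t q (b \<omega>) summable_on I_Psi d"
      using elim by (simp add: besov_term_synthesis cong: summable_on_cong)
    have "besov_norm d \<phi> \<psi> t q (b \<omega>) powr q = (\<Sum>\<^sub>\<infinity>\<nu>\<in>I_Psi d. besov_weight d t q \<nu> * \<bar>c \<omega> \<nu>\<bar> powr q)"
      using elim q by (subst besov_norm_powr) (auto intro!: infsum_cong simp: besov_term_synthesis)
    then have "ennreal (besov_norm d \<phi> \<psi> t q (b \<omega>) powr q) =
       (\<integral>\<^sup>+\<nu>. ennreal (besov_weight d t q \<nu> * \<bar>c \<omega> \<nu>\<bar> powr q) \<partial>count_space (I_Psi d))"
      using s(2) by (simp add: besov_weight_def)
    with sum bsum show ?case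
      using elim synthesis_distribution[of d "c \<omega>" m] by (simp add: besov_space_def)
  qed
qed

text \<open>The approximating simple functions are finite wavelet sums over the levels up to \<open>n\<close> whose
  coefficients approximate those of \<open>b\<close> by simple functions dominated by twice the coefficient.\<close>

lemma strongly_measurable_besov:
  "\<exists>u. (\<forall>n::nat. simple_function M (u n) \<and> u n ` space M \<subseteq> besov_space d m \<phi> \<psi> t q) \<and>
      (AE \<omega> in M. b \<omega> \<in> besov_space d m \<phi> \<psi> t q \<and> (\<lambda>n. besov_norm d \<phi> \<psi> t q (\<lambda>g. u n \<omega> g - b \<omega> g)) \<longlonglongrightarrow> 0)"
proof -
  let ?W = "besov_weight d t q"
  \<comment> \<open>Approximation relative to the base point 0 gives the domination by twice the
    distance to 0.\<close>
  have "\<exists>F. (\<forall>i. simple_function M (F i)) \<and> (\<forall>\<omega>\<in>space M. (\<lambda>i. F i \<omega>) \<longlonglongrightarrow> c \<omega> \<nu>) \<and>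
    (\<forall>i. \<forall>\<omega>\<in>space M. \<bar>F i \<omega>\<bar> \<le> 2 * \<bar>c \<omega> \<nu>\<bar>)" if "\<nu> \<in> I_Psi d" for \<nu>
    using borel_measurable_implies_sequence_metric[OF meas[OF that], of 0] by simp
  then obtain F where F: "\<And>\<nu> i. \<nu> \<in> I_Psi d \<Longrightarrow> simple_function M (F \<nu> i)"
    "\<And>\<nu> \<omega>. \<nu> \<in> I_Psi d \<Longrightarrow> \<omega> \<in> space M \<Longrightarrow> (\<lambda>i. F \<nu> i \<omega>) \<longlonglongrightarrow> c \<omega> \<nu>"
    "\<And>\<nu> i \<omega>. \<nu> \<in> I_Psi d \<Longrightarrow> \<omega> \<in> space M \<Longrightarrow> \<bar>F \<nu> i \<omega>\<bar> \<le> 2 * \<bar>c \<omega> \<nu>\<bar>"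
    by metis
  define I where "I n = {\<nu> \<in> I_Psi d. fst \<nu> \<le> n}" for n :: nat
  have fin: "finite (I n)" for n
  proof (rule finite_subset)
    show "I n \<subseteq> Sigma {..n} (\<lambda>j. K_set d j \<times> L_set d j)" by (auto simp: I_def I_Psi_def)
  qed (auto intro: finite_K_set finite_L_set)
  define cn where "cn n \<omega> \<nu> = (if \<nu> \<in> I n then F \<nu> n \<omega> else 0)" for n \<omega> \<nu>
  define u where "u n \<omega> = synthesis d \<phi> \<psi> (cn n \<omega>)" for n \<omega>
  have "simple_function M (cn n)" for n
    unfolding cn_def[abs_def] by (rule simple_function_finite_family[OF fin]) (auto simp: I_def F)
  then have 1: "simple_function M (u n)" for n
    unfolding u_def[abs_def] by (rule simple_function_compose1)
  have 2: "u n \<omega> \<in> besov_space d m \<phi> \<psi> t q" for n \<omega>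
  proof -
    have "synthesizable d (cn n \<omega>)" by (rule synthesizable_finite[OF fin[of n]]) (simp add: cn_def)
    then have "u n \<omega> \<in> distributions d m" unfolding u_def by (rule synthesis_distribution)
    moreover have "besov_term d \<phi> \<psi> t q (u n \<omega>) summable_on I_Psi d"
    proof (rule summable_on_cong_neutral[THEN iffD1])
      show "besov_term d \<phi> \<psi> t q (u n \<omega>) summable_on I n" by (rule summable_on_finite[OF fin])
      fix \<nu> assume "\<nu> \<in> I_Psi d - I n"
      then show "besov_term d \<phi> \<psi> t q (u n \<omega>) \<nu> = 0" using q
        by (simp add: u_def besov_term_synthesis cn_def)
    qed (auto simp: I_def)
    ultimately show ?thesis by (simp add: besov_space_def)
  qed
  have 3: "AE \<omega> in M. b \<omega> \<in> besov_space d m \<phi> \<psi> t q \<and>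
    (\<lambda>n. besov_norm d \<phi> \<psi> t q (\<lambda>g. u n \<omega> g - b \<omega> g)) \<longlonglongrightarrow> 0"
    using AE_besov synth AE_space
  proof eventually_elim
    case (elim \<omega>)
    let ?f = "\<lambda>n \<nu>. ?W \<nu> * \<bar>cn n \<omega> \<nu> - c \<omega> \<nu>\<bar> powr q"
    \<comment> \<open>The error of a coefficient is at most 2 |c| + |c|, whence the factor 3 in the
      dominating function.\<close>
    have int: "integrable (count_space (I_Psi d)) (\<lambda>\<nu>. 3 powr q * (?W \<nu> * \<bar>c \<omega> \<nu>\<bar> powr q))"
      using elim by (intro integrable_mult_right) (simp add: summable_on_iff_integrable_count_space)
    have bound: "norm (?f n \<nu>) \<le> 3 powr q * (?W \<nu> * \<bar>c \<omega> \<nu>\<bar> powr q)" if "\<nu> \<in> I_Psi d" for n \<nu>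
    proof -
      have "\<bar>cn n \<omega> \<nu> - c \<omega> \<nu>\<bar> \<le> 3 * \<bar>c \<omega> \<nu>\<bar>"
        using F(3)[OF that, of \<omega> n] elim by (auto simp: cn_def)
      then have "\<bar>cn n \<omega> \<nu> - c \<omega> \<nu>\<bar> powr q \<le> (3 * \<bar>c \<omega> \<nu>\<bar>) powr q"
        using q by (intro powr_mono2) auto
      from mult_left_mono[OF this, of "?W \<nu>"] show ?thesis
        by (simp add: powr_mult besov_weight_def mult_ac)
    qed
    \<comment> \<open>Once \<open>n\<close> passes the level of \<nu>, the truncation to
      \<open>I n\<close> no longer acts and the convergence of \<open>F\<close> is
      inherited.\<close>
    have lim: "(\<lambda>n. ?f n \<nu>) \<longlonglongrightarrow> 0" if "\<nu> \<in> I_Psi d" for \<nu>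
    proof -
      have "\<forall>\<^sub>F n in sequentially. F \<nu> n \<omega> = cn n \<omega> \<nu>"
        using eventually_ge_at_top[of "fst \<nu>"] by eventually_elim (use that in \<open>simp add: cn_def I_def\<close>)
      with F(2)[OF that, of \<omega>] elim have "(\<lambda>n. cn n \<omega> \<nu>) \<longlonglongrightarrow> c \<omega> \<nu>"
        by (blast intro: Lim_transform_eventually)
      then have "(\<lambda>n. \<bar>cn n \<omega> \<nu> - c \<omega> \<nu>\<bar>) \<longlonglongrightarrow> 0" by (simp add: LIM_zero tendsto_rabs_zero)
      then have "(\<lambda>n. \<bar>cn n \<omega> \<nu> - c \<omega> \<nu>\<bar> powr q) \<longlonglongrightarrow> 0 powr q"
        using q by (intro tendsto_powr') auto
      from tendsto_mult_left[OF this, of "?W \<nu>"] show ?thesis using q by simp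
    qed
    have sum: "(\<lambda>\<nu>. ?f n \<nu>) summable_on I_Psi d" for n
      unfolding summable_on_iff_integrable_count_space
    proof (rule Bochner_Integration.integrable_bound[OF int])
      show "AE \<nu> in count_space (I_Psi d). norm (?f n \<nu>) \<le> norm (3 powr q * (?W \<nu> * \<bar>c \<omega> \<nu>\<bar> powr q))"
        using order_trans[OF bound abs_ge_self] by (intro AE_I2) simp
    qed simp
    have "(\<lambda>n. \<integral>\<nu>. ?f n \<nu> \<partial>count_space (I_Psi d)) \<longlonglongrightarrow> (\<integral>\<nu>. 0 \<partial>count_space (I_Psi d))"
      by (rule integral_dominated_convergence[OF _ _ int]) (use bound lim in \<open>auto simp: AE_count_space\<close>)
    then have "(\<lambda>n. \<Sum>\<^sub>\<infinity>\<nu>\<in>I_Psi d. ?f n \<nu>) \<longlonglongrightarrow> 0"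
      using summable_on_iff_integrable_count_space(2)[OF sum] by simp
    then have "(\<lambda>n. (\<Sum>\<^sub>\<infinity>\<nu>\<in>I_Psi d. ?f n \<nu>) powr (1 / q)) \<longlonglongrightarrow> 0 powr (1 / q)"
      using q by (intro tendsto_powr') (auto intro!: always_eventually infsum_nonneg simp: besov_weight_def)
    moreover have "besov_norm d \<phi> \<psi> t q (\<lambda>g. u n \<omega> g - b \<omega> g) = (\<Sum>\<^sub>\<infinity>\<nu>\<in>I_Psi d. ?f n \<nu>) powr (1 / q)" for n
      using elim unfolding besov_norm_def u_def
      by (auto intro!: arg_cong[where f="\<lambda>x. x powr (1 / q)"] infsum_cong simp: besov_term_eq synthesis_wavelet)
    ultimately show ?case using elim q by simp
  qed
  from 1 2 3 show ?thesis by (intro exI[of _ u]) blast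
qed

lemma bochner_besov: "b \<in> bochner_Lq M q (besov_space d m \<phi> \<psi> t q) (besov_norm d \<phi> \<psi> t q)"
proof -
  have "(\<integral>\<^sup>+\<omega>. ennreal (besov_norm d \<phi> \<psi> t q (b \<omega>) powr q) \<partial>M) =
    (\<integral>\<^sup>+\<omega>. \<integral>\<^sup>+\<nu>. ennreal (besov_weight d t q \<nu> * \<bar>c \<omega> \<nu>\<bar> powr q) \<partial>count_space (I_Psi d) \<partial>M)"
    by (rule nn_integral_cong_AE) (use AE_besov in eventually_elim, blast)
  with strongly_measurable_besov energy show ?thesis
    by (simp add: bochner_Lq_def finite_energy_def)
qed

text \<open>The embedding carries the approximating simple functions over to the Zygmund norm. The
  exponent \<open>r\<close> is separate from \<open>q\<close> because the embedding may need a
  larger exponent than the one wanted for the moment.\<close>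

lemma bochner_zygmund:
  assumes "prob_space M" "1 \<le> r" "r \<le> q" "t = t' + real d / q"
  shows "b \<in> bochner_Lq M r (zygmund_space d m \<phi> \<psi> t') (zygmund_norm d \<phi> \<psi> t')"
proof -
  interpret prob_space M by fact
  let ?S = "\<lambda>\<omega>. \<integral>\<^sup>+\<nu>. ennreal (besov_weight d t q \<nu> * \<bar>c \<omega> \<nu>\<bar> powr q) \<partial>count_space (I_Psi d)"
  have q0: "0 < q" using q by simp
  note zb = zygmund_le_besov[of d \<phi> \<psi> t' q, folded assms(4), OF _ q0]
  have sub: "besov_space d m \<phi> \<psi> t q \<subseteq> zygmund_space d m \<phi> \<psi> t'"
    using zb by (auto simp: besov_space_def zygmund_space_def)
  obtain u where u: "\<And>n. simple_function M (u n)" "\<And>n. u n ` space M \<subseteq> besov_space d m \<phi> \<psi> t q"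
    "AE \<omega> in M. b \<omega> \<in> besov_space d m \<phi> \<psi> t q \<and> (\<lambda>n. besov_norm d \<phi> \<psi> t q (\<lambda>g. u n \<omega> g - b \<omega> g)) \<longlonglongrightarrow> 0"
    using strongly_measurable_besov by blast
  have "AE \<omega> in M. b \<omega> \<in> zygmund_space d m \<phi> \<psi> t' \<and> (\<lambda>n. zygmund_norm d \<phi> \<psi> t' (\<lambda>g. u n \<omega> g - b \<omega> g)) \<longlonglongrightarrow> 0"
    using u(3) AE_space
  proof eventually_elim
    case (elim \<omega>)
    have "besov_term d \<phi> \<psi> t q (\<lambda>g. u n \<omega> g - b \<omega> g) summable_on I_Psi d" for n
      using elim u(2)[of n] q0 by (intro besov_term_diff_summable) (auto simp: besov_space_def)
    note z = zb[OF this]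
    have "(\<lambda>n. zygmund_norm d \<phi> \<psi> t' (\<lambda>g. u n \<omega> g - b \<omega> g)) \<longlonglongrightarrow> 0"
    proof (rule real_tendsto_sandwich)
      show "\<forall>\<^sub>F n in sequentially. 0 \<le> zygmund_norm d \<phi> \<psi> t' (\<lambda>g. u n \<omega> g - b \<omega> g)"
        by (intro always_eventually allI z(2))
      show "\<forall>\<^sub>F n in sequentially. zygmund_norm d \<phi> \<psi> t' (\<lambda>g. u n \<omega> g - b \<omega> g) \<le>
          besov_norm d \<phi> \<psi> t q (\<lambda>g. u n \<omega> g - b \<omega> g)"
        by (intro always_eventually allI z(3))
      show "(\<lambda>n. besov_norm d \<phi> \<psi> t q (\<lambda>g. u n \<omega> g - b \<omega> g)) \<longlonglongrightarrow> 0" using elim by blast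
    qed (rule tendsto_const)
    then show ?case using elim sub by blast
  qed
  moreover have "(\<integral>\<^sup>+\<omega>. ennreal (zygmund_norm d \<phi> \<psi> t' (b \<omega>) powr r) \<partial>M) < \<infinity>"
  proof -
    have "(\<integral>\<^sup>+\<omega>. ennreal (zygmund_norm d \<phi> \<psi> t' (b \<omega>) powr r) \<partial>M) \<le> (\<integral>\<^sup>+\<omega>. 1 + ?S \<omega> \<partial>M)"
    proof (rule nn_integral_mono_AE)
      show "AE \<omega> in M. ennreal (zygmund_norm d \<phi> \<psi> t' (b \<omega>) powr r) \<le> 1 + ?S \<omega>"
        using AE_besov
      proof eventually_elim
        case (elim \<omega>)
        let ?z = "zygmund_norm d \<phi> \<psi> t' (b \<omega>)"
        have z: "0 \<le> ?z" "?z \<le> besov_norm d \<phi> \<psi> t q (b \<omega>)" using zb[of "b \<omega>"] elim by (auto simp: besov_space_def)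
        have "?z powr r \<le> 1 + ?z powr q"
        proof (cases "?z \<le> 1")
          case True
          then have "?z powr r \<le> 1 powr r" using z assms by (intro powr_mono2) auto
          then show ?thesis by (rule order_trans) simp
        next
          case False
          then have "?z powr r \<le> ?z powr q" using assms by (intro powr_mono) auto
          then show ?thesis by simp
        qed
        also have "?z powr q \<le> besov_norm d \<phi> \<psi> t q (b \<omega>) powr q" using z q by (intro powr_mono2) auto
        finally have "ennreal (?z powr r) \<le> ennreal (1 + besov_norm d \<phi> \<psi> t q (b \<omega>) powr q)" by (intro ennreal_leI) auto
        also have "\<dots> = 1 + ?S \<omega>" using elim by (simp add: ennreal_plus)
        finally show ?case .
      qed
    qed
    also have "\<dots> = 1 + (\<integral>\<^sup>+\<omega>. ?S \<omega> \<partial>M)"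
      using meas by (subst nn_integral_add) (auto simp: emeasure_space_1 intro!: measurable_nn_integral_I_Psi)
    also have "\<dots> < \<infinity>" using energy by (simp add: finite_energy_def)
    finally show ?thesis .
  qed
  ultimately show ?thesis using u(1,2) sub unfolding bochner_Lq_def by blast
qed

end

end

section \<open>Regularity of the random tree prior\<close>

text \<open>In a complete space a change on a null set preserves measurability; this is needed
  because nothing controls \<open>b\<close> where its series fails to converge.\<close>

lemma (in complete_measure) borel_measurable_AE_eq:
  fixes f g :: "'a \<Rightarrow> real"
  assumes "f \<in> borel_measurable M" "AE x in M. f x = g x"
  shows "g \<in> borel_measurable M"
proof (rule measurableI)
  fix A :: "real set" assume "A \<in> sets borel"
  with assms(1) have "f -` A \<inter> space M \<in> sets M" by (rule measurable_sets)
  moreover have "AE x in M. x \<in> f -` A \<inter> space M \<longleftrightarrow> x \<in> g -` A \<inter> space M"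
    using assms(2) by eventually_elim simp
  ultimately show "g -` A \<inter> space M \<in> sets M"
    using in_sets_AE[of "f -` A \<inter> space M" "g -` A \<inter> space M"] by simp
qed simp

locale besov_prior = besov_tree M d p \<kappa> \<gamma> X T + wavelet_pair \<alpha> \<phi> \<psi>
  for M :: "'w measure" and d p \<kappa> \<gamma> X T \<alpha> \<phi> \<psi> +
  fixes s :: real and m :: nat
begin

definition b :: "'w \<Rightarrow> functional" where
  "b = b_tree d m s p \<phi> \<psi> X T"

text \<open>Extension by 0 beyond the tree replaces the random index set by the fixed set
  \<open>I_Psi d\<close>.\<close>

definition coef :: "'w \<Rightarrow> windex \<Rightarrow> real" where
  "coef \<omega> \<nu> = (if \<nu> \<in> I_tree d (T \<omega>) then eta d s p (fst \<nu>) * X \<nu> \<omega> else 0)"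

lemma measurable_coef:
  assumes "\<nu> \<in> I_Psi d"
  shows "(\<lambda>\<omega>. coef \<omega> \<nu>) \<in> borel_measurable M"
proof -
  note [measurable] = measurable_X[OF assms]
  show ?thesis unfolding coef_def by measurable
qed

text \<open>Absolute convergence against all test functions selects the first branch of
  \<open>b_tree\<close>, and the coefficients outside the tree add only zeros.\<close>

lemma b_eq_synthesis:
  assumes "synthesizable d (coef \<omega>)"
  shows "b \<omega> = synthesis d \<phi> \<psi> (coef \<omega>)"
proof -
  have eq: "b_series_term d s p \<phi> \<psi> X \<omega> g \<nu> = coef \<omega> \<nu> * pairing d \<phi> \<psi> \<nu> g" if "\<nu> \<in> I_tree d (T \<omega>)" for g \<nu>
    using that by (simp add: b_series_term_def coef_def pairing_def)
  have "b_series_term d s p \<phi> \<psi> X \<omega> g summable_on I_tree d (T \<omega>)" if "g \<in> test_fun d m" for g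
    using summable_synthesis[OF assms test_fun_continuous[OF that]]
    by (rule summable_on_cong_neutral[THEN iffD1, rotated -1])
       (use I_tree_subset eq in \<open>auto simp: coef_def\<close>)
  moreover have "(\<Sum>\<^sub>\<infinity>\<nu>\<in>I_tree d (T \<omega>). b_series_term d s p \<phi> \<psi> X \<omega> g \<nu>) = synthesis d \<phi> \<psi> (coef \<omega>) g" for g
    unfolding synthesis_def
    by (rule infsum_cong_neutral) (use I_tree_subset eq in \<open>auto simp: coef_def\<close>)
  ultimately show ?thesis by (simp add: b_def b_tree_def)
qed

lemma coef_energy:
  assumes "0 < r" "a - r * (s + real d / 2 - real d / p) + \<gamma> < 0"
  shows "(\<integral>\<^sup>+\<omega>. \<integral>\<^sup>+\<nu>. ennreal (2 powr (real (fst \<nu>) * a) * \<bar>coef \<omega> \<nu>\<bar> powr r) \<partial>count_space (I_Psi d) \<partial>M) < \<infinity>"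
proof -
  have "(\<integral>\<^sup>+\<omega>. \<integral>\<^sup>+\<nu>. ennreal (2 powr (real (fst \<nu>) * a) * \<bar>coef \<omega> \<nu>\<bar> powr r) \<partial>count_space (I_Psi d) \<partial>M) =
    (\<integral>\<^sup>+\<omega>. \<integral>\<^sup>+\<nu>. ennreal (2 powr (real (fst \<nu>) * (a - r * (s + real d / 2 - real d / p)))) *
      (indicator {\<omega> \<in> space M. \<nu> \<in> I_tree d (T \<omega>)} \<omega> * ennreal (\<bar>X \<nu> \<omega>\<bar> powr r)) \<partial>count_space (I_Psi d) \<partial>M)"
  proof (intro nn_integral_cong)
    fix \<omega> \<nu> assume "\<omega> \<in> space M"
    have "2 powr (real (fst \<nu>) * a) * \<bar>eta d s p (fst \<nu>) * X \<nu> \<omega>\<bar> powr r =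
      2 powr (real (fst \<nu>) * (a - r * (s + real d / 2 - real d / p))) * \<bar>X \<nu> \<omega>\<bar> powr r"
    proof -
      have "\<bar>eta d s p (fst \<nu>) * X \<nu> \<omega>\<bar> powr r = eta d s p (fst \<nu>) powr r * \<bar>X \<nu> \<omega>\<bar> powr r"
        by (simp add: abs_mult powr_mult eta_def)
      moreover have "2 powr (real (fst \<nu>) * a) * eta d s p (fst \<nu>) powr r =
        2 powr (real (fst \<nu>) * a + (- (real (fst \<nu>) * (s + real d / 2 - real d / p))) * r)"
        by (simp only: eta_def powr_powr powr_add)
      moreover have "real (fst \<nu>) * a + (- (real (fst \<nu>) * (s + real d / 2 - real d / p))) * r =
        real (fst \<nu>) * (a - r * (s + real d / 2 - real d / p))" by (simp add: algebra_simps)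
      ultimately show ?thesis by (metis mult.assoc)
    qed
    then show "ennreal (2 powr (real (fst \<nu>) * a) * \<bar>coef \<omega> \<nu>\<bar> powr r) =
      ennreal (2 powr (real (fst \<nu>) * (a - r * (s + real d / 2 - real d / p)))) *
      (indicator {\<omega> \<in> space M. \<nu> \<in> I_tree d (T \<omega>)} \<omega> * ennreal (\<bar>X \<nu> \<omega>\<bar> powr r))"
      using \<open>\<omega> \<in> space M\<close> assms(1) by (simp add: coef_def ennreal_mult[symmetric])
  qed
  also have "\<dots> < \<infinity>" using assms by (intro expected_tree_sum_finite)
  finally show ?thesis .
qed

text \<open>Synthesizability is the energy estimate with r = 1 and a = -d/2; the resulting exponent
  is \<gamma> - s - d + d/p.\<close>

lemma AE_synthesis:
  assumes "\<gamma> < s + real d - real d / p"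
  shows "AE \<omega> in M. b \<omega> = synthesis d \<phi> \<psi> (coef \<omega>) \<and> synthesizable d (coef \<omega>)"
proof -
  let ?f = "\<lambda>\<omega> \<nu>. 2 powr (real (fst \<nu>) * (- (real d / 2))) * \<bar>coef \<omega> \<nu>\<bar> powr 1"
  have "(\<lambda>\<omega>. \<integral>\<^sup>+\<nu>. ennreal (?f \<omega> \<nu>) \<partial>count_space (I_Psi d)) \<in> borel_measurable M"
    using measurable_coef by (intro measurable_nn_integral_I_Psi) measurable
  moreover have "(\<integral>\<^sup>+\<omega>. \<integral>\<^sup>+\<nu>. ennreal (?f \<omega> \<nu>) \<partial>count_space (I_Psi d) \<partial>M) < \<infinity>"
  proof (rule coef_energy)
    have "- (real d / 2) - 1 * (s + real d / 2 - x) + \<gamma> < 0" if "\<gamma> < s + real d - x" for x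
      using that by (simp add: field_simps)
    from this[OF assms] show "- (real d / 2) - 1 * (s + real d / 2 - real d / p) + \<gamma> < 0" .
  qed simp
  ultimately have "AE \<omega> in M. (\<integral>\<^sup>+\<nu>. ennreal (?f \<omega> \<nu>) \<partial>count_space (I_Psi d)) \<noteq> \<infinity>"
    by (intro nn_integral_PInf_AE) auto
  then show ?thesis
  proof eventually_elim
    case (elim \<omega>)
    then have "?f \<omega> summable_on I_Psi d"
      by (intro summable_on_if_nn_integral_finite(1)) (auto simp: less_top[symmetric])
    then have "synthesizable d (coef \<omega>)" by (simp add: synthesizable_def mult_ac)
    with b_eq_synthesis show ?case by blast
  qed
qed

lemma smoothness_bound:
  assumes "0 < t" "1 \<le> q" "t < s + (real d - \<gamma>) / q - real d / p"
  shows "AE \<omega> in M. b \<omega> = synthesis d \<phi> \<psi> (coef \<omega>) \<and> synthesizable d (coef \<omega>)"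
    and "finite_energy M d t q coef"
proof -
  \<comment> \<open>As \<gamma> \<le> d and q \<ge> 1, the exponent 1 gives the weakest condition;
    together with t > 0 it ensures convergence of the series.\<close>
  have "(real d - \<gamma>) / q \<le> real d - \<gamma>" using \<gamma> assms(2) by (simp add: pos_divide_le_eq mult_le_cancel_left1)
  then show "AE \<omega> in M. b \<omega> = synthesis d \<phi> \<psi> (coef \<omega>) \<and> synthesizable d (coef \<omega>)"
    using assms by (intro AE_synthesis) linarith
  \<comment> \<open>Multiplication by \<open>q\<close> turns the hypothesis into negativity of q (t
    - s + d/p) - d + \<gamma>, the exponent of the geometric series.\<close>
  have "q * t < q * (s + (real d - \<gamma>) / q - real d / p)" using assms by (intro mult_strict_left_mono) auto
  also have "\<dots> = q * s + (real d - \<gamma>) - q * (real d / p)" 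
  proof -
    have "q * ((real d - \<gamma>) / q) = real d - \<gamma>" using assms(2) by simp
    then show ?thesis by (simp only: distrib_left right_diff_distrib)
  qed
  finally have "q * (t + real d / 2 - real d / q) - q * (s + real d / 2 - real d / p) + \<gamma> < 0"
    using assms(2) by (simp add: algebra_simps)
  from coef_energy[OF _ this] assms(2) show "finite_energy M d t q coef"
    by (simp add: finite_energy_def besov_weight_def mult.assoc)
qed

lemma besov_regularity:
  assumes "0 < t" "1 \<le> q" "t < s + (real d - \<gamma>) / q - real d / p"
  shows "b \<in> bochner_Lq M q (besov_space d m \<phi> \<psi> t q) (besov_norm d \<phi> \<psi> t q)"
    and "AE \<omega> in M. b \<omega> \<in> besov_space d m \<phi> \<psi> t q"
proof -
  note sb = smoothness_bound[OF assms]
  show "b \<in> bochner_Lq M q (besov_space d m \<phi> \<psi> t q) (besov_norm d \<phi> \<psi> t q)"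
    by (rule bochner_besov[OF assms(2) measurable_coef sb])
  show "AE \<omega> in M. b \<omega> \<in> besov_space d m \<phi> \<psi> t q"
    by (rule eventually_mono[OF AE_besov[OF assms(2) _ sb, where m=m]]) (erule measurable_coef, blast)
qed

text \<open>For positive \<open>\<gamma>\<close> the loss \<open>\<gamma> / q'\<close> of smoothness in the embedding into the Zygmund space is made
  arbitrarily small by passing to a large integrability exponent \<open>q'\<close>.\<close>

lemma zygmund_regularity:
  assumes "0 < t" "1 \<le> q" "t < s - real d / p - min \<gamma> 0 / q"
  shows "b \<in> bochner_Lq M q (zygmund_space d m \<phi> \<psi> t) (zygmund_norm d \<phi> \<psi> t)"
proof -
  have "\<exists>q'\<ge>q. t < s - real d / p - \<gamma> / q'"
  proof (cases "\<gamma> \<le> 0")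
    case True
    with assms show ?thesis by (intro exI[of _ q]) (simp add: min_def)
  next
    case False
    define \<delta> where "\<delta> = s - real d / p - t"
    have \<delta>: "0 < \<delta>" using assms False by (simp add: \<delta>_def)
    \<comment> \<open>The additional 1 makes \<open>q'\<close> strictly larger than
      \<gamma>/\<delta>, so that \<gamma>/q' < \<delta>.\<close>
    define q' where "q' = max q (\<gamma> / \<delta> + 1)"
    have "\<gamma> / \<delta> < q'" "0 < q'" using assms by (auto simp: q'_def)
    then have "\<gamma> / q' < \<delta>" using \<delta> by (simp add: field_simps)
    then show ?thesis by (intro exI[of _ q']) (simp add: q'_def \<delta>_def)
  qed
  then obtain q' where q': "q \<le> q'" "t < s - real d / p - \<gamma> / q'" by blast
  have q1: "1 \<le> q'" using q' assms by simp
  have t0: "0 < t + real d / q'" using assms q1 by (intro add_pos_nonneg) auto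
  have "t + real d / q' < s + (real d - \<gamma>) / q' - real d / p"
    using q' by (simp add: diff_divide_distrib)
  note sb = smoothness_bound[OF t0 q1 this]
  show ?thesis
    by (rule bochner_zygmund[OF q1 measurable_coef sb prob_space_axioms assms(2) q'(1) refl])
qed

section \<open>Exponential moments in the Zygmund norm\<close>

definition exp_sum :: "real \<Rightarrow> real \<Rightarrow> 'w \<Rightarrow> ennreal" where
  "exp_sum \<delta> \<epsilon> \<omega> = (\<integral>\<^sup>+\<nu>. ennreal (exp (2 * \<epsilon> * \<bar>X \<nu> \<omega>\<bar> powr p - \<epsilon> * 2 powr (real (fst \<nu>) * \<delta> * p))) \<partial>count_space (I_Psi d))"

lemma measurable_exp_sum: "exp_sum \<delta> \<epsilon> \<in> borel_measurable M"
  unfolding exp_sum_def[abs_def]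
proof (rule measurable_nn_integral_I_Psi)
  fix \<nu> assume "\<nu> \<in> I_Psi d"
  note [measurable] = measurable_X[OF this]
  show "(\<lambda>\<omega>. ennreal (exp (2 * \<epsilon> * \<bar>X \<nu> \<omega>\<bar> powr p - \<epsilon> * 2 powr (real (fst \<nu>) * \<delta> * p)))) \<in> borel_measurable M"
    by measurable
qed

text \<open>The factor exp (-\<epsilon> 2^(j \<delta> p)) decays doubly exponentially in the level
  and beats the number of wavelets, of order 2^(d j); what remains is an exponential moment of order
  2 \<epsilon>.\<close>

lemma expected_exp_sum_finite:
  assumes "0 < \<delta>" "0 < \<epsilon>" "2 * \<epsilon> < 1 / \<kappa>"
  shows "(\<integral>\<^sup>+\<omega>. exp_sum \<delta> \<epsilon> \<omega> \<partial>M) < \<infinity>"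
proof -
  let ?m = "moment (\<lambda>x. exp (2 * \<epsilon> * \<bar>x\<bar> powr p))"
  let ?e = "\<lambda>j. exp (- \<epsilon> * 2 powr (real j * \<delta> * p))"
  \<comment> \<open>Chosen so that (2^(j \<delta> p))^r = 2^(j (d + 1)); against 2^(d j) positions
    this leaves 2^(-j).\<close>
  define r where "r = (real d + 1) / (\<delta> * p)"
  define C where "C = (r / \<epsilon>) powr r"
  have r: "0 < r" using assms p by (simp add: r_def)
  have e: "?e j \<le> C * 2 powr (- (real j * (real d + 1)))" for j
  proof -
    let ?y = "2 powr (real j * \<delta> * p)"
    have "?y powr r \<le> C * exp (\<epsilon> * ?y)" unfolding C_def using assms r by (intro powr_le_exp) auto
    moreover have "?y powr r = 2 powr (real j * (real d + 1))"
      using assms p by (simp add: powr_powr r_def)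
    ultimately have le: "2 powr (real j * (real d + 1)) \<le> C * exp (\<epsilon> * ?y)" by simp
    have "inverse E \<le> C * inverse Z" if "Z \<le> C * E" "0 < Z" "0 < E" for Z E :: real
      using that by (simp add: field_simps)
    from this[OF le] show ?thesis by (simp only: mult_minus_left exp_minus powr_minus) simp
  qed
  have "(\<integral>\<^sup>+\<omega>. exp_sum \<delta> \<epsilon> \<omega> \<partial>M) = (\<integral>\<^sup>+\<nu>. \<integral>\<^sup>+\<omega>. ennreal (exp (2 * \<epsilon> * \<bar>X \<nu> \<omega>\<bar> powr p - \<epsilon> * 2 powr (real (fst \<nu>) * \<delta> * p)))
    \<partial>M \<partial>count_space (I_Psi d))"
    unfolding exp_sum_def
  proof (rule nn_integral_count_space_nn_integral[OF countable_I_Psi])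
    fix \<nu> assume "\<nu> \<in> I_Psi d"
    note [measurable] = measurable_X[OF this]
    show "(\<lambda>\<omega>. ennreal (exp (2 * \<epsilon> * \<bar>X \<nu> \<omega>\<bar> powr p - \<epsilon> * 2 powr (real (fst \<nu>) * \<delta> * p)))) \<in> borel_measurable M"
      by measurable
  qed
  also have "\<dots> = (\<integral>\<^sup>+\<nu>. ennreal (?e (fst \<nu>)) * ?m \<partial>count_space (I_Psi d))"
  proof (rule nn_integral_cong)
    fix \<nu> assume "\<nu> \<in> space (count_space (I_Psi d))"
    then have \<nu>: "\<nu> \<in> I_Psi d" by simp
    note [measurable] = measurable_X[OF this]
    have "(\<integral>\<^sup>+\<omega>. ennreal (exp (2 * \<epsilon> * \<bar>X \<nu> \<omega>\<bar> powr p - \<epsilon> * 2 powr (real (fst \<nu>) * \<delta> * p))) \<partial>M) =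
      (\<integral>\<^sup>+\<omega>. ennreal (?e (fst \<nu>)) * ennreal (exp (2 * \<epsilon> * \<bar>X \<nu> \<omega>\<bar> powr p)) \<partial>M)"
      by (intro nn_integral_cong) (simp add: ennreal_mult[symmetric] exp_add[symmetric] exp_diff exp_minus divide_inverse mult.commute)
    also have "\<dots> = ennreal (?e (fst \<nu>)) * ?m"
      using nn_integral_X[OF \<nu>, of "\<lambda>x. exp (2 * \<epsilon> * \<bar>x\<bar> powr p)"] by (subst nn_integral_cmult) simp_all
    finally show "(\<integral>\<^sup>+\<omega>. ennreal (exp (2 * \<epsilon> * \<bar>X \<nu> \<omega>\<bar> powr p - \<epsilon> * 2 powr (real (fst \<nu>) * \<delta> * p))) \<partial>M) =
      ennreal (?e (fst \<nu>)) * ?m" .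
  qed
  also have "\<dots> = (\<Sum>j. ennreal (real (card (K_set d j)) * (real (card (L_set d j)) * ?e j)) * ?m)"
    by (simp add: nn_integral_I_Psi ennreal_mult ennreal_of_nat_eq_real_of_nat mult.assoc)
  also have "\<dots> \<le> (\<Sum>j. ennreal (2 ^ d * C * (1 / 2) ^ j) * ?m)"
  proof (intro suminf_le mult_right_mono ennreal_leI)
    fix j
    have "real (card (K_set d j)) * (real (card (L_set d j)) * ?e j) \<le>
      2 ^ (d * j) * (2 ^ d * (C * 2 powr (- (real j * (real d + 1)))))"
      using of_nat_mono[OF card_L_set[of d j], where 'a=real] e[of j]
      by (intro mult_mono) (auto simp: card_K_set)
    also have "\<dots> = 2 ^ d * C * (2 powr (real (d * j)) * 2 powr (- (real j * (real d + 1))))"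
    proof -
      have "(2::real) ^ (d * j) = 2 powr real (d * j)" by (subst powr_realpow) simp_all
      then show ?thesis by (simp only: mult_ac)
    qed
    also have "2 powr (real (d * j)) * 2 powr (- (real j * (real d + 1))) = 2 powr (- real j)"
    proof -
      have "real (d * j) + - (real j * (real d + 1)) = - real j" by (simp add: algebra_simps)
      then show ?thesis by (simp only: powr_add[symmetric])
    qed
    also have "\<dots> = (1 / 2) ^ j" by (simp add: powr_minus powr_realpow power_one_over inverse_eq_divide)
    finally show "real (card (K_set d j)) * (real (card (L_set d j)) * ?e j) \<le> 2 ^ d * C * (1 / 2) ^ j" .
  qed auto
  also have "\<dots> = ennreal (\<Sum>j. 2 ^ d * C * (1 / 2) ^ j) * ?m"
  proof -
    have "summable (\<lambda>j. 2 ^ d * C * (1 / 2) ^ j)" by (intro summable_mult summable_geometric) auto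
    then show ?thesis by (subst ennreal_suminf_multc) (simp add: suminf_ennreal2 C_def)
  qed
  also have "\<dots> < \<infinity>" using exponential_moment[of "2 * \<epsilon>"] assms by (simp add: ennreal_mult_less_top)
  finally show ?thesis .
qed

text \<open>A coefficient with \<open>|X|^p \<le> 2^(j \<delta> p)\<close> contributes at most \<open>exp \<epsilon>\<close>; for a larger one,
  \<open>\<epsilon> |X|^p \<le> 2 \<epsilon> |X|^p - \<epsilon> 2^(j \<delta> p)\<close>, so the supremum is dominated by a convergent sum.\<close>

lemma exp_zygmund_bound:
  assumes "b \<omega> = synthesis d \<phi> \<psi> (coef \<omega>)" "exp_sum \<delta> \<epsilon> \<omega> < \<infinity>" "0 < \<epsilon>" "0 < \<delta>" "t = s - real d / p - \<delta>"
  shows "bdd_above (zygmund_term d \<phi> \<psi> t (b \<omega>) ` I_Psi d)"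
    and "0 \<le> zygmund_norm d \<phi> \<psi> t (b \<omega>)"
    and "ennreal (exp (\<epsilon> * zygmund_norm d \<phi> \<psi> t (b \<omega>) powr p)) \<le> ennreal (exp \<epsilon>) + exp_sum \<delta> \<epsilon> \<omega>"
proof -
  let ?f = "\<lambda>\<nu>. exp (2 * \<epsilon> * \<bar>X \<nu> \<omega>\<bar> powr p - \<epsilon> * 2 powr (real (fst \<nu>) * \<delta> * p))"
  have sum: "?f summable_on I_Psi d" and eq: "ennreal (infsum ?f (I_Psi d)) = exp_sum \<delta> \<epsilon> \<omega>"
    using summable_on_if_nn_integral_finite[of "I_Psi d" ?f] assms(2) by (auto simp: exp_sum_def)
  \<comment> \<open>A majorant independent of \<nu>. The bound is inverted to (ln B /
    \<epsilon>)^(1/p) for each term, so that the supremum can be taken before exponentiating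
    again.\<close>
  define B where "B = exp \<epsilon> + infsum ?f (I_Psi d)"
  have f0: "0 \<le> infsum ?f (I_Psi d)" by (intro infsum_nonneg) simp
  then have B: "exp \<epsilon> \<le> B" by (simp add: B_def)
  then have B0: "0 < B" using exp_gt_zero[of \<epsilon>] by linarith
  have lnB: "0 \<le> ln B / \<epsilon>"
  proof -
    have "1 \<le> exp \<epsilon>" using assms(3) by simp
    with B have "1 \<le> B" by linarith
    then show ?thesis using assms(3) by (intro divide_nonneg_pos ln_ge_zero)
  qed
  have le: "zygmund_term d \<phi> \<psi> t (b \<omega>) \<nu> \<le> (ln B / \<epsilon>) powr (1 / p)" if \<nu>: "\<nu> \<in> I_Psi d" for \<nu>
  proof -
    let ?j = "real (fst \<nu>)" and ?x = "\<bar>X \<nu> \<omega>\<bar>"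
    let ?z = "zygmund_term d \<phi> \<psi> t (b \<omega>) \<nu>"
    have "?z = 2 powr (?j * (t + real d / 2)) * \<bar>coef \<omega> \<nu>\<bar>"
      unfolding assms(1) using synthesis_wavelet[OF \<nu>, of "coef \<omega>"] by (cases \<nu>) (simp add: zygmund_term_def)
    also have "\<dots> \<le> 2 powr (?j * (t + real d / 2)) * (eta d s p (fst \<nu>) * ?x)"
      by (intro mult_left_mono) (auto simp: coef_def abs_mult eta_def)
    \<comment> \<open>The weight of the norm and \<open>eta\<close> combine to 2^(-j \<delta>),
      where \<delta> is the gap between \<open>t\<close> and s - d/p.\<close>
    also have "\<dots> = 2 powr (- (?j * \<delta>)) * ?x"
    proof -
      have "?j * (t + real d / 2) + - (?j * (s + real d / 2 - real d / p)) = - (?j * \<delta>)"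
        by (simp add: assms(5) algebra_simps)
      then show ?thesis unfolding eta_def by (simp add: powr_add[symmetric] mult.assoc[symmetric])
    qed
    finally have "?z powr p \<le> (2 powr (- (?j * \<delta>)) * ?x) powr p"
      using p by (intro powr_mono2 zygmund_term_nonneg) auto
    also have "\<dots> = 2 powr (- (?j * \<delta> * p)) * ?x powr p" by (simp add: powr_mult powr_powr)
    finally have zp: "?z powr p \<le> 2 powr (- (?j * \<delta> * p)) * ?x powr p" .
    have "exp (\<epsilon> * ?z powr p) \<le> B"
    proof (cases "?x powr p \<le> 2 powr (?j * \<delta> * p)")
      case True
      then have "2 powr (- (?j * \<delta> * p)) * ?x powr p \<le> 2 powr (- (?j * \<delta> * p)) * 2 powr (?j * \<delta> * p)"
        by (intro mult_left_mono) auto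
      also have "\<dots> = 1" by (simp add: powr_minus)
      finally have "?z powr p \<le> 1" using zp by linarith
      then have "exp (\<epsilon> * ?z powr p) \<le> exp \<epsilon>" using assms(3) by simp
      with B show ?thesis by linarith
    next
      case False
      have "2 powr (- (?j * \<delta> * p)) \<le> 2 powr 0" using assms(4) p by (intro powr_mono) auto
      then have "2 powr (- (?j * \<delta> * p)) * ?x powr p \<le> 1 * ?x powr p" by (intro mult_right_mono) auto
      with zp have "?z powr p \<le> ?x powr p" by linarith
      with False have "?z powr p \<le> 2 * ?x powr p - 2 powr (?j * \<delta> * p)" by linarith
      then have "\<epsilon> * ?z powr p \<le> \<epsilon> * (2 * ?x powr p - 2 powr (?j * \<delta> * p))" using assms(3) by (intro mult_left_mono) auto
      then have "exp (\<epsilon> * ?z powr p) \<le> ?f \<nu>" by (simp add: algebra_simps)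
      also have "\<dots> \<le> infsum ?f (I_Psi d)" using finite_sum_le_infsum[OF sum, of "{\<nu>}"] \<nu> by simp
      also have "\<dots> \<le> B" by (simp add: B_def)
      finally show ?thesis .
    qed
    then have "\<epsilon> * ?z powr p \<le> ln B" using B0 by (simp add: ln_ge_iff)
    then have "?z powr p \<le> ln B / \<epsilon>" using assms(3) by (simp add: field_simps)
    then have "(?z powr p) powr (1 / p) \<le> (ln B / \<epsilon>) powr (1 / p)" using p by (intro powr_mono2) auto
    then show ?thesis using p zygmund_term_nonneg[of d \<phi> \<psi> t "b \<omega>" \<nu>] by (simp add: powr_powr)
  qed
  then show bdd: "bdd_above (zygmund_term d \<phi> \<psi> t (b \<omega>) ` I_Psi d)" by (auto intro!: bdd_aboveI2)
  obtain \<nu> where \<nu>: "\<nu> \<in> I_Psi d" using I_Psi_nonempty by blast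
  show nn: "0 \<le> zygmund_norm d \<phi> \<psi> t (b \<omega>)"
    unfolding zygmund_norm_def using cSUP_upper[OF \<nu> bdd] zygmund_term_nonneg[of d \<phi> \<psi> t "b \<omega>" \<nu>] by linarith
  have "zygmund_norm d \<phi> \<psi> t (b \<omega>) \<le> (ln B / \<epsilon>) powr (1 / p)"
    unfolding zygmund_norm_def using le by (intro cSUP_least I_Psi_nonempty)
  then have "zygmund_norm d \<phi> \<psi> t (b \<omega>) powr p \<le> ((ln B / \<epsilon>) powr (1 / p)) powr p"
    using nn p by (intro powr_mono2) auto
  also have "\<dots> = ln B / \<epsilon>" using p lnB by (simp add: powr_powr del: abs_divide)
  finally have "\<epsilon> * zygmund_norm d \<phi> \<psi> t (b \<omega>) powr p \<le> ln B" using assms(3) by (simp add: field_simps)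
  then have "exp (\<epsilon> * zygmund_norm d \<phi> \<psi> t (b \<omega>) powr p) \<le> B" using B0 by (simp add: ln_ge_iff)
  then have "ennreal (exp (\<epsilon> * zygmund_norm d \<phi> \<psi> t (b \<omega>) powr p)) \<le> ennreal B" by (rule ennreal_leI)
  also have "ennreal B = ennreal (exp \<epsilon>) + exp_sum \<delta> \<epsilon> \<omega>" using f0 eq by (simp add: B_def ennreal_plus)
  finally show "ennreal (exp (\<epsilon> * zygmund_norm d \<phi> \<psi> t (b \<omega>) powr p)) \<le> ennreal (exp \<epsilon>) + exp_sum \<delta> \<epsilon> \<omega>" .
qed

text \<open>The pointwise bound controls the size only. Measurability comes from an almost sure
  identity of the norm with a countable supremum of measurable coefficients, and from
  completeness.\<close>

lemma exponential_integrability: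
  assumes "complete_measure M" "t < s - real d / p" "0 < t" "0 < \<epsilon>" "\<epsilon> < 1 / (2 * \<kappa>)"
  shows "integrable M (\<lambda>\<omega>. exp (\<epsilon> * zygmund_norm d \<phi> \<psi> t (b \<omega>) powr p))"
proof -
  interpret complete_measure M by fact
  define \<delta> where "\<delta> = s - real d / p - t"
  have \<delta>: "0 < \<delta>" "t = s - real d / p - \<delta>" using assms by (auto simp: \<delta>_def)
  have "2 * \<epsilon> < 1 / \<kappa>" using assms(5) \<kappa> by (simp add: field_simps)
  note fin = expected_exp_sum_finite[OF \<delta>(1) assms(4) this]
  have "AE \<omega> in M. exp_sum \<delta> \<epsilon> \<omega> \<noteq> \<infinity>"
    using fin by (intro nn_integral_PInf_AE measurable_exp_sum) auto
  \<comment> \<open>From \<gamma> \<le> d and 0 < t < s - d/p follows the condition for convergence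
    of the series.\<close>
  moreover have "AE \<omega> in M. b \<omega> = synthesis d \<phi> \<psi> (coef \<omega>) \<and> synthesizable d (coef \<omega>)"
    using assms \<gamma> by (intro AE_synthesis) linarith
  ultimately have good: "AE \<omega> in M. b \<omega> = synthesis d \<phi> \<psi> (coef \<omega>) \<and> exp_sum \<delta> \<epsilon> \<omega> < \<infinity>"
    by eventually_elim (auto simp: less_top[symmetric])
  note bound = exp_zygmund_bound[OF _ _ assms(4) \<delta>]
  let ?h = "\<lambda>\<omega>. exp (\<epsilon> * zygmund_norm d \<phi> \<psi> t (b \<omega>) powr p)"
  let ?y = "\<lambda>\<omega> \<nu>. 2 powr (real (fst \<nu>) * (t + real d / 2)) * \<bar>coef \<omega> \<nu>\<bar>"
  have "?h \<in> borel_measurable M"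
  proof (rule borel_measurable_AE_eq)
    \<comment> \<open>In \<open>ennreal\<close> the supremum is measurable whether or not it is
      finite; where the terms are bounded it agrees with the real one.\<close>
    have "(\<lambda>\<omega>. SUP \<nu>\<in>I_Psi d. ennreal (?y \<omega> \<nu>)) \<in> borel_measurable M"
      using measurable_coef by (intro borel_measurable_SUP countable_I_Psi) measurable
    then show "(\<lambda>\<omega>. exp (\<epsilon> * enn2real (SUP \<nu>\<in>I_Psi d. ennreal (?y \<omega> \<nu>)) powr p)) \<in> borel_measurable M"
      by measurable
    show "AE \<omega> in M. exp (\<epsilon> * enn2real (SUP \<nu>\<in>I_Psi d. ennreal (?y \<omega> \<nu>)) powr p) = ?h \<omega>"
      using good
    proof eventually_elim
      case (elim \<omega>)
      have zt: "zygmund_term d \<phi> \<psi> t (b \<omega>) \<nu> = ?y \<omega> \<nu>" if "\<nu> \<in> I_Psi d" for \<nu>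
        using elim synthesis_wavelet[OF that, of "coef \<omega>"] by (cases \<nu>) (simp add: zygmund_term_def)
      have zn: "zygmund_norm d \<phi> \<psi> t (b \<omega>) = (SUP \<nu>\<in>I_Psi d. ?y \<omega> \<nu>)"
        unfolding zygmund_norm_def using zt by (rule SUP_cong[OF refl])
      have el: "b \<omega> = synthesis d \<phi> \<psi> (coef \<omega>)" "exp_sum \<delta> \<epsilon> \<omega> < \<infinity>" using elim by auto
      have "zygmund_term d \<phi> \<psi> t (b \<omega>) ` I_Psi d = ?y \<omega> ` I_Psi d" by (rule image_cong[OF refl zt])
      with bound(1)[OF el] have bdd: "bdd_above (?y \<omega> ` I_Psi d)" by (simp only:)
      have nn: "0 \<le> zygmund_norm d \<phi> \<psi> t (b \<omega>)" by (rule bound(2)[OF el])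
      have "(SUP \<nu>\<in>I_Psi d. ennreal (?y \<omega> \<nu>)) \<le> ennreal (SUP \<nu>\<in>I_Psi d. ?y \<omega> \<nu>)"
        by (intro SUP_least ennreal_leI cSUP_upper bdd)
      then have "(SUP \<nu>\<in>I_Psi d. ennreal (?y \<omega> \<nu>)) \<noteq> \<top>" by (rule neq_top_trans[OF ennreal_neq_top])
      from ennreal_SUP[OF this I_Psi_nonempty]
      have "(SUP \<nu>\<in>I_Psi d. ennreal (?y \<omega> \<nu>)) = ennreal (zygmund_norm d \<phi> \<psi> t (b \<omega>))"
        unfolding zn by (rule sym)
      then have "enn2real (SUP \<nu>\<in>I_Psi d. ennreal (?y \<omega> \<nu>)) = zygmund_norm d \<phi> \<psi> t (b \<omega>)"
        using nn by (simp only: enn2real_ennreal)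
      then show ?case by (simp only:)
    qed
  qed
  moreover have "(\<integral>\<^sup>+\<omega>. ennreal (?h \<omega>) \<partial>M) < \<infinity>"
  proof -
    have "(\<integral>\<^sup>+\<omega>. ennreal (?h \<omega>) \<partial>M) \<le> (\<integral>\<^sup>+\<omega>. ennreal (exp \<epsilon>) + exp_sum \<delta> \<epsilon> \<omega> \<partial>M)"
      by (rule nn_integral_mono_AE) (use good in eventually_elim, use bound(3) in blast)
    also have "\<dots> = ennreal (exp \<epsilon>) + (\<integral>\<^sup>+\<omega>. exp_sum \<delta> \<epsilon> \<omega> \<partial>M)"
      by (subst nn_integral_add) (auto simp: emeasure_space_1 measurable_exp_sum)
    also have "\<dots> < \<infinity>" using fin by simp
    finally show ?thesis .
  qed
  ultimately show ?thesis by (intro integrableI_nonneg) auto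
qed

end

theorem theorem2p11:
  fixes d :: nat and s p \<gamma> \<kappa> \<alpha> :: real
    and \<phi> \<psi> :: "real \<Rightarrow> real"
    and M :: "'w measure"
    and X :: "windex \<Rightarrow> 'w \<Rightarrow> real"
    and T :: "'w \<Rightarrow> nat list set"
    and m :: nat
    and b :: "'w \<Rightarrow> functional"
  assumes "1 \<le> d" and "0 < s" and "1 \<le> p" and "\<gamma> \<le> real d"
    and "1 \<le> \<alpha>" and "s \<le> \<alpha>" and "wavelet_system \<alpha> \<phi> \<psi>"
    and "prob_space M" and "complete_measure M" and "0 < \<kappa>"
    and "besov_tree_data M d p \<kappa> (2 powr (\<gamma> - real d)) X T"
    and "m = nat \<lfloor>\<alpha>\<rfloor>"
    and "b = b_tree d m s p \<phi> \<psi> X T"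
  shows
    "(\<forall>t q. 0 < t \<and> 1 \<le> q \<and> t < s + (real d - \<gamma>) / q - real d / p \<longrightarrow>
        b \<in> bochner_Lq M q (besov_space d m \<phi> \<psi> t q) (besov_norm d \<phi> \<psi> t q) \<and>
        (AE \<omega> in M. b \<omega> \<in> besov_space d m \<phi> \<psi> t q))
     \<and>
     (0 < s - real d / p \<longrightarrow>
        (\<forall>t. 0 < t \<and> t < s - real d / p \<longrightarrow>
          (\<exists>\<epsilon>p>0. \<forall>\<epsilon>. 0 < \<epsilon> \<and> \<epsilon> < \<epsilon>p \<longrightarrow>
             integrable M (\<lambda>\<omega>. exp (\<epsilon> * zygmund_norm d \<phi> \<psi> t (b \<omega>) powr p))) \<and>
          (\<forall>q\<ge>1. b \<in> bochner_Lq M q (zygmund_space d m \<phi> \<psi> t) (zygmund_norm d \<phi> \<psi> t))))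
     \<and>
     (\<forall>q\<ge>1. 0 < s - real d / p - min \<gamma> 0 / q \<longrightarrow>
        (\<forall>t. 0 < t \<and> t < s - real d / p - min \<gamma> 0 / q \<longrightarrow>
          b \<in> bochner_Lq M q (zygmund_space d m \<phi> \<psi> t) (zygmund_norm d \<phi> \<psi> t)))"
proof -
  interpret prior: besov_prior M d p \<kappa> \<gamma> X T \<alpha> \<phi> \<psi> s m
    using assms by (simp add: besov_prior_def besov_tree_def besov_tree_axioms_def wavelet_pair_def)
  have b: "b = prior.b" using assms(13) by (simp add: prior.b_def)
  \<comment> \<open>Since min \<gamma> 0 / q is nonpositive, the Bochner claim of the second part is
    an instance of the third.\<close>
  have "t < s - real d / p - min \<gamma> 0 / q" if "t < s - real d / p" "1 \<le> q" for t q
  proof -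
    have "min \<gamma> 0 / q \<le> 0" using that by (simp add: divide_nonpos_pos)
    with that show ?thesis by linarith
  qed
  then show ?thesis unfolding b
    using prior.besov_regularity prior.zygmund_regularity
      prior.exponential_integrability[OF assms(9)] assms(10)
    by (auto intro!: exI[of _ "1 / (2 * \<kappa>)"])
qed

end
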